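(* Let $(\Omega,\mathcal E,P)$ be a probability space, $\mathcal F$ a $\sigma$-subalgebra of $\mathcal E$, $1\le r\le p<+\infty$, $q$ the Hölder conjugate number of $p$, $f:L^p(\mathcal E)\to L^r(\mathcal F)$ an $L^0(\mathcal F)$-convex $L^p$-conditional risk measure, and $\bar f:L^p_{\mathcal F}(\mathcal E)\to L^0(\mathcal F)$ the unique $L^0(\mathcal F)$-convex $L^p_{\mathcal F}(\mathcal E)$-conditional risk measure with $\bar f|_{L^p(\mathcal E)}=f$. Then the following statements are equivalent: (1) $f(x)=\bigvee\{E(xy|\mathcal F)-f^*(y): y\in L^q(\mathcal E),\ y\le0,\ E(|y|^q|\mathcal F)\in L^\infty(\mathcal F)\text{ and }E(y|\mathcal F)=-1\}$ for all $x\in L^p(\mathcal E)$. (2) For any given positive number $\gamma$, $f(x)=\bigvee\{E(xy|\mathcal F)-f^*(y): y\in L^q(\mathcal E),\ y\le0,\ E(|y|^q|\mathcal F)\in L^\gamma(\mathcal F)\text{ and }E(y|\mathcal F)=-1\}$ for all $x\in L^p(\mathcal E)$. (3) $f(x)=\bigvee\{E(xy|\mathcal F)-f^*(y): y\in L^q(\mathcal E),\ y\le0,\ E(|y|^q|\mathcal F)\in L^{\frac{r(p-1)}{p-r}}(\mathcal F)\text{ and }E(y|\mathcal F)=-1\}$ for all $x\in L^p(\mathcal E)$, where $\frac{r(p-1)}{p-r}=+\infty$ when $p=r$. (4) $f(x)=\bigvee\{E(xy|\mathcal F)-f^*(y): y\in L^q_{\mathcal F}(\mathcal E),\ y\le0\text{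 and }E(y|\mathcal F)=-1\}$ for all $x\in L^p(\mathcal E)$. (5) $\bar f(x)=\bigvee\{E(xy|\mathcal F)-\bar f^*(y): y\in L^q_{\mathcal F}(\mathcal E),\ y\le0\text{ and }E(y|\mathcal F)=-1\}$ for all $x\in L^p_{\mathcal F}(\mathcal E)$. (6) $\bar f$ is $\mathcal T_{\varepsilon,\lambda}$-lower semicontinuous (or, equivalently, $\mathcal T_c$-lower semicontinuous). (7) $\bar f$ is continuous from $(L^p_{\mathcal F}(\mathcal E),\mathcal T_c)$ to $(L^0(\mathcal F),\mathcal T_c)$.
   Context: $L^0(\mathcal E)$, $L^0(\mathcal F)$ are the algebras of (a.s.-equality) equivalence classes of real $\mathcal E$-, respectively $\mathcal F$-, measurable random variables with the a.s. order; $L^0_+(\mathcal F)$, $L^0_{++}(\mathcal F)$ are the elements of $L^0(\mathcal F)$ that are $\ge0$, respectively $>0$, a.s. $\bar L^0(\mathcal F)$ is the complete lattice of classes of $[-\infty,\infty]$-valued $\mathcal F$-measurable functions, $\bar L^0_+(\mathcal F)$ its nonnegative elements; $\bigvee,\bigwedge$ are taken there. $L^p(\mathcal E)$, $L^r(\mathcal F)$, etc. are the usual Lebesgue spaces ($L^\gamma(\mathcal F)=\{\xi\in L^0(\mathcal F):E|\xi|^\gamma<\infty\}$ for $0<\gamma<\infty$). For $x\in L^0(\mathcal E)$ and $1\le s<\infty$, $|||x|||_s=E[|x|^s|\mathcal F]^{1/s}$; $|||x|||_\infty=\bigwedge\{\xi\in\bar L^0_+(\mathcal F):|x|\le\xi\}$;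 $L^s_{\mathcal F}(\mathcal E)=\{x\in L^0(\mathcal E):|||x|||_s\in L^0_+(\mathcal F)\}$ for $1\le s\le\infty$. For $z\in L^1_{\mathcal F}(\mathcal E)$, $E(z|\mathcal F)=E(z^+|\mathcal F)-E(z^-|\mathcal F)\in L^0(\mathcal F)$; $xy\in L^1_{\mathcal F}(\mathcal E)$ for $x\in L^p_{\mathcal F}(\mathcal E)$, $y\in L^q_{\mathcal F}(\mathcal E)$. When $p=1$, $q=+\infty$, the condition on $E(|y|^q|\mathcal F)$ is read as the corresponding condition on $|||y|||_\infty$ (automatically satisfied for $y\in L^\infty(\mathcal E)$). An $L^p$-conditional risk measure is a function $f:L^p(\mathcal E)\to L^r(\mathcal F)$ with $f(x)\le f(y)$ whenever $x\ge y$, and $f(x+y)=f(x)-y$ for $x\in L^p(\mathcal E)$, $y\in L^p(\mathcal F)$. A function $\bar f:L^p_{\mathcal F}(\mathcal E)\to L^0(\mathcal F)$ is an $L^p_{\mathcal F}(\mathcal E)$-conditional risk measure if $\bar f(x)\le\bar f(y)$ whenever $x\ge y$, and $\bar f(x+y)=\bar f(x)-y$ for $x\in L^p_{\mathcal F}(\mathcal E)$, $y\in L^0(\mathcal F)$. Such functions are $L^0(\mathcal F)$-convex if $f(\xi x+(1-\xi)y)\le\xi f(x)+(1-\xi)f(y)$ for all $x,y$ in the domain and $\xi\in L^0_+(\mathcal F)$ with $0\le\xi\le1$. The extension $\bar f$ in the claim exists and is unique. For $y\in L^q_{\mathcal F}(\mathcal E)$: $f^*(y)=\bigvee\{E(xy|\mathcal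 F)-f(x):x\in L^p(\mathcal E)\}$ and $\bar f^*(y)=\bigvee\{E(xy|\mathcal F)-\bar f(x):x\in L^p_{\mathcal F}(\mathcal E)\}$. $\mathcal T_{\varepsilon,\lambda}$ on $L^p_{\mathcal F}(\mathcal E)$ is the linear topology with local base at $0$ consisting of $\{x:P\{|||x|||_p<\varepsilon\}>1-\lambda\}$, $\varepsilon>0$, $0<\lambda<1$ real; on $L^0(\mathcal F)$ it is the topology of convergence in probability. $\mathcal T_c$ on $L^p_{\mathcal F}(\mathcal E)$ has local base at $0$ consisting of $\{x:|||x|||_p\le\varepsilon\}$, $\varepsilon\in L^0_{++}(\mathcal F)$; $\mathcal T_c$ on $L^0(\mathcal F)$ is defined likewise with $|\cdot|$. $\bar f$ is $\mathcal T_{\varepsilon,\lambda}$-lower semicontinuous if $\{(x,s):s\in L^0(\mathcal F),\bar f(x)\le s\}$ is closed in $(L^p_{\mathcal F}(\mathcal E),\mathcal T_{\varepsilon,\lambda})\times(L^0(\mathcal F),\mathcal T_{\varepsilon,\lambda})$; $\mathcal T_c$-lower semicontinuous if $\{x:\bar f(x)\le s\}$ is $\mathcal T_c$-closed for every $s\in L^0(\mathcal F)$. *)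

theory Defs
  imports "HOL-Probability.Probability"
begin

text \<open>
  Random variables are represented by measurable functions and all relations between them
  are understood almost surely with respect to \<open>M\<close>; the sub-\<open>\<sigma>\<close>-algebra is given by a measure
  \<open>F\<close> with \<^prop>\<open>subalgebra M F\<close>, of which only \<open>sets F\<close> and \<open>space F\<close> are used.
  Operations on equivalence classes are operations on representatives that respect
  almost sure equality.
\<close>

abbreviation L0 :: "'a measure \<Rightarrow> ('a \<Rightarrow> real) set" where
  "L0 G \<equiv> borel_measurable G"

definition L0_pp :: "'a measure \<Rightarrow> 'a measure \<Rightarrow> ('a \<Rightarrow> real) set" where
  "L0_pp M F = {\<epsilon> \<in> L0 F. AE \<omega> in M. 0 < \<epsilon> \<omega>}"

definition Lp :: "'a measure \<Rightarrow> 'a measure \<Rightarrow> ereal \<Rightarrow> ('a \<Rightarrow> real) set" where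
  "Lp M G s = {x \<in> L0 G.
     if s = \<infinity> then \<exists>C. AE \<omega> in M. \<bar>x \<omega>\<bar> \<le> C
     else integrable M (\<lambda>\<omega>. \<bar>x \<omega>\<bar> powr real_of_ereal s)}"

text \<open>
  Suprema and infima in the complete lattice of classes of extended-real \<open>F\<close>-measurable functions.
  For a set of \<open>F\<close>-measurable functions they exist and are unique up to almost sure equality,
  so that the choice only selects a representative.
\<close>

definition L0_Sup :: "'a measure \<Rightarrow> 'a measure \<Rightarrow> ('a \<Rightarrow> ereal) set \<Rightarrow> 'a \<Rightarrow> ereal" where
  "L0_Sup M F S = (SOME g. g \<in> borel_measurable F \<and>
     (\<forall>h\<in>S. AE \<omega> in M. h \<omega> \<le> g \<omega>) \<and>
     (\<forall>k\<in>borel_measurable F. (\<forall>h\<in>S. AE \<omega> in M. h \<omega> \<le> k \<omega>) \<longrightarrow> (AE \<omega> in M. g \<omega> \<le> k \<omega>)))"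

definition L0_Inf :: "'a measure \<Rightarrow> 'a measure \<Rightarrow> ('a \<Rightarrow> ereal) set \<Rightarrow> 'a \<Rightarrow> ereal" where
  "L0_Inf M F S = (SOME g. g \<in> borel_measurable F \<and>
     (\<forall>h\<in>S. AE \<omega> in M. g \<omega> \<le> h \<omega>) \<and>
     (\<forall>k\<in>borel_measurable F. (\<forall>h\<in>S. AE \<omega> in M. k \<omega> \<le> h \<omega>) \<longrightarrow> (AE \<omega> in M. k \<omega> \<le> g \<omega>)))"

definition ennreal_root :: "real \<Rightarrow> ennreal \<Rightarrow> ereal" where
  "ennreal_root s a = (if a = \<infinity> then \<infinity> else ereal (enn2real a powr (1 / s)))"

definition cond_norm :: "'a measure \<Rightarrow> 'a measure \<Rightarrow> ereal \<Rightarrow> ('a \<Rightarrow> real) \<Rightarrow> 'a \<Rightarrow> ereal" where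
  "cond_norm M F s x =
     (if s = \<infinity> then
        L0_Inf M F {\<xi> \<in> borel_measurable F.
          (AE \<omega> in M. 0 \<le> \<xi> \<omega>) \<and> (AE \<omega> in M. ereal \<bar>x \<omega>\<bar> \<le> \<xi> \<omega>)}
      else (\<lambda>\<omega>. ennreal_root (real_of_ereal s)
             (nn_cond_exp M F (\<lambda>\<omega>. ennreal (\<bar>x \<omega>\<bar> powr real_of_ereal s)) \<omega>)))"

definition LFp :: "'a measure \<Rightarrow> 'a measure \<Rightarrow> ereal \<Rightarrow> ('a \<Rightarrow> real) set" where
  "LFp M F s = {x \<in> L0 M. AE \<omega> in M. cond_norm M F s x \<omega> < \<infinity>}"

text \<open>
  For measurable \<open>z\<close>, \<^term>\<open>real_cond_exp M F z\<close> is the difference of the generalised conditional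
  expectations of the positive and the negative part wherever these are finite; for \<open>z\<close> in
  \<^term>\<open>LFp M F 1\<close>, integrable or not, that is almost everywhere.

  For \<open>s = \<infinity>\<close> the conditional moment \<open>E(\<bar>y\<bar>\<^sup>s | F)\<close> is read as the conditional norm of \<open>y\<close>.
\<close>

definition cond_moment :: "'a measure \<Rightarrow> 'a measure \<Rightarrow> ereal \<Rightarrow> ('a \<Rightarrow> real) \<Rightarrow> 'a \<Rightarrow> real" where
  "cond_moment M F s y =
     (if s = \<infinity> then (\<lambda>\<omega>. real_of_ereal (cond_norm M F \<infinity> y \<omega>))
      else real_cond_exp M F (\<lambda>\<omega>. \<bar>y \<omega>\<bar> powr real_of_ereal s))"

text \<open>
  \<open>X\<close> is the domain, \<open>Y\<close> the space of admissible translations, \<open>Z\<close> the codomain.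
  Monotonicity for the almost sure order makes \<open>f\<close> respect almost sure equality on \<open>X\<close>.
\<close>

definition cond_risk_measure ::
  "'a measure \<Rightarrow> ('a \<Rightarrow> real) set \<Rightarrow> ('a \<Rightarrow> real) set \<Rightarrow> ('a \<Rightarrow> real) set
    \<Rightarrow> (('a \<Rightarrow> real) \<Rightarrow> 'a \<Rightarrow> real) \<Rightarrow> bool" where
  "cond_risk_measure M X Y Z f \<longleftrightarrow>
     (\<forall>x\<in>X. f x \<in> Z) \<and>
     (\<forall>x\<in>X. \<forall>y\<in>X. (AE \<omega> in M. y \<omega> \<le> x \<omega>) \<longrightarrow> (AE \<omega> in M. f x \<omega> \<le> f y \<omega>)) \<and>
     (\<forall>x\<in>X. \<forall>y\<in>Y. AE \<omega> in M. f (\<lambda>\<omega>. x \<omega> + y \<omega>) \<omega> = f x \<omega> - y \<omega>)"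

definition Lp_cond_risk_measure ::
  "'a measure \<Rightarrow> 'a measure \<Rightarrow> real \<Rightarrow> real \<Rightarrow> (('a \<Rightarrow> real) \<Rightarrow> 'a \<Rightarrow> real) \<Rightarrow> bool" where
  "Lp_cond_risk_measure M F p r f \<longleftrightarrow>
     cond_risk_measure M (Lp M M (ereal p)) (Lp M F (ereal p)) (Lp M F (ereal r)) f"

definition LFp_cond_risk_measure ::
  "'a measure \<Rightarrow> 'a measure \<Rightarrow> real \<Rightarrow> (('a \<Rightarrow> real) \<Rightarrow> 'a \<Rightarrow> real) \<Rightarrow> bool" where
  "LFp_cond_risk_measure M F p f \<longleftrightarrow> cond_risk_measure M (LFp M F (ereal p)) (L0 F) (L0 F) f"

definition L0_convex ::
  "'a measure \<Rightarrow> 'a measure \<Rightarrow> ('a \<Rightarrow> real) set \<Rightarrow> (('a \<Rightarrow> real) \<Rightarrow> 'a \<Rightarrow> real) \<Rightarrow> bool" where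
  "L0_convex M F X f \<longleftrightarrow>
     (\<forall>x\<in>X. \<forall>y\<in>X. \<forall>\<xi>\<in>L0 F. (AE \<omega> in M. 0 \<le> \<xi> \<omega> \<and> \<xi> \<omega> \<le> 1) \<longrightarrow>
        (AE \<omega> in M. f (\<lambda>\<omega>. \<xi> \<omega> * x \<omega> + (1 - \<xi> \<omega>) * y \<omega>) \<omega>
                      \<le> \<xi> \<omega> * f x \<omega> + (1 - \<xi> \<omega>) * f y \<omega>))"

definition cond_conjugate ::
  "'a measure \<Rightarrow> 'a measure \<Rightarrow> ('a \<Rightarrow> real) set \<Rightarrow> (('a \<Rightarrow> real) \<Rightarrow> 'a \<Rightarrow> real)
    \<Rightarrow> ('a \<Rightarrow> real) \<Rightarrow> 'a \<Rightarrow> ereal" where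
  "cond_conjugate M F X f y =
     L0_Sup M F {(\<lambda>\<omega>. ereal (real_cond_exp M F (\<lambda>\<omega>. x \<omega> * y \<omega>) \<omega> - f x \<omega>)) | x. x \<in> X}"

definition dual_elements :: "'a measure \<Rightarrow> 'a measure \<Rightarrow> ('a \<Rightarrow> real) set \<Rightarrow> ('a \<Rightarrow> real) set" where
  "dual_elements M F Y =
     {y \<in> Y. (AE \<omega> in M. y \<omega> \<le> 0) \<and> (AE \<omega> in M. real_cond_exp M F y \<omega> = - 1)}"

definition dual_representation ::
  "'a measure \<Rightarrow> 'a measure \<Rightarrow> ('a \<Rightarrow> real) set \<Rightarrow> (('a \<Rightarrow> real) \<Rightarrow> 'a \<Rightarrow> real)
    \<Rightarrow> ('a \<Rightarrow> real) set \<Rightarrow> bool" where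
  "dual_representation M F X f Y \<longleftrightarrow>
     (\<forall>x\<in>X. AE \<omega> in M. ereal (f x \<omega>) =
        L0_Sup M F {(\<lambda>\<omega>. ereal (real_cond_exp M F (\<lambda>\<omega>. x \<omega> * y \<omega>) \<omega>) - cond_conjugate M F X f y \<omega>)
                    | y. y \<in> dual_elements M F Y} \<omega>)"

text \<open>
  The translation-invariant topology on \<open>S\<close> with local base \<open>\<N>\<close> at the origin. On
  representatives it is not Hausdorff; its open sets are the preimages of those of the quotient.
\<close>

definition local_base_topology ::
  "('a \<Rightarrow> real) set \<Rightarrow> ('a \<Rightarrow> real) set set \<Rightarrow> ('a \<Rightarrow> real) topology" where
  "local_base_topology S \<N> =
     topology (\<lambda>U. U \<subseteq> S \<and> (\<forall>x\<in>U. \<exists>N\<in>\<N>. \<forall>z\<in>S. (\<lambda>\<omega>. z \<omega> - x \<omega>) \<in> N \<longrightarrow> z \<in> U))"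

definition Teps_nhds_LFp :: "'a measure \<Rightarrow> 'a measure \<Rightarrow> real \<Rightarrow> ('a \<Rightarrow> real) set set" where
  "Teps_nhds_LFp M F p =
     {{x \<in> LFp M F (ereal p). \<P>(\<omega> in M. cond_norm M F (ereal p) x \<omega> < ereal \<epsilon>) > 1 - \<delta>} | \<epsilon> \<delta>.
        0 < \<epsilon> \<and> 0 < \<delta> \<and> \<delta> < 1}"

definition Teps_nhds_L0 :: "'a measure \<Rightarrow> 'a measure \<Rightarrow> ('a \<Rightarrow> real) set set" where
  "Teps_nhds_L0 M F =
     {{x \<in> L0 F. \<P>(\<omega> in M. \<bar>x \<omega>\<bar> < \<epsilon>) > 1 - \<delta>} | \<epsilon> \<delta>. 0 < \<epsilon> \<and> 0 < \<delta> \<and> \<delta> < 1}"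

definition Tc_nhds_LFp :: "'a measure \<Rightarrow> 'a measure \<Rightarrow> real \<Rightarrow> ('a \<Rightarrow> real) set set" where
  "Tc_nhds_LFp M F p =
     {{x \<in> LFp M F (ereal p). AE \<omega> in M. cond_norm M F (ereal p) x \<omega> \<le> ereal (\<epsilon> \<omega>)} | \<epsilon>.
        \<epsilon> \<in> L0_pp M F}"

definition Tc_nhds_L0 :: "'a measure \<Rightarrow> 'a measure \<Rightarrow> ('a \<Rightarrow> real) set set" where
  "Tc_nhds_L0 M F = {{x \<in> L0 F. AE \<omega> in M. \<bar>x \<omega>\<bar> \<le> \<epsilon> \<omega>} | \<epsilon>. \<epsilon> \<in> L0_pp M F}"

definition Teps_LFp :: "'a measure \<Rightarrow> 'a measure \<Rightarrow> real \<Rightarrow> ('a \<Rightarrow> real) topology" where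
  "Teps_LFp M F p = local_base_topology (LFp M F (ereal p)) (Teps_nhds_LFp M F p)"

definition Teps_L0 :: "'a measure \<Rightarrow> 'a measure \<Rightarrow> ('a \<Rightarrow> real) topology" where
  "Teps_L0 M F = local_base_topology (L0 F) (Teps_nhds_L0 M F)"

definition Tc_LFp :: "'a measure \<Rightarrow> 'a measure \<Rightarrow> real \<Rightarrow> ('a \<Rightarrow> real) topology" where
  "Tc_LFp M F p = local_base_topology (LFp M F (ereal p)) (Tc_nhds_LFp M F p)"

definition Tc_L0 :: "'a measure \<Rightarrow> 'a measure \<Rightarrow> ('a \<Rightarrow> real) topology" where
  "Tc_L0 M F = local_base_topology (L0 F) (Tc_nhds_L0 M F)"

definition Teps_lsc ::
  "'a measure \<Rightarrow> 'a measure \<Rightarrow> real \<Rightarrow> (('a \<Rightarrow> real) \<Rightarrow> 'a \<Rightarrow> real) \<Rightarrow> bool" where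
  "Teps_lsc M F p f \<longleftrightarrow>
     closedin (prod_topology (Teps_LFp M F p) (Teps_L0 M F))
       {(x, s). x \<in> LFp M F (ereal p) \<and> s \<in> L0 F \<and> (AE \<omega> in M. f x \<omega> \<le> s \<omega>)}"

definition Tc_lsc ::
  "'a measure \<Rightarrow> 'a measure \<Rightarrow> real \<Rightarrow> (('a \<Rightarrow> real) \<Rightarrow> 'a \<Rightarrow> real) \<Rightarrow> bool" where
  "Tc_lsc M F p f \<longleftrightarrow>
     (\<forall>s\<in>L0 F. closedin (Tc_LFp M F p) {x \<in> LFp M F (ereal p). AE \<omega> in M. f x \<omega> \<le> s \<omega>})"

text \<open>The four predicates defining these topologies do satisfy the axioms of a topology.\<close>

lemma openin_local_base_topology:
  assumes "\<And>A B. A \<in> \<N> \<Longrightarrow> B \<in> \<N> \<Longrightarrow> \<exists>C\<in>\<N>. C \<subseteq> A \<inter> B"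
  shows "openin (local_base_topology S \<N>) U \<longleftrightarrow>
     U \<subseteq> S \<and> (\<forall>x\<in>U. \<exists>N\<in>\<N>. \<forall>z\<in>S. (\<lambda>\<omega>. z \<omega> - x \<omega>) \<in> N \<longrightarrow> z \<in> U)"
proof -
  define L where "L = (\<lambda>U. U \<subseteq> S \<and> (\<forall>x\<in>U. \<exists>N\<in>\<N>. \<forall>z\<in>S. (\<lambda>\<omega>. z \<omega> - x \<omega>) \<in> N \<longrightarrow> z \<in> U))"
  have "L (U \<inter> V)" if U: "L U" and V: "L V" for U V
    unfolding L_def
  proof (intro conjI ballI)
    show "U \<inter> V \<subseteq> S" using U unfolding L_def by (simp add: le_infI1)
    fix x assume x: "x \<in> U \<inter> V"
    obtain A where A: "A \<in> \<N>" "\<forall>z\<in>S. (\<lambda>\<omega>. z \<omega> - x \<omega>) \<in> A \<longrightarrow> z \<in> U"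
      using U x unfolding L_def by (meson IntD1)
    obtain B where B: "B \<in> \<N>" "\<forall>z\<in>S. (\<lambda>\<omega>. z \<omega> - x \<omega>) \<in> B \<longrightarrow> z \<in> V"
      using V x unfolding L_def by (meson IntD2)
    from assms[OF A(1) B(1)] obtain C where C: "C \<in> \<N>" "C \<subseteq> A \<inter> B" by (elim bexE)
    have "z \<in> U \<inter> V" if "z \<in> S" "(\<lambda>\<omega>. z \<omega> - x \<omega>) \<in> C" for z
      using A(2) B(2) subsetD[OF C(2) that(2)] that(1) by simp
    with C(1) show "\<exists>N\<in>\<N>. \<forall>z\<in>S. (\<lambda>\<omega>. z \<omega> - x \<omega>) \<in> N \<longrightarrow> z \<in> U \<inter> V"
      by (intro bexI[of _ C] ballI impI)
  qed
  moreover have "L (\<Union>K)" if K: "\<forall>U\<in>K. L U" for K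
    unfolding L_def
  proof (intro conjI ballI)
    show "\<Union>K \<subseteq> S" using K unfolding L_def by (simp add: Sup_le_iff)
    fix x assume "x \<in> \<Union>K"
    then obtain U where U: "U \<in> K" "x \<in> U" by (elim UnionE)
    with K obtain N where N: "N \<in> \<N>" "\<forall>z\<in>S. (\<lambda>\<omega>. z \<omega> - x \<omega>) \<in> N \<longrightarrow> z \<in> U"
      unfolding L_def by meson
    then show "\<exists>N\<in>\<N>. \<forall>z\<in>S. (\<lambda>\<omega>. z \<omega> - x \<omega>) \<in> N \<longrightarrow> z \<in> \<Union>K"
      using UnionI[OF U(1)] by (intro bexI[of _ N]) simp_all
  qed
  ultimately have "istopology L"
    unfolding istopology_def by simp
  moreover have "local_base_topology S \<N> = topology L"
    unfolding local_base_topology_def L_def ..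
  ultimately have "openin (local_base_topology S \<N>) U \<longleftrightarrow> L U"
    by (simp only: topology_inverse')
  then show ?thesis
    unfolding L_def .
qed

lemma L0_pp_min:
  assumes "\<epsilon> \<in> L0_pp M F" "\<delta> \<in> L0_pp M F"
  shows "(\<lambda>\<omega>. min (\<epsilon> \<omega>) (\<delta> \<omega>)) \<in> L0_pp M F"
  using assms unfolding L0_pp_def by auto

lemma borel_measurable_cond_norm:
  "cond_norm M F (ereal p) x \<in> borel_measurable F"
  unfolding cond_norm_def ennreal_root_def by simp

lemma Tc_nhds_LFp_Int:
  assumes "A \<in> Tc_nhds_LFp M F p" "B \<in> Tc_nhds_LFp M F p"
  shows "\<exists>C\<in>Tc_nhds_LFp M F p. C \<subseteq> A \<inter> B"
proof -
  let ?N = "\<lambda>\<epsilon>. {x \<in> LFp M F (ereal p). AE \<omega> in M. cond_norm M F (ereal p) x \<omega> \<le> ereal (\<epsilon> \<omega>)}"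
  obtain \<epsilon> \<delta> where *: "\<epsilon> \<in> L0_pp M F" "\<delta> \<in> L0_pp M F" "A = ?N \<epsilon>" "B = ?N \<delta>"
    using assms unfolding Tc_nhds_LFp_def by blast
  have "?N (\<lambda>\<omega>. min (\<epsilon> \<omega>) (\<delta> \<omega>)) \<in> Tc_nhds_LFp M F p"
    unfolding Tc_nhds_LFp_def
    by (rule CollectI, intro exI conjI, rule refl, rule L0_pp_min[OF *(1,2)])
  moreover have "?N (\<lambda>\<omega>. min (\<epsilon> \<omega>) (\<delta> \<omega>)) \<subseteq> A \<inter> B"
  proof
    fix x assume "x \<in> ?N (\<lambda>\<omega>. min (\<epsilon> \<omega>) (\<delta> \<omega>))"
    then have x: "x \<in> LFp M F (ereal p)" and le: "AE \<omega> in M. cond_norm M F (ereal p) x \<omega> \<le> ereal (min (\<epsilon> \<omega>) (\<delta> \<omega>))"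
      by auto
    from le have "AE \<omega> in M. cond_norm M F (ereal p) x \<omega> \<le> ereal (\<epsilon> \<omega>)"
      by eventually_elim (erule order_trans, simp)
    moreover from le have "AE \<omega> in M. cond_norm M F (ereal p) x \<omega> \<le> ereal (\<delta> \<omega>)"
      by eventually_elim (erule order_trans, simp)
    ultimately show "x \<in> A \<inter> B" unfolding * using x by blast
  qed
  ultimately show ?thesis by blast
qed

lemma Tc_nhds_L0_Int:
  assumes "A \<in> Tc_nhds_L0 M F" "B \<in> Tc_nhds_L0 M F"
  shows "\<exists>C\<in>Tc_nhds_L0 M F. C \<subseteq> A \<inter> B"
proof -
  let ?N = "\<lambda>\<epsilon>. {x \<in> L0 F. AE \<omega> in M. \<bar>x \<omega>\<bar> \<le> \<epsilon> \<omega>}"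
  obtain \<epsilon> \<delta> where *: "\<epsilon> \<in> L0_pp M F" "\<delta> \<in> L0_pp M F" "A = ?N \<epsilon>" "B = ?N \<delta>"
    using assms unfolding Tc_nhds_L0_def by blast
  have "?N (\<lambda>\<omega>. min (\<epsilon> \<omega>) (\<delta> \<omega>)) \<in> Tc_nhds_L0 M F"
    unfolding Tc_nhds_L0_def
    by (rule CollectI, intro exI conjI, rule refl, rule L0_pp_min[OF *(1,2)])
  moreover have "?N (\<lambda>\<omega>. min (\<epsilon> \<omega>) (\<delta> \<omega>)) \<subseteq> A \<inter> B"
  proof
    fix x assume "x \<in> ?N (\<lambda>\<omega>. min (\<epsilon> \<omega>) (\<delta> \<omega>))"
    then have x: "x \<in> L0 F" and le: "AE \<omega> in M. \<bar>x \<omega>\<bar> \<le> min (\<epsilon> \<omega>) (\<delta> \<omega>)"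
      by auto
    from le have "AE \<omega> in M. \<bar>x \<omega>\<bar> \<le> \<epsilon> \<omega>"
      by eventually_elim (erule order_trans, simp)
    moreover from le have "AE \<omega> in M. \<bar>x \<omega>\<bar> \<le> \<delta> \<omega>"
      by eventually_elim (erule order_trans, simp)
    ultimately show "x \<in> A \<inter> B" unfolding * using x by blast
  qed
  ultimately show ?thesis by blast
qed

lemma Teps_nhds_LFp_Int:
  assumes "prob_space M" "subalgebra M F" "A \<in> Teps_nhds_LFp M F p" "B \<in> Teps_nhds_LFp M F p"
  shows "\<exists>C\<in>Teps_nhds_LFp M F p. C \<subseteq> A \<inter> B"
proof -
  interpret prob_space M by fact
  let ?P = "\<lambda>x \<epsilon>. \<P>(\<omega> in M. cond_norm M F (ereal p) x \<omega> < ereal \<epsilon>)"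
  let ?N = "\<lambda>\<epsilon> \<delta>. {x \<in> LFp M F (ereal p). ?P x \<epsilon> > 1 - \<delta>}"
  obtain a \<alpha> b \<beta> where *: "0 < a" "0 < \<alpha>" "\<alpha> < 1" "0 < b" "0 < \<beta>" "\<beta> < 1" "A = ?N a \<alpha>" "B = ?N b \<beta>"
    using assms(3,4) unfolding Teps_nhds_LFp_def by blast
  have meas: "cond_norm M F (ereal p) x \<in> borel_measurable M" for x
    using borel_measurable_cond_norm measurable_from_subalg[OF assms(2)] by blast
  have mono: "?P x c \<le> ?P x d" if "c \<le> d" for x c d
  proof (rule finite_measure_mono)
    show "{\<omega> \<in> space M. cond_norm M F (ereal p) x \<omega> < ereal d} \<in> events"
      using meas[of x] by measurable
  qed (use that in \<open>auto intro: less_le_trans\<close>)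
  have "?N (min a b) (min \<alpha> \<beta>) \<in> Teps_nhds_LFp M F p"
    unfolding Teps_nhds_LFp_def using * by (auto simp: min_def)
  moreover have "?N (min a b) (min \<alpha> \<beta>) \<subseteq> A \<inter> B"
  proof
    fix x assume "x \<in> ?N (min a b) (min \<alpha> \<beta>)"
    then have "x \<in> LFp M F (ereal p)" "?P x (min a b) > 1 - min \<alpha> \<beta>" by auto
    moreover have "1 - min \<alpha> \<beta> \<ge> 1 - \<alpha>" "1 - min \<alpha> \<beta> \<ge> 1 - \<beta>" by auto
    moreover have "?P x (min a b) \<le> ?P x a" "?P x (min a b) \<le> ?P x b" by (intro mono; simp)+
    ultimately have "?P x a > 1 - \<alpha>" "?P x b > 1 - \<beta>" by linarith+
    with \<open>x \<in> LFp M F (ereal p)\<close> show "x \<in> A \<inter> B" unfolding * by blast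
  qed
  ultimately show ?thesis by blast
qed

lemma Teps_nhds_L0_Int:
  assumes "prob_space M" "subalgebra M F" "A \<in> Teps_nhds_L0 M F" "B \<in> Teps_nhds_L0 M F"
  shows "\<exists>C\<in>Teps_nhds_L0 M F. C \<subseteq> A \<inter> B"
proof -
  interpret prob_space M by fact
  let ?P = "\<lambda>x \<epsilon>. \<P>(\<omega> in M. \<bar>x \<omega>\<bar> < \<epsilon>)"
  let ?N = "\<lambda>\<epsilon> \<delta>. {x \<in> L0 F. ?P x \<epsilon> > 1 - \<delta>}"
  obtain a \<alpha> b \<beta> where *: "0 < a" "0 < \<alpha>" "\<alpha> < 1" "0 < b" "0 < \<beta>" "\<beta> < 1" "A = ?N a \<alpha>" "B = ?N b \<beta>"
    using assms(3,4) unfolding Teps_nhds_L0_def by blast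
  have mono: "?P x c \<le> ?P x d" if "c \<le> d" "x \<in> L0 F" for x c d
  proof (rule finite_measure_mono)
    have "x \<in> borel_measurable M"
      using that(2) measurable_from_subalg[OF assms(2)] by blast
    then show "{\<omega> \<in> space M. \<bar>x \<omega>\<bar> < d} \<in> events" by measurable
  qed (use that in auto)
  have "?N (min a b) (min \<alpha> \<beta>) \<in> Teps_nhds_L0 M F"
    unfolding Teps_nhds_L0_def using * by (auto simp: min_def)
  moreover have "?N (min a b) (min \<alpha> \<beta>) \<subseteq> A \<inter> B"
  proof
    fix x assume "x \<in> ?N (min a b) (min \<alpha> \<beta>)"
    then have x: "x \<in> L0 F" "?P x (min a b) > 1 - min \<alpha> \<beta>" by auto
    moreover have "1 - min \<alpha> \<beta> \<ge> 1 - \<alpha>" "1 - min \<alpha> \<beta> \<ge> 1 - \<beta>" by auto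
    moreover have "?P x (min a b) \<le> ?P x a" "?P x (min a b) \<le> ?P x b"
      by (intro mono x(1); simp)+
    ultimately have "?P x a > 1 - \<alpha>" "?P x b > 1 - \<beta>" by linarith+
    with x(1) show "x \<in> A \<inter> B" unfolding * by blast
  qed
  ultimately show ?thesis by blast
qed

end

theory Submission
  imports Defs "HOL-Library.Function_Algebras"
begin

text \<open>
  All seven statements hold outright, by a conditional form of the Namioka--Klee theorem.
  A finite monotone convex \<open>fbar\<close> is continuous: if it were unbounded near a point, one could pick small
  perturbations \<open>g\<^sub>n\<close> on which it exceeds \<open>n\<close>, and a single element of \<open>L\<^sup>p\<^sub>F\<close> would
  dominate all of them. Local properties turn this into a modulus of continuity in the
  conditional norm, which gives the semicontinuity and continuity statements.

  For the dual representations, the expected increment of \<open>fbar\<close> at \<open>x\<close> is a real convex functional on simple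
  functions, so it dominates a linear one by Hahn--Banach. Monotonicity and continuity make the
  latter integration against some \<open>-y \<ge> 0\<close> by Radon--Nikodym, and locality upgrades the integrated
  inequality to a conditional one, so that \<open>y\<close> attains the supremum at \<open>x\<close>. The modulus of continuity
  bounds the conditional \<open>q\<close>-th moment of \<open>y\<close> by a finite \<open>F\<close>-measurable \<open>c\<close>; replacing \<open>y\<close> by \<open>-1\<close> on
  \<open>{c > n}\<close> gives admissible elements for the smallest of the index sets, and these still attain the supremum on
  \<open>{c \<le> n}\<close>.
\<close>

section \<open>Hahn--Banach domination\<close>

text \<open>Elements of \<open>LFp M F p\<close> may fail to be integrable, and so may their
  products with dual elements. Conditional expectations are therefore controlled through a.e.
  finiteness of nonnegative conditional expectations, and Hahn--Banach is used on simple functions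
  only: translation invariance makes their increments bounded, so that the expected increment
  exists. Conditioning is recovered by testing against indicators of sets in \<open>F\<close>, and
  the inequality reaches all of \<open>LFp M F p\<close> by monotone and dominated convergence.

  In the domination argument the place where \<open>fbar\<close> is large depends on \<omega>, so
  the perturbations must be selected measurably. Essential suprema over countable families and
  pasting along an \<open>F\<close>-measurable index make this possible.

  The value \<open>-1\<close> in the truncation respects both dual constraints, the sign and the
  conditional expectation. For every index set one half of the representation is the Fenchel--Young
  inequality, so a representation over the smallest index set passes to all larger ones.\<close>

instantiation "fun" :: (type, real_vector) real_vector
begin

definition scaleR_fun :: "real \<Rightarrow> ('a \<Rightarrow> 'b) \<Rightarrow> 'a \<Rightarrow> 'b" where
  "scaleR_fun c f = (\<lambda>x. c *\<^sub>R f x)"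

instance
  by standard (auto simp: scaleR_fun_def fun_eq_iff algebra_simps)

end

definition sublinear_on :: "'v::real_vector set \<Rightarrow> ('v \<Rightarrow> real) \<Rightarrow> bool" where
  "sublinear_on X s \<longleftrightarrow> (\<forall>x\<in>X. \<forall>y\<in>X. s (x + y) \<le> s x + s y) \<and>
     (\<forall>x\<in>X. \<forall>c>0. s (c *\<^sub>R x) = c * s x) \<and> s 0 = 0"

lemma sublinear_on_lower:
  assumes "subspace X" "sublinear_on X s" "x \<in> X"
  shows "- s (- x) \<le> s x"
proof -
  have "s (x + - x) \<le> s x + s (- x)"
    using assms subspace_neg unfolding sublinear_on_def by blast
  then show ?thesis
    using assms(2) by (simp add: sublinear_on_def)
qed

text \<open>The reverse inequality is the assumption with factor \<open>1 / c\<close> at the point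
  \<open>c *\<^sub>R x\<close>. The infima constructed below thus only need one direction of
  homogeneity.\<close>

lemma sublinear_on_scale_le:
  assumes "\<And>x c. x \<in> X \<Longrightarrow> c > 0 \<Longrightarrow> s (c *\<^sub>R x) \<le> c * s x" "subspace X" "x \<in> X" "c > 0"
  shows "s (c *\<^sub>R x) = c * s x"
proof (rule antisym)
  have "s ((1 / c) *\<^sub>R (c *\<^sub>R x)) \<le> (1 / c) * s (c *\<^sub>R x)"
    using assms by (intro assms(1)) (auto simp: subspace_scale)
  then show "c * s x \<le> s (c *\<^sub>R x)"
    using assms(4) by (simp add: field_simps)
qed (use assms in auto)

text \<open>For a minimal sublinear \<open>s\<close> this forces \<open>s' = s\<close>, hence \<open>s (- v) = - s v\<close>, so that \<open>s\<close> is linear.\<close>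

lemma sublinear_shift:
  assumes X: "subspace X" and s: "sublinear_on X s" and v: "v \<in> X"
  defines "s' \<equiv> \<lambda>x. INF t\<in>{0::real..}. s (x + t *\<^sub>R v) - t * s v"
  shows "sublinear_on X s'" "\<And>x. x \<in> X \<Longrightarrow> s' x \<le> s x" "s' (- v) \<le> - s v"
proof -
  have add: "s (x + y) \<le> s x + s y" if "x \<in> X" "y \<in> X" for x y
    using s that by (auto simp: sublinear_on_def)
  have hom: "s (c *\<^sub>R x) = c * s x" if "x \<in> X" "0 \<le> c" for x c
    using s that by (cases "c = 0") (auto simp: sublinear_on_def)
  have mem: "x + t *\<^sub>R v \<in> X" "t *\<^sub>R v \<in> X" "- x \<in> X" if "x \<in> X" for x t
    using X v that by (auto simp: subspace_add subspace_scale subspace_neg)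
  \<comment> \<open>Writing \<open>t *\<^sub>R v\<close> as
    \<open>(x + t *\<^sub>R v) + (- x)\<close>, subadditivity bounds the terms of the infimum below
    uniformly in \<open>t\<close>.\<close>
  have low: "- s (- x) \<le> s (x + t *\<^sub>R v) - t * s v" if "x \<in> X" "0 \<le> t" for x t
    using add[of "x + t *\<^sub>R v" "- x"] mem that hom[OF v, of t] by simp
  have bdd: "bdd_below ((\<lambda>t. s (x + t *\<^sub>R v) - t * s v) ` {0..})" if "x \<in> X" for x
    using low[OF that] by (intro bdd_belowI[of _ "- s (- x)"]) auto
  have upper: "s' x \<le> s (x + t *\<^sub>R v) - t * s v" if "x \<in> X" "0 \<le> t" for x t
    unfolding s'_def using bdd[OF that(1)] that(2) by (intro cINF_lower) auto
  have greatest: "b \<le> s' x" if "\<And>t. 0 \<le> t \<Longrightarrow> b \<le> s (x + t *\<^sub>R v) - t * s v" for b x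
    unfolding s'_def using that by (intro cINF_greatest) auto
  show "s' x \<le> s x" if "x \<in> X" for x
    using upper[OF that, of 0] by simp
  show "s' (- v) \<le> - s v"
    using upper[of "- v" 1] mem[OF v] s by (simp add: sublinear_on_def)
  have s'0: "s' 0 = 0"
  proof (rule antisym)
    show "s' 0 \<le> 0"
      using upper[of 0 0] X s by (simp add: subspace_0 sublinear_on_def)
    show "0 \<le> s' 0"
      using hom[OF v] by (intro greatest) simp
  qed
  show "sublinear_on X s'"
    unfolding sublinear_on_def
  proof (intro conjI ballI allI impI s'0)
    fix x y assume x: "x \<in> X" and y: "y \<in> X"
    \<comment> \<open>Separate parameters \<open>t\<close> for \<open>x\<close> and \<open>u\<close>
      for \<open>y\<close> combine into the parameter \<open>t + u\<close> for \<open>x + y\<close>,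
      so the two infima can be taken one after the other.\<close>
    have "s' (x + y) - (s (x + t *\<^sub>R v) - t * s v) \<le> s' y" if "0 \<le> t" for t
    proof (rule greatest)
      fix u :: real assume u: "0 \<le> u"
      have "s' (x + y) \<le> s ((x + y) + (t + u) *\<^sub>R v) - (t + u) * s v"
        using x y X that u by (intro upper) (auto simp: subspace_add)
      also have "(x + y) + (t + u) *\<^sub>R v = (x + t *\<^sub>R v) + (y + u *\<^sub>R v)"
        by (simp add: algebra_simps)
      also have "s \<dots> \<le> s (x + t *\<^sub>R v) + s (y + u *\<^sub>R v)"
        using x y mem by (intro add) auto
      finally show "s' (x + y) - (s (x + t *\<^sub>R v) - t * s v) \<le> s (y + u *\<^sub>R v) - u * s v"
        by (simp add: algebra_simps)
    qed
    then have "s' (x + y) - s' y \<le> s' x"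
      by (intro greatest) (simp add: algebra_simps)
    then show "s' (x + y) \<le> s' x + s' y" by simp
  next
    fix x and c :: real assume x: "x \<in> X" and c: "0 < c"
    have "s' (c *\<^sub>R x) \<le> c * s' x" if x: "x \<in> X" and c: "0 < c" for x c
    proof -
      have "s' (c *\<^sub>R x) / c \<le> s' x"
      proof (rule greatest)
        fix t :: real assume t: "0 \<le> t"
        have "s' (c *\<^sub>R x) \<le> s (c *\<^sub>R x + (c * t) *\<^sub>R v) - (c * t) * s v"
          using x X c t by (intro upper) (auto simp: subspace_scale)
        also have "c *\<^sub>R x + (c * t) *\<^sub>R v = c *\<^sub>R (x + t *\<^sub>R v)"
          by (simp add: algebra_simps)
        also have "s \<dots> = c * s (x + t *\<^sub>R v)"
          using mem x c by (intro hom) auto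
        finally show "s' (c *\<^sub>R x) / c \<le> s (x + t *\<^sub>R v) - t * s v"
          using c by (simp add: field_simps)
      qed
      then show ?thesis using c by (simp add: field_simps)
    qed
    then show "s' (c *\<^sub>R x) = c * s' x"
      using X x c by (rule sublinear_on_scale_le)
  qed
qed

text \<open>Zorn's lemma yields a minimal sublinear functional below \<open>s\<close>. It is linear,
  because \<open>sublinear_shift\<close> would otherwise produce a strictly smaller one.\<close>

lemma sublinear_dominates_linear:
  fixes X :: "'v::real_vector set"
  assumes X: "subspace X" and s: "sublinear_on X s"
  obtains l where "\<And>x y. x \<in> X \<Longrightarrow> y \<in> X \<Longrightarrow> l (x + y) = l x + l y"
    "\<And>c x. x \<in> X \<Longrightarrow> l (c *\<^sub>R x) = c * l x" "\<And>x. x \<in> X \<Longrightarrow> l x \<le> s x"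
proof -
  \<comment> \<open>Values off \<open>X\<close> are pinned to 0, so that minimality on
    \<open>X\<close> determines the whole function and comparison with a competitor gives an
    equation of functions.\<close>
  define A where "A = {u. sublinear_on X u \<and> (\<forall>x\<in>X. u x \<le> s x) \<and> (\<forall>x. x \<notin> X \<longrightarrow> u x = (0::real))}"
  \<comment> \<open>The order is reversed because Zorn's lemma provides maximal elements.\<close>
  define ge where "ge u w \<longleftrightarrow> w \<le> u" for u w :: "'v \<Rightarrow> real"
  have cut: "(\<lambda>x. if x \<in> X then u x else 0) \<in> A" if "sublinear_on X u" "\<And>x. x \<in> X \<Longrightarrow> u x \<le> s x" for u
    using that X by (auto simp: A_def sublinear_on_def subspace_add subspace_scale subspace_0)
  have "\<exists>m\<in>A. \<forall>u\<in>A. ge m u \<longrightarrow> u = m"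
  proof (rule predicate_Zorn)
    show "partial_order_on A (relation_of ge A)"
      by (intro partial_order_on_relation_ofI) (auto simp: ge_def)
    fix C assume "C \<in> Chains (relation_of ge A)"
    then have tot: "u \<le> w \<or> w \<le> u" if "u \<in> C" "w \<in> C" for u w
      using that unfolding Chains_def relation_of_def ge_def by auto
    have CA: "C \<subseteq> A"
      using \<open>C \<in> Chains (relation_of ge A)\<close> unfolding Chains_def relation_of_def by auto
    show "\<exists>u\<in>A. \<forall>a\<in>C. ge a u"
    proof (cases "C = {}")
      case True
      then show ?thesis using cut[OF s] by auto
    next
      case False
      define m where "m x = (INF u\<in>C. u x)" for x
      have bdd: "bdd_below ((\<lambda>u. u x) ` C)" if "x \<in> X" for x
      proof (rule bdd_belowI[of _ "- s (- x)"], clarify)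
        fix u assume "u \<in> C"
        then have u: "sublinear_on X u" "u (- x) \<le> s (- x)"
          using CA subspace_neg[OF X that] by (auto simp: A_def)
        then show "- s (- x) \<le> u x"
          using sublinear_on_lower[OF X u(1) that] by simp
      qed
      have lower: "m x \<le> u x" if "x \<in> X" "u \<in> C" for x u
        unfolding m_def using bdd that by (auto intro: cINF_lower)
      have greatest: "b \<le> m x" if "\<And>u. u \<in> C \<Longrightarrow> b \<le> u x" for b x
        unfolding m_def using that False by (intro cINF_greatest) auto
      have sub: "sublinear_on X u" if "u \<in> C" for u
        using that CA by (auto simp: A_def)
      have "sublinear_on X m"
        unfolding sublinear_on_def
      proof (intro conjI ballI allI impI)
        fix x y assume x: "x \<in> X" and y: "y \<in> X"
        have "m (x + y) - u x \<le> w y" if u: "u \<in> C" and w: "w \<in> C" for u w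
        proof -
          \<comment> \<open>Subadditivity survives the infimum because \<open>C\<close> is a chain:
            the smaller of \<open>u\<close> and \<open>w\<close> serves in both summands.\<close>
          obtain z where z: "z \<in> C" "z \<le> u" "z \<le> w"
            using tot[OF u w] u w that order_refl[of u] order_refl[of w] by (elim disjE) auto
          have "m (x + y) \<le> z (x + y)"
            using X x y z by (intro lower) (auto simp: subspace_add)
          also have "\<dots> \<le> z x + z y"
            using sub[OF z(1)] x y by (auto simp: sublinear_on_def)
          also have "\<dots> \<le> u x + w y"
            using z by (intro add_mono) (auto simp: le_fun_def)
          finally show ?thesis by simp
        qed
        then have "m (x + y) - u x \<le> m y" if "u \<in> C" for u
          using that by (intro greatest) auto
        then have "m (x + y) - m y \<le> m x"
          by (intro greatest) (simp add: algebra_simps)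
        then show "m (x + y) \<le> m x + m y" by simp
      next
        fix x and c :: real assume x: "x \<in> X" and c: "0 < c"
        have "m (c *\<^sub>R x) \<le> c * m x" if x: "x \<in> X" and c: "0 < c" for x c
        proof -
          have "m (c *\<^sub>R x) / c \<le> m x"
          proof (rule greatest)
            fix u assume u: "u \<in> C"
            have "m (c *\<^sub>R x) \<le> c * u x"
              using lower[of "c *\<^sub>R x" u] u sub[OF u] x c X
              by (auto simp: subspace_scale sublinear_on_def)
            then show "m (c *\<^sub>R x) / c \<le> u x"
              using c by (simp add: field_simps)
          qed
          then show ?thesis using c by (simp add: field_simps)
        qed
        then show "m (c *\<^sub>R x) = c * m x"
          using X x c by (rule sublinear_on_scale_le)
      next
        have "(\<lambda>u. u 0) ` C = {0}"
          using sub False by (auto simp: sublinear_on_def image_iff)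
        then show "m 0 = 0"
          unfolding m_def by simp
      qed
      moreover have "m x \<le> s x" if "x \<in> X" for x
      proof -
        obtain u where "u \<in> C" using False by auto
        then show ?thesis
          using lower[OF that, of u] CA that by (auto simp: A_def intro: order_trans)
      qed
      ultimately have mA: "(\<lambda>x. if x \<in> X then m x else 0) \<in> A"
        by (rule cut)
      have "ge a (\<lambda>x. if x \<in> X then m x else 0)" if "a \<in> C" for a
        using lower[OF _ that] CA that by (auto simp: ge_def le_fun_def A_def)
      with mA show ?thesis by blast
    qed
  qed
  then obtain m where mA: "m \<in> A" and min: "\<And>u. u \<in> A \<Longrightarrow> u \<le> m \<Longrightarrow> u = m"
    by (auto simp: ge_def)
  have m: "sublinear_on X m" "\<And>x. x \<in> X \<Longrightarrow> m x \<le> s x" "\<And>x. x \<notin> X \<Longrightarrow> m x = 0"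
    using mA by (auto simp: A_def)
  have neg: "m (- v) = - m v" if v: "v \<in> X" for v
  proof (rule antisym)
    let ?s' = "\<lambda>x. INF t\<in>{0::real..}. m (x + t *\<^sub>R v) - t * m v"
    note sh = sublinear_shift[OF X m(1) v]
    have "(\<lambda>x. if x \<in> X then ?s' x else 0) = m"
    proof (rule min)
      show "(\<lambda>x. if x \<in> X then ?s' x else 0) \<in> A"
        using sh(1) order_trans[OF sh(2) m(2)] by (rule cut)
      show "(\<lambda>x. if x \<in> X then ?s' x else 0) \<le> m"
        using sh(2) m(3) by (auto simp: le_fun_def)
    qed
    from fun_cong[OF this, of "- v"] have "m (- v) = ?s' (- v)"
      using subspace_neg[OF X v] by simp
    with sh(3) show "m (- v) \<le> - m v" by simp
    show "- m v \<le> m (- v)"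
      using sublinear_on_lower[OF X m(1), of "- v"] v subspace_neg[OF X v] by simp
  qed
  have add: "m (x + y) = m x + m y" if x: "x \<in> X" and y: "y \<in> X" for x y
  proof (rule antisym)
    show le: "m (x + y) \<le> m x + m y"
      using m(1) x y by (auto simp: sublinear_on_def)
    have "m (- x + - y) \<le> m (- x) + m (- y)"
      using m(1) subspace_neg[OF X x] subspace_neg[OF X y] unfolding sublinear_on_def by blast
    then show "m x + m y \<le> m (x + y)"
      using neg[of "x + y"] neg[OF x] neg[OF y] x y X by (simp add: subspace_add)
  qed
  have scale: "m (c *\<^sub>R x) = c * m x" if x: "x \<in> X" for c x
  proof -
    have pos: "m (c *\<^sub>R x) = c * m x" if "0 \<le> c" for c
      using m(1) x that by (cases "c = 0") (auto simp: sublinear_on_def)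
    show ?thesis
    proof (cases "0 \<le> c")
      case False
      then show ?thesis
        using pos[of "- c"] neg[of "c *\<^sub>R x"] X x by (simp add: subspace_scale)
    qed (rule pos)
  qed
  show thesis
    using add scale m(2) by (rule that)
qed

text \<open>The directional derivative at the origin is a sublinear minorant.\<close>

lemma convex_dominates_linear:
  fixes X :: "'v::real_vector set"
  assumes X: "subspace X" and f: "convex_on X f" and f0: "f 0 = 0"
  obtains l where "\<And>x y. x \<in> X \<Longrightarrow> y \<in> X \<Longrightarrow> l (x + y) = l x + l y"
    "\<And>c x. x \<in> X \<Longrightarrow> l (c *\<^sub>R x) = c * l x" "\<And>x. x \<in> X \<Longrightarrow> l x \<le> f x"
proof -
  define s where "s x = (INF t\<in>{0::real<..}. f (t *\<^sub>R x) / t)" for x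
  have conv: "f (a *\<^sub>R x + b *\<^sub>R y) \<le> a * f x + b * f y"
    if "x \<in> X" "y \<in> X" "0 \<le> a" "0 \<le> b" "a + b = 1" for x y a b
    using f that unfolding convex_on_def by blast
  have low: "- f (- x) \<le> f (t *\<^sub>R x) / t" if x: "x \<in> X" and t: "0 < t" for x t
  proof -
    \<comment> \<open>These weights make the convex combination of \<open>- x\<close> and
      \<open>t *\<^sub>R x\<close> equal to 0, where \<open>f\<close> vanishes. All difference
      quotients are thereby bounded below.\<close>
    have "f ((t / (1 + t)) *\<^sub>R (- x) + (1 / (1 + t)) *\<^sub>R (t *\<^sub>R x)) \<le>
        t / (1 + t) * f (- x) + 1 / (1 + t) * f (t *\<^sub>R x)"
      using x t X by (intro conv) (auto simp: subspace_neg subspace_scale add_divide_distrib[symmetric])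
    then have "0 \<le> (t * f (- x) + f (t *\<^sub>R x)) / (1 + t)"
      using f0 by (simp add: add_divide_distrib)
    then show ?thesis using t by (simp add: field_simps)
  qed
  have bdd: "bdd_below ((\<lambda>t. f (t *\<^sub>R x) / t) ` {0<..})" if "x \<in> X" for x
    using low[OF that] by (intro bdd_belowI[of _ "- f (- x)"]) auto
  have upper: "s x \<le> f (t *\<^sub>R x) / t" if "x \<in> X" "0 < t" for x t
    unfolding s_def using bdd[OF that(1)] that(2) by (intro cINF_lower) auto
  have greatest: "b \<le> s x" if "\<And>t. 0 < t \<Longrightarrow> b \<le> f (t *\<^sub>R x) / t" for b x
    unfolding s_def using that by (intro cINF_greatest) auto
  have "sublinear_on X s"
    unfolding sublinear_on_def
  proof (intro conjI ballI allI impI)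
    fix x y assume x: "x \<in> X" and y: "y \<in> X"
    have "s (x + y) - f (t *\<^sub>R x) / t \<le> f (u *\<^sub>R y) / u" if t: "0 < t" and u: "0 < u" for t u
    proof -
      \<comment> \<open>Half the harmonic mean of \<open>t\<close> and \<open>u\<close>: then
        \<open>w *\<^sub>R (x + y)\<close> is a convex combination of \<open>t *\<^sub>R x\<close>
        and \<open>u *\<^sub>R y\<close>, and division by \<open>w\<close> turns the bound into the
        sum of the two quotients.\<close>
      define w where "w = t * u / (t + u)"
      have w: "0 < w" using t u by (simp add: w_def)
      have "w *\<^sub>R (x + y) = (u / (t + u)) *\<^sub>R (t *\<^sub>R x) + (t / (t + u)) *\<^sub>R (u *\<^sub>R y)"
        by (simp add: w_def algebra_simps)
      also have "f \<dots> \<le> u / (t + u) * f (t *\<^sub>R x) + t / (t + u) * f (u *\<^sub>R y)"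
        using x y t u X by (intro conv) (auto simp: subspace_scale add_divide_distrib[symmetric])
      finally have "f (w *\<^sub>R (x + y)) / w \<le> (u / (t + u) * f (t *\<^sub>R x) + t / (t + u) * f (u *\<^sub>R y)) / w"
        using w by (intro divide_right_mono) auto
      also have "\<dots> = f (t *\<^sub>R x) / t + f (u *\<^sub>R y) / u"
      proof -
        have "u / (t + u) = w / t" "t / (t + u) = w / u"
          using t u by (auto simp: w_def)
        then show ?thesis using w by (simp add: add_divide_distrib)
      qed
      finally have "f (w *\<^sub>R (x + y)) / w \<le> f (t *\<^sub>R x) / t + f (u *\<^sub>R y) / u" .
      moreover have "s (x + y) \<le> f (w *\<^sub>R (x + y)) / w"
        using x y X w by (intro upper) (auto simp: subspace_add)
      ultimately show ?thesis by simp
    qed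
    then have "s (x + y) - f (t *\<^sub>R x) / t \<le> s y" if "0 < t" for t
      using that by (intro greatest) auto
    then have "s (x + y) - s y \<le> s x"
      by (intro greatest) (simp add: algebra_simps)
    then show "s (x + y) \<le> s x + s y" by simp
  next
    fix x and c :: real assume x: "x \<in> X" and c: "0 < c"
    have "s (c *\<^sub>R x) \<le> c * s x" if x: "x \<in> X" and c: "0 < c" for x c
    proof -
      have "s (c *\<^sub>R x) / c \<le> s x"
      proof (rule greatest)
        fix t :: real assume t: "0 < t"
        show "s (c *\<^sub>R x) / c \<le> f (t *\<^sub>R x) / t"
          using upper[of "c *\<^sub>R x" "t / c"] x X c t by (simp add: subspace_scale field_simps)
      qed
      then show ?thesis using c by (simp add: field_simps)
    qed
    then show "s (c *\<^sub>R x) = c * s x"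
      using X x c by (rule sublinear_on_scale_le)
  next
    show "s 0 = 0" unfolding s_def using f0 by simp
  qed
  then obtain l where l: "\<And>x y. x \<in> X \<Longrightarrow> y \<in> X \<Longrightarrow> l (x + y) = l x + l y"
    "\<And>c x. x \<in> X \<Longrightarrow> l (c *\<^sub>R x) = c * l x" "\<And>x. x \<in> X \<Longrightarrow> l x \<le> s x"
    by (rule sublinear_dominates_linear[OF X]) blast
  show thesis
  proof (rule that)
    show "l x \<le> f x" if "x \<in> X" for x
      using l(3)[OF that] upper[OF that, of 1] by simp
  qed (use l in auto)
qed

section \<open>Essential suprema and generalised conditional expectations\<close>

text \<open>Exhaustion: the measures of countable unions have a supremum, and merging a maximising
  sequence of countable families attains it. A set with non-null remainder could be added to exceed
  the supremum.\<close>

lemma (in finite_measure) essential_union: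
  assumes "\<A> \<subseteq> sets M"
  obtains \<C> where "\<C> \<subseteq> \<A>" "countable \<C>" "\<And>A. A \<in> \<A> \<Longrightarrow> A - \<Union>\<C> \<in> null_sets M"
proof -
  define K where "K = {\<C>. \<C> \<subseteq> \<A> \<and> countable \<C>}"
  define s where "s = (SUP \<C>\<in>K. measure M (\<Union>\<C>))"
  have bdd: "bdd_above ((\<lambda>\<C>. measure M (\<Union>\<C>)) ` K)"
    by (intro bdd_aboveI[of _ "measure M (space M)"]) (auto simp: bounded_measure)
  have K0: "{} \<in> K" by (simp add: K_def)
  have "\<exists>\<C>\<in>K. s - 1 / Suc n < measure M (\<Union>\<C>)" for n
  proof -
    have "s - 1 / Suc n < (SUP \<C>\<in>K. measure M (\<Union>\<C>))" by (simp add: s_def)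
    then show ?thesis
      using bdd K0 by (subst (asm) less_cSUP_iff) auto
  qed
  then obtain \<D> where \<D>: "\<And>n. \<D> n \<in> K" "\<And>n. s - 1 / Suc n < measure M (\<Union>(\<D> n))"
    by metis
  define \<C> where "\<C> = (\<Union>n. \<D> n)"
  have meas: "\<Union>\<B> \<in> sets M" if "\<B> \<in> K" for \<B>
    using that assms by (auto simp: K_def intro!: sets.countable_Union)
  have \<C>: "\<C> \<in> K"
    using \<D>(1) by (auto simp: \<C>_def K_def)
  have "s - 1 / Suc n \<le> measure M (\<Union>\<C>)" for n
  proof -
    have "measure M (\<Union>(\<D> n)) \<le> measure M (\<Union>\<C>)"
      using meas[OF \<C>] by (intro finite_measure_mono) (auto simp: \<C>_def)
    with \<D>(2)[of n] show ?thesis by simp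
  qed
  moreover have "(\<lambda>n. s - 1 / Suc n) \<longlonglongrightarrow> s - 0"
    by (intro tendsto_intros LIMSEQ_inverse_real_of_nat[unfolded inverse_eq_divide])
  ultimately have s_le: "s \<le> measure M (\<Union>\<C>)"
    by (intro LIMSEQ_le_const2[of _ s]) auto
  show thesis
  proof
    show "\<C> \<subseteq> \<A>" "countable \<C>" using \<C> by (auto simp: K_def)
    fix A assume A: "A \<in> \<A>"
    have "insert A \<C> \<in> K" using A \<C> by (auto simp: K_def)
    then have "measure M (\<Union>(insert A \<C>)) \<le> s"
      unfolding s_def using bdd by (intro cSUP_upper) auto
    with s_le have "measure M (A \<union> \<Union>\<C>) \<le> measure M (\<Union>\<C>)" by simp
    moreover have "measure M (A \<union> \<Union>\<C>) = measure M (\<Union>\<C>) + measure M (A - \<Union>\<C>)"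
      using finite_measure_Union'[of "\<Union>\<C>" A] A assms meas[OF \<C>] by (auto simp: Un_commute)
    ultimately have "measure M (A - \<Union>\<C>) = 0"
      by (metis add_le_same_cancel1 measure_nonneg order_antisym)
    then show "A - \<Union>\<C> \<in> null_sets M"
      using A assms meas[OF \<C>] by (auto intro!: null_setsI simp: emeasure_eq_measure)
  qed
qed

context finite_measure_subalgebra
begin

lemma sets_F_into_M: "A \<in> sets F \<Longrightarrow> A \<in> sets M"
  using subalg by (auto simp: subalgebra_def)

lemma space_F [simp]: "space F = space M"
  using subalg by (auto simp: subalgebra_def)

lemma measurable_F_into_M: "f \<in> measurable F N \<Longrightarrow> f \<in> measurable M N"
  by (rule measurable_from_subalg[OF subalg])

text \<open>\<open>essential_union\<close> is applied to the superlevel sets at every rational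
  level. Where \<open>h\<close> exceeds the countable supremum, a rational level lies strictly
  between, which puts the point into one of countably many null remainders.\<close>

lemma essential_supremum:
  fixes S :: "('a \<Rightarrow> ereal) set"
  assumes S: "S \<subseteq> borel_measurable F"
  obtains C where "C \<subseteq> S" "countable C" "\<And>h. h \<in> S \<Longrightarrow> AE x in M. h x \<le> (SUP c\<in>C. c x)"
proof -
  define E where "E q h = {x \<in> space M. ereal (real_of_rat q) < h x}" for q :: rat and h :: "'a \<Rightarrow> ereal"
  have E: "E q h \<in> sets M" if "h \<in> S" for q h
  proof -
    have [measurable]: "h \<in> borel_measurable M" using that S measurable_F_into_M by blast
    show ?thesis unfolding E_def by measurable
  qed
  have "\<exists>C\<subseteq>S. countable C \<and> (\<forall>h\<in>S. E q h - (\<Union>c\<in>C. E q c) \<in> null_sets M)" for q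
  proof -
    have "E q ` S \<subseteq> sets M" using E by auto
    then obtain \<C> where \<C>: "\<C> \<subseteq> E q ` S" "countable \<C>"
        "\<And>A. A \<in> E q ` S \<Longrightarrow> A - \<Union>\<C> \<in> null_sets M"
      by (rule essential_union) blast
    then obtain C where "countable C" "C \<subseteq> S" "\<C> = E q ` C"
      using countable_subset_image[of \<C> "E q" S] by auto
    with \<C>(3) show ?thesis by blast
  qed
  then obtain C where C: "\<And>q. C q \<subseteq> S" "\<And>q. countable (C q)"
      "\<And>q h. h \<in> S \<Longrightarrow> E q h - (\<Union>c\<in>C q. E q c) \<in> null_sets M"
    by metis
  show thesis
  proof
    show "(\<Union>q. C q) \<subseteq> S" "countable (\<Union>q. C q)" using C by auto
    fix h assume h: "h \<in> S"
    have "AE x in M. \<forall>q. x \<notin> E q h - (\<Union>c\<in>C q. E q c)"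
      by (subst AE_all_countable) (intro allI AE_not_in C(3)[OF h])
    with AE_space show "AE x in M. h x \<le> (SUP c\<in>(\<Union>q. C q). c x)"
    proof eventually_elim
      case (elim x)
      show ?case
      proof (rule ccontr)
        assume "\<not> ?thesis"
        then obtain q where q: "(SUP c\<in>(\<Union>q. C q). c x) < ereal (real_of_rat q)"
            "ereal (real_of_rat q) < h x"
          using ereal_dense3[of "SUP c\<in>(\<Union>q. C q). c x" "h x"] by (auto simp: not_le)
        then obtain c where "c \<in> C q" "ereal (real_of_rat q) < c x"
          using elim by (auto simp: E_def)
        then have "ereal (real_of_rat q) < (SUP c\<in>(\<Union>q. C q). c x)"
          by (intro less_SUP_iff[THEN iffD2]) auto
        with q show False by simp
      qed
    qed
  qed
qed

text \<open>The countable supremum from \<open>essential_supremum\<close> witnesses the description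
  inside \<open>L0_Sup\<close>, so the chosen function has the characteristic properties of a least
  upper bound.\<close>

lemma L0_Sup:
  assumes S: "S \<subseteq> borel_measurable F"
  shows L0_Sup_measurable: "L0_Sup M F S \<in> borel_measurable F"
    and L0_Sup_upper: "h \<in> S \<Longrightarrow> AE x in M. h x \<le> L0_Sup M F S x"
    and L0_Sup_least: "k \<in> borel_measurable F \<Longrightarrow> (\<And>h. h \<in> S \<Longrightarrow> AE x in M. h x \<le> k x) \<Longrightarrow>
      AE x in M. L0_Sup M F S x \<le> k x"
proof -
  obtain C where C: "C \<subseteq> S" "countable C" "\<And>h. h \<in> S \<Longrightarrow> AE x in M. h x \<le> (SUP c\<in>C. c x)"
    by (rule essential_supremum[OF S]) blast
  have "(\<lambda>x. SUP c\<in>C. c x) \<in> borel_measurable F"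
    using C S by (intro borel_measurable_SUP) auto
  moreover have "AE x in M. (SUP c\<in>C. c x) \<le> k x"
    if "\<forall>h\<in>S. AE x in M. h x \<le> k x" for k
  proof -
    have "AE x in M. \<forall>c\<in>C. c x \<le> k x"
      using that C by (subst AE_ball_countable) auto
    then show ?thesis by eventually_elim (auto intro: SUP_least)
  qed
  ultimately have "\<exists>g. g \<in> borel_measurable F \<and> (\<forall>h\<in>S. AE x in M. h x \<le> g x) \<and>
     (\<forall>k\<in>borel_measurable F. (\<forall>h\<in>S. AE x in M. h x \<le> k x) \<longrightarrow> (AE x in M. g x \<le> k x))"
    using C(3) by blast
  note ex = someI_ex[OF this, folded L0_Sup_def]
  show "L0_Sup M F S \<in> borel_measurable F"
    "h \<in> S \<Longrightarrow> AE x in M. h x \<le> L0_Sup M F S x"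
    "k \<in> borel_measurable F \<Longrightarrow> (\<And>h. h \<in> S \<Longrightarrow> AE x in M. h x \<le> k x) \<Longrightarrow>
      AE x in M. L0_Sup M F S x \<le> k x"
    using ex by blast+
qed

lemma L0_Inf:
  assumes S: "S \<subseteq> borel_measurable F"
  shows L0_Inf_measurable: "L0_Inf M F S \<in> borel_measurable F"
    and L0_Inf_lower: "h \<in> S \<Longrightarrow> AE x in M. L0_Inf M F S x \<le> h x"
    and L0_Inf_greatest: "k \<in> borel_measurable F \<Longrightarrow> (\<And>h. h \<in> S \<Longrightarrow> AE x in M. k x \<le> h x) \<Longrightarrow>
      AE x in M. k x \<le> L0_Inf M F S x"
proof -
  let ?S = "(\<lambda>h x. - h x) ` S"
  define g where "g x = - L0_Sup M F ?S x" for x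
  have S': "?S \<subseteq> borel_measurable F" using S by auto
  have "g \<in> borel_measurable F"
    unfolding g_def using L0_Sup_measurable[OF S'] by measurable
  moreover have "AE x in M. g x \<le> h x" if "h \<in> S" for h
  proof -
    have "AE x in M. - h x \<le> L0_Sup M F ?S x" using that by (intro L0_Sup_upper[OF S']) auto
    then show ?thesis by eventually_elim (simp add: g_def ereal_uminus_le_reorder)
  qed
  moreover have "AE x in M. k x \<le> g x"
    if k: "k \<in> borel_measurable F" and le: "\<forall>h\<in>S. AE x in M. k x \<le> h x" for k
  proof -
    have "AE x in M. L0_Sup M F ?S x \<le> - k x"
      using k le by (intro L0_Sup_least[OF S']) auto
    then show ?thesis
      by eventually_elim (metis g_def ereal_minus_le_minus ereal_uminus_uminus)
  qed
  ultimately have "\<exists>g. g \<in> borel_measurable F \<and> (\<forall>h\<in>S. AE x in M. g x \<le> h x) \<and>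
     (\<forall>k\<in>borel_measurable F. (\<forall>h\<in>S. AE x in M. k x \<le> h x) \<longrightarrow> (AE x in M. k x \<le> g x))"
    by blast
  note ex = someI_ex[OF this, folded L0_Inf_def]
  show "L0_Inf M F S \<in> borel_measurable F"
    "h \<in> S \<Longrightarrow> AE x in M. L0_Inf M F S x \<le> h x"
    "k \<in> borel_measurable F \<Longrightarrow> (\<And>h. h \<in> S \<Longrightarrow> AE x in M. k x \<le> h x) \<Longrightarrow>
      AE x in M. k x \<le> L0_Inf M F S x"
    using ex by blast+
qed

text \<open>Multiplication by the indicator of \<open>A\<close> turns equality on \<open>A\<close>
  into equality a.e., and being \<open>F\<close>-measurable the indicator can be moved out of the
  conditional expectation.\<close>

lemma nn_cond_exp_local:
  assumes A: "A \<in> sets F" and eq: "AE x in M. x \<in> A \<longrightarrow> f x = g x"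
    and [measurable]: "f \<in> borel_measurable M" "g \<in> borel_measurable M"
  shows "AE x in M. x \<in> A \<longrightarrow> nn_cond_exp M F f x = nn_cond_exp M F g x"
proof -
  have [measurable]: "A \<in> sets F" "A \<in> sets M" using A sets_F_into_M by auto
  have "AE x in M. indicator A x * nn_cond_exp M F f x = nn_cond_exp M F (\<lambda>x. indicator A x * f x) x"
    "AE x in M. indicator A x * nn_cond_exp M F g x = nn_cond_exp M F (\<lambda>x. indicator A x * g x) x"
    by (intro nn_cond_exp_prod; measurable)+
  moreover have "AE x in M. nn_cond_exp M F (\<lambda>x. indicator A x * f x) x =
      nn_cond_exp M F (\<lambda>x. indicator A x * g x) x"
    using eq by (intro nn_cond_exp_cong) (auto elim!: eventually_mono simp: indicator_def)
  ultimately show ?thesis by eventually_elim (auto simp: indicator_def)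
qed

lemma real_cond_exp_local:
  assumes A: "A \<in> sets F" and eq: "AE x in M. x \<in> A \<longrightarrow> f x = g x"
    and [measurable]: "f \<in> borel_measurable M" "g \<in> borel_measurable M"
  shows "AE x in M. x \<in> A \<longrightarrow> real_cond_exp M F f x = real_cond_exp M F g x"
proof -
  have "AE x in M. x \<in> A \<longrightarrow> nn_cond_exp M F (\<lambda>x. ennreal (f x)) x = nn_cond_exp M F (\<lambda>x. ennreal (g x)) x"
    "AE x in M. x \<in> A \<longrightarrow> nn_cond_exp M F (\<lambda>x. ennreal (- f x)) x = nn_cond_exp M F (\<lambda>x. ennreal (- g x)) x"
    using eq by (intro nn_cond_exp_local[OF A]; auto elim!: eventually_mono)+
  then show ?thesis by eventually_elim (simp add: real_cond_exp_def)
qed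

section \<open>Convergence theorems for generalised conditional expectations\<close>

lemma nn_cond_exp_suminf:
  assumes [measurable]: "\<And>i. f i \<in> borel_measurable M"
  shows "AE x in M. (\<Sum>i. nn_cond_exp M F (f i) x) = nn_cond_exp M F (\<lambda>x. \<Sum>i. f i x) x"
proof (rule nn_cond_exp_charact)
  fix A assume A: "A \<in> sets F"
  have [measurable]: "A \<in> sets F" "A \<in> sets M" using A sets_F_into_M by auto
  have "(\<integral>\<^sup>+ x \<in> A. (\<Sum>i. f i x) \<partial>M) = (\<integral>\<^sup>+ x. (\<Sum>i. indicator A x * f i x) \<partial>M)"
    by (intro nn_integral_cong) (simp add: mult.commute ennreal_suminf_cmult)
  also have "\<dots> = (\<Sum>i. \<integral>\<^sup>+ x. indicator A x * f i x \<partial>M)"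
    by (rule nn_integral_suminf) measurable
  also have "\<dots> = (\<Sum>i. \<integral>\<^sup>+ x. indicator A x * nn_cond_exp M F (f i) x \<partial>M)"
    by (intro suminf_cong nn_cond_exp_intg[symmetric]) measurable
  also have "\<dots> = (\<integral>\<^sup>+ x. (\<Sum>i. indicator A x * nn_cond_exp M F (f i) x) \<partial>M)"
    by (rule nn_integral_suminf[symmetric]) measurable
  also have "\<dots> = (\<integral>\<^sup>+ x \<in> A. (\<Sum>i. nn_cond_exp M F (f i) x) \<partial>M)"
    by (intro nn_integral_cong) (simp add: mult.commute ennreal_suminf_cmult)
  finally show "(\<integral>\<^sup>+ x \<in> A. (\<Sum>i. f i x) \<partial>M) = (\<integral>\<^sup>+ x \<in> A. (\<Sum>i. nn_cond_exp M F (f i) x) \<partial>M)" .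
qed measurable

text \<open>Monotone convergence is applied to the set integrals over members of \<open>F\<close>,
  which characterise the conditional expectation of the supremum.\<close>

lemma nn_cond_exp_monotone_convergence:
  assumes [measurable]: "\<And>i. f i \<in> borel_measurable M" and mono: "AE x in M. incseq (\<lambda>i. f i x)"
  shows "AE x in M. (\<lambda>i. nn_cond_exp M F (f i) x) \<longlonglongrightarrow> nn_cond_exp M F (\<lambda>x. SUP i. f i x) x"
proof -
  have "AE x in M. \<forall>i. nn_cond_exp M F (f i) x \<le> nn_cond_exp M F (f (Suc i)) x"
    using mono by (subst AE_all_countable, intro allI nn_cond_exp_mono)
      (auto elim!: eventually_mono simp: incseq_Suc_iff)
  then have inc: "AE x in M. incseq (\<lambda>i. nn_cond_exp M F (f i) x)"
    by eventually_elim (simp add: incseq_Suc_iff)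
  have "AE x in M. (SUP i. nn_cond_exp M F (f i) x) = nn_cond_exp M F (\<lambda>x. SUP i. f i x) x"
  proof (rule nn_cond_exp_charact)
    fix A assume A: "A \<in> sets F"
    have [measurable]: "A \<in> sets F" "A \<in> sets M" using A sets_F_into_M by auto
    have "(\<integral>\<^sup>+ x \<in> A. (SUP i. f i x) \<partial>M) = (\<integral>\<^sup>+ x. (SUP i. indicator A x * f i x) \<partial>M)"
      by (intro nn_integral_cong) (simp add: mult.commute SUP_mult_left_ennreal)
    also have "\<dots> = (SUP i. \<integral>\<^sup>+ x. indicator A x * f i x \<partial>M)"
      using mono by (intro nn_integral_monotone_convergence_SUP_AE)
        (auto elim!: eventually_mono simp: incseq_Suc_iff mult_left_mono)
    also have "\<dots> = (SUP i. \<integral>\<^sup>+ x. indicator A x * nn_cond_exp M F (f i) x \<partial>M)"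
      by (intro SUP_cong nn_cond_exp_intg[symmetric] refl) measurable
    also have "\<dots> = (\<integral>\<^sup>+ x. (SUP i. indicator A x * nn_cond_exp M F (f i) x) \<partial>M)"
      using inc by (intro nn_integral_monotone_convergence_SUP_AE[symmetric])
        (auto elim!: eventually_mono simp: incseq_Suc_iff mult_left_mono)
    also have "\<dots> = (\<integral>\<^sup>+ x \<in> A. (SUP i. nn_cond_exp M F (f i) x) \<partial>M)"
      by (intro nn_integral_cong) (simp add: mult.commute SUP_mult_left_ennreal)
    finally show "(\<integral>\<^sup>+ x \<in> A. (SUP i. f i x) \<partial>M) = (\<integral>\<^sup>+ x \<in> A. (SUP i. nn_cond_exp M F (f i) x) \<partial>M)" .
  qed measurable
  with inc show ?thesis by eventually_elim (metis LIMSEQ_SUP)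
qed

text \<open>The tail suprema \<open>s i\<close> decrease to 0, so \<open>w - s i\<close> increases
  to \<open>w\<close> and monotone convergence applies. Finiteness of the conditional expectation of
  \<open>w\<close> allows subtracting to return to \<open>s i\<close>, which dominates
  \<open>f i\<close>.\<close>

lemma nn_cond_exp_tendsto_0:
  assumes [measurable]: "\<And>i. f i \<in> borel_measurable M" "w \<in> borel_measurable M"
    and lim: "AE x in M. (\<lambda>i. f i x) \<longlonglongrightarrow> 0" and dom: "AE x in M. \<forall>i. f i x \<le> w x"
    and w: "AE x in M. w x < \<infinity>" "AE x in M. nn_cond_exp M F w x < \<infinity>"
  shows "AE x in M. (\<lambda>i. nn_cond_exp M F (f i) x) \<longlonglongrightarrow> 0"
proof -
  define s where "s i x = (SUP j\<in>{i..}. f j x)" for i :: nat and x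
  define u where "u i x = w x - s i x" for i :: nat and x
  have [measurable]: "s i \<in> borel_measurable M" "u i \<in> borel_measurable M" for i
    unfolding s_def u_def by measurable
  have fs: "f i x \<le> s i x" for i x unfolding s_def by (rule SUP_upper) simp
  have s_w: "AE x in M. \<forall>i. s i x \<le> w x"
    using dom by eventually_elim (auto simp: s_def intro: SUP_least)
  have dec: "decseq (\<lambda>i. s i x)" for x
    unfolding s_def decseq_def by (auto intro: SUP_subset_mono)
  have s_lim: "AE x in M. (INF i. s i x) = 0"
    using lim
  proof eventually_elim
    case (elim x)
    then have "limsup (\<lambda>i. f i x) = 0"
      by (intro lim_imp_Limsup) auto
    then show ?case by (simp add: limsup_INF_SUP s_def)
  qed
  have inc: "incseq (\<lambda>i. u i x)" for x
    using dec[of x] by (auto simp: u_def incseq_def decseq_def intro!: ennreal_minus_mono)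
  have "AE x in M. (SUP i. u i x) = w x"
    using s_lim w(1)
  proof eventually_elim
    case (elim x)
    have "(\<lambda>i. s i x) \<longlonglongrightarrow> 0"
      using LIMSEQ_INF[OF dec[of x]] elim by simp
    then have "(\<lambda>i. u i x) \<longlonglongrightarrow> w x - 0"
      unfolding u_def using elim by (intro tendsto_diff_ennreal) auto
    then show ?case
      using LIMSEQ_SUP[OF inc[of x]] LIMSEQ_unique by fastforce
  qed
  then have "AE x in M. nn_cond_exp M F (\<lambda>x. SUP i. u i x) x = nn_cond_exp M F w x"
    by (intro nn_cond_exp_cong) measurable
  moreover have "AE x in M. (\<lambda>i. nn_cond_exp M F (u i) x) \<longlonglongrightarrow> nn_cond_exp M F (\<lambda>x. SUP i. u i x) x"
    using inc by (intro nn_cond_exp_monotone_convergence) auto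
  moreover have "AE x in M. \<forall>i. nn_cond_exp M F (u i) x + nn_cond_exp M F (s i) x = nn_cond_exp M F w x"
  proof (subst AE_all_countable, intro allI)
    fix i
    have "AE x in M. nn_cond_exp M F (\<lambda>x. u i x + s i x) x = nn_cond_exp M F w x"
      using s_w by (intro nn_cond_exp_cong) (auto elim!: eventually_mono simp: u_def diff_add_cancel_ennreal)
    moreover have "AE x in M. nn_cond_exp M F (u i) x + nn_cond_exp M F (s i) x =
        nn_cond_exp M F (\<lambda>x. u i x + s i x) x"
      by (intro nn_cond_exp_sum) measurable
    ultimately show "AE x in M. nn_cond_exp M F (u i) x + nn_cond_exp M F (s i) x = nn_cond_exp M F w x"
      by eventually_elim simp
  qed
  moreover have "AE x in M. \<forall>i. nn_cond_exp M F (f i) x \<le> nn_cond_exp M F (s i) x"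
    using fs by (subst AE_all_countable, intro allI nn_cond_exp_mono) auto
  ultimately show ?thesis using w(2)
  proof eventually_elim
    case (elim x)
    let ?W = "nn_cond_exp M F w x" and ?U = "\<lambda>i. nn_cond_exp M F (u i) x"
    have s: "nn_cond_exp M F (s i) x = ?W - ?U i" for i
    proof -
      have "?U i + nn_cond_exp M F (s i) x = ?W" using elim by blast
      moreover have "?U i \<noteq> \<infinity>" using calculation elim(5) by auto
      ultimately show ?thesis by (metis ennreal_add_diff_cancel_left infinity_ennreal_def)
    qed
    have "(\<lambda>i. ?W - ?U i) \<longlonglongrightarrow> ?W - ?W"
      using elim by (intro tendsto_diff_ennreal) auto
    then have lim: "(\<lambda>i. ?W - ?U i) \<longlonglongrightarrow> 0" using elim(5) by simp
    have "\<forall>\<^sub>F i in sequentially. nn_cond_exp M F (f i) x \<le> ?W - ?U i"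
      using elim(4) s by simp
    then show ?case
      by (rule tendsto_sandwich[OF _ _ tendsto_const lim, rotated]) simp
  qed
qed

text \<open>Since \<open>ennreal\<close> sends negative reals to 0, this concerns positive parts.
  The distances of \<open>s i\<close> from \<open>t\<close> are dominated by \<open>w + w\<close>,
  hence their conditional expectations tend to 0, and triangle inequalities in both directions
  squeeze those of \<open>s i\<close>.\<close>

lemma nn_cond_exp_dominated_convergence:
  fixes s :: "nat \<Rightarrow> 'a \<Rightarrow> real"
  assumes [measurable]: "\<And>i. s i \<in> borel_measurable M" "t \<in> borel_measurable M" "w \<in> borel_measurable M"
    and lim: "AE x in M. (\<lambda>i. s i x) \<longlonglongrightarrow> t x" and dom: "AE x in M. \<forall>i. \<bar>s i x\<bar> \<le> w x"
    and w: "AE x in M. nn_cond_exp M F (\<lambda>x. ennreal (w x)) x < \<infinity>"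
  shows "AE x in M. (\<lambda>i. nn_cond_exp M F (\<lambda>x. ennreal (s i x)) x)
           \<longlonglongrightarrow> nn_cond_exp M F (\<lambda>x. ennreal (t x)) x"
    and "AE x in M. nn_cond_exp M F (\<lambda>x. ennreal (t x)) x < \<infinity>"
proof -
  let ?E = "\<lambda>f. nn_cond_exp M F (\<lambda>x. ennreal (f x))"
  have t_w: "AE x in M. \<bar>t x\<bar> \<le> w x"
    using lim dom
  proof eventually_elim
    case (elim x)
    then show ?case
      by (intro LIMSEQ_le_const2[OF tendsto_rabs]) auto
  qed
  then have "AE x in M. ?E t x \<le> ?E w x"
    by (intro nn_cond_exp_mono) (auto elim!: eventually_mono intro!: ennreal_leI)
  with w show t_fin: "AE x in M. ?E t x < \<infinity>"
    by eventually_elim auto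
  have "AE x in M. ?E w x + ?E w x = nn_cond_exp M F (\<lambda>x. ennreal (w x) + ennreal (w x)) x"
    by (intro nn_cond_exp_sum) measurable
  with w have ww: "AE x in M. nn_cond_exp M F (\<lambda>x. ennreal (w x) + ennreal (w x)) x < \<infinity>"
    by eventually_elim (metis ennreal_add_less_top infinity_ennreal_def)
  have "AE x in M. (\<lambda>i. ?E (\<lambda>x. \<bar>s i x - t x\<bar>) x) \<longlonglongrightarrow> 0"
  proof (rule nn_cond_exp_tendsto_0[where w = "\<lambda>x. ennreal (w x) + ennreal (w x)"])
    show "AE x in M. (\<lambda>i. ennreal \<bar>s i x - t x\<bar>) \<longlonglongrightarrow> 0"
      using lim
    proof eventually_elim
      case (elim x)
      then have "(\<lambda>i. \<bar>s i x - t x\<bar>) \<longlonglongrightarrow> 0"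
        by (intro tendsto_rabs_zero LIM_zero)
      then show ?case
        using tendsto_ennrealI by fastforce
    qed
    show "AE x in M. \<forall>i. ennreal \<bar>s i x - t x\<bar> \<le> ennreal (w x) + ennreal (w x)"
      using dom t_w
    proof eventually_elim
      case (elim x)
      have "ennreal \<bar>s i x - t x\<bar> \<le> ennreal (w x + w x)" for i
        using elim(1)[rule_format, of i] elim(2) by (intro ennreal_leI) linarith
      moreover have "0 \<le> w x" using elim(2) by linarith
      ultimately show ?case by (metis ennreal_plus)
    qed
  qed (use ww in auto)
  moreover have "AE x in M. \<forall>i. ?E (s i) x \<le> ?E t x + ?E (\<lambda>x. \<bar>s i x - t x\<bar>) x \<and>
      ?E t x \<le> ?E (s i) x + ?E (\<lambda>x. \<bar>s i x - t x\<bar>) x"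
  proof (subst AE_all_countable, intro allI)
    fix i
    \<comment> \<open>Taking positive parts does not increase distances.\<close>
    have tri: "AE x in M. ?E f x \<le> ?E g x + ?E (\<lambda>x. \<bar>f x - g x\<bar>) x"
      if [measurable]: "f \<in> borel_measurable M" "g \<in> borel_measurable M" for f g
    proof -
      have "ennreal (f x) \<le> ennreal (g x) + ennreal \<bar>f x - g x\<bar>" for x
      proof -
        have "ennreal (f x) \<le> ennreal (max 0 (g x) + \<bar>f x - g x\<bar>)"
          by (intro ennreal_leI) auto
        also have "\<dots> = ennreal (g x) + ennreal \<bar>f x - g x\<bar>"
          by (subst ennreal_plus) (auto simp: max_def ennreal_neg)
        finally show ?thesis .
      qed
      then have "AE x in M. ?E f x \<le> nn_cond_exp M F (\<lambda>x. ennreal (g x) + ennreal \<bar>f x - g x\<bar>) x"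
        by (intro nn_cond_exp_mono) auto
      moreover have "AE x in M. ?E g x + ?E (\<lambda>x. \<bar>f x - g x\<bar>) x =
          nn_cond_exp M F (\<lambda>x. ennreal (g x) + ennreal \<bar>f x - g x\<bar>) x"
        by (intro nn_cond_exp_sum) measurable
      ultimately show ?thesis by eventually_elim simp
    qed
    show "AE x in M. ?E (s i) x \<le> ?E t x + ?E (\<lambda>x. \<bar>s i x - t x\<bar>) x \<and>
        ?E t x \<le> ?E (s i) x + ?E (\<lambda>x. \<bar>s i x - t x\<bar>) x"
      using tri[of "s i" t] tri[of t "s i"] by (auto simp: abs_minus_commute)
  qed
  ultimately show "AE x in M. (\<lambda>i. ?E (s i) x) \<longlonglongrightarrow> ?E t x"
    using t_fin
  proof eventually_elim
    case (elim x)
    let ?d = "\<lambda>i. ?E (\<lambda>x. \<bar>s i x - t x\<bar>) x"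
    have lo: "(\<lambda>i. ?E t x - ?d i) \<longlonglongrightarrow> ?E t x"
      using tendsto_diff_ennreal[OF tendsto_const elim(1), of "?E t x"] elim(3) by simp
    have hi: "(\<lambda>i. ?E t x + ?d i) \<longlonglongrightarrow> ?E t x"
      using tendsto_add[OF tendsto_const elim(1), of "?E t x"] by simp
    have "?E t x - ?d i \<le> ?E (s i) x" for i
      using elim(2,3) by (auto simp: ennreal_minus_le_iff add.commute)
    then show ?case
      using elim(2) by (intro tendsto_sandwich[OF _ _ lo hi]) simp_all
  qed
qed

lemma real_cond_exp_dominated_convergence:
  fixes s :: "nat \<Rightarrow> 'a \<Rightarrow> real"
  assumes [measurable]: "\<And>i. s i \<in> borel_measurable M" "t \<in> borel_measurable M" "w \<in> borel_measurable M"
    and lim: "AE x in M. (\<lambda>i. s i x) \<longlonglongrightarrow> t x" and dom: "AE x in M. \<forall>i. \<bar>s i x\<bar> \<le> w x"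
    and w: "AE x in M. nn_cond_exp M F (\<lambda>x. ennreal (w x)) x < \<infinity>"
  shows "AE x in M. (\<lambda>i. real_cond_exp M F (s i) x) \<longlonglongrightarrow> real_cond_exp M F t x"
proof -
  have lim': "AE x in M. (\<lambda>i. - s i x) \<longlonglongrightarrow> - t x"
    using lim by eventually_elim (rule tendsto_minus)
  have dom': "AE x in M. \<forall>i. \<bar>- s i x\<bar> \<le> w x" using dom by simp
  note pos = nn_cond_exp_dominated_convergence[OF assms]
  have "AE x in M. (\<lambda>i. nn_cond_exp M F (\<lambda>x. ennreal (- s i x)) x) \<longlonglongrightarrow> nn_cond_exp M F (\<lambda>x. ennreal (- t x)) x"
    "AE x in M. nn_cond_exp M F (\<lambda>x. ennreal (- t x)) x < \<infinity>"
    using nn_cond_exp_dominated_convergence[OF _ _ _ lim' dom' w] by simp_all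
  with pos show ?thesis
    unfolding real_cond_exp_def
    by eventually_elim (intro tendsto_diff tendsto_enn2real; simp)
qed

text \<open>With positive and negative parts on suitable sides, \<open>f + g\<close> satisfies an
  identity between sums of nonnegative functions, to which additivity of \<open>nn_cond_exp\<close>
  applies. All six terms are a.e. finite, so the identity can be rearranged in the reals.\<close>

lemma real_cond_exp_add_generalised:
  assumes [measurable]: "f \<in> borel_measurable M" "g \<in> borel_measurable M"
    and f: "AE x in M. nn_cond_exp M F (\<lambda>x. ennreal \<bar>f x\<bar>) x < \<infinity>"
    and g: "AE x in M. nn_cond_exp M F (\<lambda>x. ennreal \<bar>g x\<bar>) x < \<infinity>"
  shows "AE x in M. real_cond_exp M F (\<lambda>x. f x + g x) x = real_cond_exp M F f x + real_cond_exp M F g x"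
proof -
  let ?E = "\<lambda>f. nn_cond_exp M F (\<lambda>x. ennreal (f x))"
  let ?h = "\<lambda>x. f x + g x"
  have add: "AE x in M. ?E u x + ?E v x + ?E w x =
      nn_cond_exp M F (\<lambda>x. ennreal (u x) + ennreal (v x) + ennreal (w x)) x"
    if [measurable]: "u \<in> borel_measurable M" "v \<in> borel_measurable M" "w \<in> borel_measurable M" for u v w :: "'a \<Rightarrow> real"
  proof -
    have "AE x in M. ?E u x + ?E v x = nn_cond_exp M F (\<lambda>x. ennreal (u x) + ennreal (v x)) x"
      by (intro nn_cond_exp_sum) measurable
    moreover have "AE x in M. nn_cond_exp M F (\<lambda>x. ennreal (u x) + ennreal (v x)) x + ?E w x =
        nn_cond_exp M F (\<lambda>x. ennreal (u x) + ennreal (v x) + ennreal (w x)) x"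
      by (intro nn_cond_exp_sum) measurable
    ultimately show ?thesis by eventually_elim simp
  qed
  have "(\<lambda>x. ennreal (?h x) + ennreal (- f x) + ennreal (- g x)) =
      (\<lambda>x. ennreal (- ?h x) + ennreal (f x) + ennreal (g x))"
  proof
    fix x
    have e: "ennreal a + ennreal b + ennreal c = ennreal (max 0 a + max 0 b + max 0 c)" for a b c
      by (simp add: ennreal_max_0)
    show "ennreal (?h x) + ennreal (- f x) + ennreal (- g x) =
      ennreal (- ?h x) + ennreal (f x) + ennreal (g x)"
      unfolding e by (rule arg_cong[where f = ennreal]) (auto simp: max_def)
  qed
  then have eq: "AE x in M. ?E ?h x + ?E (\<lambda>x. - f x) x + ?E (\<lambda>x. - g x) x =
      ?E (\<lambda>x. - ?h x) x + ?E f x + ?E g x"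
    using add[of ?h "\<lambda>x. - f x" "\<lambda>x. - g x"] add[of "\<lambda>x. - ?h x" f g]
    by (simp only: assms(1,2) borel_measurable_add borel_measurable_uminus simp_thms True_implies_equals) force
  have fin: "AE x in M. ?E u x < \<infinity>"
    if "\<And>x. u x \<le> \<bar>f x\<bar> + \<bar>g x\<bar>" and [measurable]: "u \<in> borel_measurable M" for u :: "'a \<Rightarrow> real"
  proof -
    have "ennreal (u x) \<le> ennreal \<bar>f x\<bar> + ennreal \<bar>g x\<bar>" for x
      using that(1)[of x] by (simp add: ennreal_plus[symmetric] ennreal_leI del: ennreal_plus)
    then have "AE x in M. ?E u x \<le> nn_cond_exp M F (\<lambda>x. ennreal \<bar>f x\<bar> + ennreal \<bar>g x\<bar>) x"
      by (intro nn_cond_exp_mono) auto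
    moreover have "AE x in M. ?E (\<lambda>x. \<bar>f x\<bar>) x + ?E (\<lambda>x. \<bar>g x\<bar>) x =
        nn_cond_exp M F (\<lambda>x. ennreal \<bar>f x\<bar> + ennreal \<bar>g x\<bar>) x"
      by (intro nn_cond_exp_sum) measurable
    ultimately show ?thesis using f g
      by eventually_elim (metis ennreal_add_less_top infinity_ennreal_def order_le_less_trans)
  qed
  have "AE x in M. ?E ?h x < \<infinity>" "AE x in M. ?E (\<lambda>x. - ?h x) x < \<infinity>"
    "AE x in M. ?E f x < \<infinity>" "AE x in M. ?E (\<lambda>x. - f x) x < \<infinity>"
    "AE x in M. ?E g x < \<infinity>" "AE x in M. ?E (\<lambda>x. - g x) x < \<infinity>"
    by (rule fin; simp; fail | rule fin; simp; arith)+
  with eq show ?thesis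
  proof eventually_elim
    case (elim x)
    from arg_cong[OF this(1), of enn2real] this(2-) show ?case
      by (simp add: real_cond_exp_def enn2real_plus ennreal_add_less_top)
  qed
qed

end

section \<open>Continuity of convex conditional risk measures\<close>

lemma abs_add_powr_le:
  fixes x y p :: real
  assumes "0 \<le> p"
  shows "\<bar>x + y\<bar> powr p \<le> 2 powr p * (\<bar>x\<bar> powr p + \<bar>y\<bar> powr p)"
proof -
  have "\<bar>x + y\<bar> powr p \<le> (2 * max \<bar>x\<bar> \<bar>y\<bar>) powr p"
    using assms by (intro powr_mono2) auto
  also have "\<dots> = 2 powr p * max \<bar>x\<bar> \<bar>y\<bar> powr p"
    by (simp add: powr_mult)
  also have "max \<bar>x\<bar> \<bar>y\<bar> powr p \<le> \<bar>x\<bar> powr p + \<bar>y\<bar> powr p"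
    by (auto simp: max_def)
  finally show ?thesis by simp
qed

section \<open>The conditional Lebesgue space as a solid module over \<open>L0 F\<close>\<close>

locale prob_subalgebra = prob_space M for M :: "'a measure" +
  fixes F :: "'a measure" and p :: real
  assumes subalg_F: "subalgebra M F" and p_ge_1: "1 \<le> p"

sublocale prob_subalgebra \<subseteq> finite_measure_subalgebra M F
  by standard (rule subalg_F)

context prob_subalgebra
begin

text \<open>The \<open>p\<close>-th power of the conditional norm. Estimates are made on this level
  because roots then enter only when the topologies and the dual bounds are reached.\<close>

abbreviation moment :: "('a \<Rightarrow> real) \<Rightarrow> 'a \<Rightarrow> ennreal" where
  "moment x \<equiv> nn_cond_exp M F (\<lambda>\<omega>. ennreal (\<bar>x \<omega>\<bar> powr p))"

abbreviation \<L> :: "('a \<Rightarrow> real) set" where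
  "\<L> \<equiv> LFp M F (ereal p)"

lemma LFp_iff: "x \<in> \<L> \<longleftrightarrow> x \<in> L0 M \<and> (AE \<omega> in M. moment x \<omega> < \<infinity>)"
  unfolding LFp_def cond_norm_def ennreal_root_def by (simp add: less_top)

lemma LFp_measurable: "x \<in> \<L> \<Longrightarrow> x \<in> L0 M"
  by (simp add: LFp_iff)

lemma LFp_moment: "x \<in> \<L> \<Longrightarrow> AE \<omega> in M. moment x \<omega> < \<infinity>"
  by (simp add: LFp_iff)

lemma moment_mono:
  assumes [measurable]: "x \<in> L0 M" "y \<in> L0 M" and "AE \<omega> in M. \<bar>x \<omega>\<bar> \<le> \<bar>y \<omega>\<bar>"
  shows "AE \<omega> in M. moment x \<omega> \<le> moment y \<omega>"
  using assms(3) p_ge_1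
  by (intro nn_cond_exp_mono) (auto elim!: eventually_mono intro!: ennreal_leI powr_mono2)

lemma moment_local:
  assumes "A \<in> sets F" "AE \<omega> in M. \<omega> \<in> A \<longrightarrow> x \<omega> = y \<omega>" and [measurable]: "x \<in> L0 M" "y \<in> L0 M"
  shows "AE \<omega> in M. \<omega> \<in> A \<longrightarrow> moment x \<omega> = moment y \<omega>"
  using assms(1,2) by (intro nn_cond_exp_local) (auto elim!: eventually_mono)

lemma moment_mult:
  assumes [measurable]: "\<xi> \<in> L0 F" "x \<in> L0 M"
  shows "AE \<omega> in M. moment (\<lambda>\<omega>. \<xi> \<omega> * x \<omega>) \<omega> = ennreal (\<bar>\<xi> \<omega>\<bar> powr p) * moment x \<omega>"
proof -
  have "AE \<omega> in M. ennreal (\<bar>\<xi> \<omega>\<bar> powr p) * moment x \<omega> =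
      nn_cond_exp M F (\<lambda>\<omega>. ennreal (\<bar>\<xi> \<omega>\<bar> powr p) * ennreal (\<bar>x \<omega>\<bar> powr p)) \<omega>"
    by (intro nn_cond_exp_prod) measurable
  then show ?thesis
    by eventually_elim (simp add: abs_mult powr_mult ennreal_mult)
qed

lemma moment_add_le:
  assumes [measurable]: "x \<in> L0 M" "y \<in> L0 M"
  shows "AE \<omega> in M. moment (\<lambda>\<omega>. x \<omega> + y \<omega>) \<omega> \<le> ennreal (2 powr p) * (moment x \<omega> + moment y \<omega>)"
proof -
  have le: "ennreal (\<bar>a + b\<bar> powr p) \<le> ennreal (2 powr p) * (ennreal (\<bar>a\<bar> powr p) + ennreal (\<bar>b\<bar> powr p))" for a b
    using abs_add_powr_le[of p a b] p_ge_1
    by (simp add: ennreal_plus[symmetric] ennreal_mult[symmetric] ennreal_leI del: ennreal_plus)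
  have "AE \<omega> in M. moment (\<lambda>\<omega>. x \<omega> + y \<omega>) \<omega> \<le>
      nn_cond_exp M F (\<lambda>\<omega>. ennreal (2 powr p) * (ennreal (\<bar>x \<omega>\<bar> powr p) + ennreal (\<bar>y \<omega>\<bar> powr p))) \<omega>"
    using le by (intro nn_cond_exp_mono) auto
  moreover have "AE \<omega> in M. ennreal (2 powr p) * nn_cond_exp M F (\<lambda>\<omega>. ennreal (\<bar>x \<omega>\<bar> powr p) + ennreal (\<bar>y \<omega>\<bar> powr p)) \<omega> =
      nn_cond_exp M F (\<lambda>\<omega>. ennreal (2 powr p) * (ennreal (\<bar>x \<omega>\<bar> powr p) + ennreal (\<bar>y \<omega>\<bar> powr p))) \<omega>"
    by (intro nn_cond_exp_prod) measurable
  moreover have "AE \<omega> in M. moment x \<omega> + moment y \<omega> =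
      nn_cond_exp M F (\<lambda>\<omega>. ennreal (\<bar>x \<omega>\<bar> powr p) + ennreal (\<bar>y \<omega>\<bar> powr p)) \<omega>"
    by (intro nn_cond_exp_sum) measurable
  ultimately show ?thesis by eventually_elim simp
qed

lemma LFp_solid:
  assumes "y \<in> \<L>" and [measurable]: "x \<in> L0 M" and le: "AE \<omega> in M. \<bar>x \<omega>\<bar> \<le> \<bar>y \<omega>\<bar>"
  shows "x \<in> \<L>"
proof -
  have "AE \<omega> in M. moment x \<omega> \<le> moment y \<omega>"
    using assms by (intro moment_mono) (auto simp: LFp_iff)
  with LFp_moment[OF assms(1)] have "AE \<omega> in M. moment x \<omega> < \<infinity>"
    by eventually_elim auto
  then show ?thesis by (simp add: LFp_iff)
qed

lemma LFp_add: assumes "x \<in> \<L>" "y \<in> \<L>" shows "(\<lambda>\<omega>. x \<omega> + y \<omega>) \<in> \<L>"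
proof -
  have [measurable]: "x \<in> L0 M" "y \<in> L0 M" using assms by (auto simp: LFp_iff)
  have "AE \<omega> in M. moment (\<lambda>\<omega>. x \<omega> + y \<omega>) \<omega> < \<infinity>"
    using moment_add_le[OF LFp_measurable LFp_measurable, OF assms] LFp_moment[OF assms(1)] LFp_moment[OF assms(2)]
    by eventually_elim (auto simp: ennreal_mult_less_top less_top[symmetric] top_unique ennreal_mult_eq_top_iff)
  then show ?thesis by (simp add: LFp_iff)
qed

lemma LFp_mult:
  assumes [measurable]: "\<xi> \<in> L0 F" and x: "x \<in> \<L>"
  shows "(\<lambda>\<omega>. \<xi> \<omega> * x \<omega>) \<in> \<L>"
proof -
  have [measurable]: "x \<in> L0 M" "\<xi> \<in> L0 M" using x by (auto simp: LFp_iff measurable_F_into_M)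
  have "AE \<omega> in M. moment (\<lambda>\<omega>. \<xi> \<omega> * x \<omega>) \<omega> < \<infinity>"
    using moment_mult[OF assms(1) LFp_measurable, OF x] LFp_moment[OF x]
    by eventually_elim (auto simp: ennreal_mult_less_top)
  then show ?thesis by (simp add: LFp_iff)
qed

lemma LFp_bounded:
  assumes "x \<in> L0 M" "AE \<omega> in M. \<bar>x \<omega>\<bar> \<le> C"
  shows "x \<in> \<L>"
proof -
  have "AE \<omega> in M. ennreal (\<bar>C\<bar> powr p) = moment (\<lambda>_. C) \<omega>"
    by (intro nn_cond_exp_F_meas) auto
  then have "AE \<omega> in M. moment (\<lambda>_. C) \<omega> < \<infinity>"
    by eventually_elim (metis ennreal_less_top infinity_ennreal_def)
  then have "(\<lambda>_. C) \<in> \<L>"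
    by (simp add: LFp_iff)
  then show ?thesis
    using assms(1) by (rule LFp_solid) (use assms(2) in \<open>auto elim: eventually_mono\<close>)
qed

lemma L0_subset_LFp: "\<xi> \<in> L0 F \<Longrightarrow> \<xi> \<in> \<L>"
  using LFp_mult[of \<xi> "\<lambda>_. 1"] LFp_bounded[of "\<lambda>_. 1" 1] by auto

lemma LFp_uminus: "x \<in> \<L> \<Longrightarrow> (\<lambda>\<omega>. - x \<omega>) \<in> \<L>"
  using LFp_mult[of "\<lambda>_. - 1" x] by simp

lemma LFp_diff: "x \<in> \<L> \<Longrightarrow> y \<in> \<L> \<Longrightarrow> (\<lambda>\<omega>. x \<omega> - y \<omega>) \<in> \<L>"
  using LFp_add[of x "\<lambda>\<omega>. - y \<omega>"] LFp_uminus[of y] by simp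

lemma LFp_abs: "x \<in> \<L> \<Longrightarrow> (\<lambda>\<omega>. \<bar>x \<omega>\<bar>) \<in> \<L>"
  by (rule LFp_solid[of x]) (auto dest: LFp_measurable)

lemma LFp_restrict: "A \<in> sets F \<Longrightarrow> x \<in> \<L> \<Longrightarrow> (\<lambda>\<omega>. indicator A \<omega> * x \<omega>) \<in> \<L>"
  by (rule LFp_mult) auto

text \<open>Locality identifies the moment on each of the countably many sets where \<open>k\<close>
  is constant. Membership in \<L> is a pointwise finiteness condition, so it survives
  gluing.\<close>

lemma LFp_paste:
  assumes k: "k \<in> measurable F (count_space UNIV)" and x: "\<And>j::nat. x j \<in> \<L>"
  shows "(\<lambda>\<omega>. x (k \<omega>) \<omega>) \<in> \<L>"
    and "AE \<omega> in M. moment (\<lambda>\<omega>. x (k \<omega>) \<omega>) \<omega> = moment (x (k \<omega>)) \<omega>"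
proof -
  have [measurable]: "x j \<in> L0 M" for j using x LFp_measurable by blast
  have [measurable]: "k \<in> measurable M (count_space UNIV)" "k \<in> measurable F (count_space UNIV)"
    using k by (auto simp: measurable_F_into_M)
  have m: "(\<lambda>\<omega>. x (k \<omega>) \<omega>) \<in> L0 M" by measurable
  have "AE \<omega> in M. \<forall>j. \<omega> \<in> {\<omega> \<in> space M. k \<omega> = j} \<longrightarrow>
      moment (\<lambda>\<omega>. x (k \<omega>) \<omega>) \<omega> = moment (x j) \<omega>"
  proof (subst AE_all_countable, intro allI moment_local)
    show "{\<omega> \<in> space M. k \<omega> = j} \<in> sets F" for j
      unfolding space_F[symmetric] by measurable
  qed (use m in auto)
  with AE_space show eq: "AE \<omega> in M. moment (\<lambda>\<omega>. x (k \<omega>) \<omega>) \<omega> = moment (x (k \<omega>)) \<omega>"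
    by eventually_elim simp
  have "AE \<omega> in M. \<forall>j. moment (x j) \<omega> < \<infinity>"
    using LFp_moment[OF x] by (subst AE_all_countable) auto
  with eq have "AE \<omega> in M. moment (\<lambda>\<omega>. x (k \<omega>) \<omega>) \<omega> < \<infinity>"
    by eventually_elim simp
  with m show "(\<lambda>\<omega>. x (k \<omega>) \<omega>) \<in> \<L>" by (simp add: LFp_iff)
qed

lemma cond_norm_le_imp:
  assumes "cond_norm M F (ereal p) x \<omega> \<le> ereal e"
  shows "moment x \<omega> \<le> ennreal (e powr p)"
proof -
  \<comment> \<open>An infinite moment has the root \<infinity>, which exceeds every real
    \<open>e\<close>.\<close>
  have fin: "moment x \<omega> \<noteq> \<infinity>" and le: "enn2real (moment x \<omega>) powr (1 / p) \<le> e"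
    using assms by (auto simp: cond_norm_def ennreal_root_def split: if_splits)
  have "enn2real (moment x \<omega>) = (enn2real (moment x \<omega>) powr (1 / p)) powr p"
    using p_ge_1 by (simp add: powr_powr)
  also have "\<dots> \<le> e powr p"
    using le p_ge_1 by (intro powr_mono2) auto
  finally have "ennreal (enn2real (moment x \<omega>)) \<le> ennreal (e powr p)"
    by (rule ennreal_leI)
  then show ?thesis using fin by (simp add: ennreal_enn2real_if)
qed

end

section \<open>Locality and increments of convex conditional risk measures\<close>

locale LFp_convex_risk_measure = prob_subalgebra M F p for M :: "'a measure" and F p +
  fixes f :: "('a \<Rightarrow> real) \<Rightarrow> 'a \<Rightarrow> real"
  assumes risk: "LFp_cond_risk_measure M F p f"
    and convex: "L0_convex M F (LFp M F (ereal p)) f"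
begin

lemma f_measurable: "x \<in> \<L> \<Longrightarrow> f x \<in> L0 F"
  using risk by (auto simp: LFp_cond_risk_measure_def cond_risk_measure_def)

lemma f_antimono: "x \<in> \<L> \<Longrightarrow> y \<in> \<L> \<Longrightarrow> AE \<omega> in M. y \<omega> \<le> x \<omega> \<Longrightarrow> AE \<omega> in M. f x \<omega> \<le> f y \<omega>"
  using risk by (auto simp: LFp_cond_risk_measure_def cond_risk_measure_def)

lemma f_translate: "x \<in> \<L> \<Longrightarrow> y \<in> L0 F \<Longrightarrow> AE \<omega> in M. f (\<lambda>\<omega>. x \<omega> + y \<omega>) \<omega> = f x \<omega> - y \<omega>"
  using risk by (auto simp: LFp_cond_risk_measure_def cond_risk_measure_def)

lemma f_convex:
  "x \<in> \<L> \<Longrightarrow> y \<in> \<L> \<Longrightarrow> \<xi> \<in> L0 F \<Longrightarrow> AE \<omega> in M. 0 \<le> \<xi> \<omega> \<and> \<xi> \<omega> \<le> 1 \<Longrightarrow>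
    AE \<omega> in M. f (\<lambda>\<omega>. \<xi> \<omega> * x \<omega> + (1 - \<xi> \<omega>) * y \<omega>) \<omega> \<le> \<xi> \<omega> * f x \<omega> + (1 - \<xi> \<omega>) * f y \<omega>"
  using convex by (auto simp: L0_convex_def)

text \<open>Convexity with the indicator of \<open>A\<close> as coefficient bounds \<open>f\<close>
  at the element pasted from \<open>x\<close> on \<open>A\<close> and \<open>y\<close> off
  \<open>A\<close>. This element equals \<open>y\<close> a.e., so on \<open>A\<close> the bound
  reads \<open>f y \<le> f x\<close>; the other inequality is symmetric.\<close>

lemma f_local:
  assumes A: "A \<in> sets F" and xy: "x \<in> \<L>" "y \<in> \<L>" and eq: "AE \<omega> in M. \<omega> \<in> A \<longrightarrow> x \<omega> = y \<omega>"
  shows "AE \<omega> in M. \<omega> \<in> A \<longrightarrow> f x \<omega> = f y \<omega>"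
proof -
  have le: "AE \<omega> in M. \<omega> \<in> A \<longrightarrow> f y \<omega> \<le> f x \<omega>"
    if xy: "x \<in> \<L>" "y \<in> \<L>" and eq: "AE \<omega> in M. \<omega> \<in> A \<longrightarrow> x \<omega> = y \<omega>" for x y
  proof -
    let ?\<xi> = "indicator A :: 'a \<Rightarrow> real"
    let ?z = "\<lambda>\<omega>. ?\<xi> \<omega> * x \<omega> + (1 - ?\<xi> \<omega>) * y \<omega>"
    have \<xi>: "?\<xi> \<in> L0 F" using A by measurable
    have "(\<lambda>\<omega>. 1 - ?\<xi> \<omega>) \<in> L0 F" using A by measurable
    with \<xi> have z: "?z \<in> \<L>" using xy by (intro LFp_add LFp_mult)
    have "AE \<omega> in M. f y \<omega> \<le> f ?z \<omega>"
      using eq by (intro f_antimono xy z) (auto elim!: eventually_mono simp: indicator_def)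
    moreover have "AE \<omega> in M. f ?z \<omega> \<le> ?\<xi> \<omega> * f x \<omega> + (1 - ?\<xi> \<omega>) * f y \<omega>"
      by (intro f_convex xy \<xi>) (auto simp: indicator_def)
    ultimately show ?thesis by eventually_elim (auto simp: indicator_def)
  qed
  have eq': "AE \<omega> in M. \<omega> \<in> A \<longrightarrow> y \<omega> = x \<omega>"
    using eq by eventually_elim simp
  show ?thesis
    using le[OF xy eq] le[OF xy(2,1) eq'] by eventually_elim auto
qed

text \<open>Subtracting \<open>g\<close> turns the antitone \<open>f\<close> into a map that is
  monotone in \<open>g\<close>, convex, and zero at \<open>g = 0\<close>.\<close>

definition increment :: "('a \<Rightarrow> real) \<Rightarrow> ('a \<Rightarrow> real) \<Rightarrow> 'a \<Rightarrow> real" where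
  "increment x g \<omega> = f (\<lambda>\<omega>. x \<omega> - g \<omega>) \<omega> - f x \<omega>"

lemma increment_measurable: "x \<in> \<L> \<Longrightarrow> g \<in> \<L> \<Longrightarrow> increment x g \<in> L0 F"
  unfolding increment_def using f_measurable LFp_diff by (intro borel_measurable_diff) auto

lemma increment_mono:
  assumes "x \<in> \<L>" "g \<in> \<L>" "h \<in> \<L>" "AE \<omega> in M. g \<omega> \<le> h \<omega>"
  shows "AE \<omega> in M. increment x g \<omega> \<le> increment x h \<omega>"
proof -
  have "AE \<omega> in M. f (\<lambda>\<omega>. x \<omega> - g \<omega>) \<omega> \<le> f (\<lambda>\<omega>. x \<omega> - h \<omega>) \<omega>"
    using assms by (intro f_antimono LFp_diff) (auto elim: eventually_mono)
  then show ?thesis by eventually_elim (simp add: increment_def)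
qed

lemma increment_0: "increment x (\<lambda>_. 0) = (\<lambda>_. 0)"
  by (simp add: increment_def fun_eq_iff)

lemma increment_local:
  assumes "x \<in> \<L>" "A \<in> sets F" "g \<in> \<L>" "h \<in> \<L>" "AE \<omega> in M. \<omega> \<in> A \<longrightarrow> g \<omega> = h \<omega>"
  shows "AE \<omega> in M. \<omega> \<in> A \<longrightarrow> increment x g \<omega> = increment x h \<omega>"
proof -
  have "AE \<omega> in M. \<omega> \<in> A \<longrightarrow> f (\<lambda>\<omega>. x \<omega> - g \<omega>) \<omega> = f (\<lambda>\<omega>. x \<omega> - h \<omega>) \<omega>"
    using assms by (intro f_local LFp_diff) (auto elim: eventually_mono)
  then show ?thesis by eventually_elim (simp add: increment_def)
qed

lemma increment_scale:
  assumes "x \<in> \<L>" "g \<in> \<L>" "\<xi> \<in> L0 F" "AE \<omega> in M. 0 \<le> \<xi> \<omega> \<and> \<xi> \<omega> \<le> 1"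
  shows "AE \<omega> in M. increment x (\<lambda>\<omega>. \<xi> \<omega> * g \<omega>) \<omega> \<le> \<xi> \<omega> * increment x g \<omega>"
proof -
  have "AE \<omega> in M. f (\<lambda>\<omega>. \<xi> \<omega> * (x \<omega> - g \<omega>) + (1 - \<xi> \<omega>) * x \<omega>) \<omega> \<le>
      \<xi> \<omega> * f (\<lambda>\<omega>. x \<omega> - g \<omega>) \<omega> + (1 - \<xi> \<omega>) * f x \<omega>"
    using assms by (intro f_convex LFp_diff) auto
  moreover have "(\<lambda>\<omega>. \<xi> \<omega> * (x \<omega> - g \<omega>) + (1 - \<xi> \<omega>) * x \<omega>) = (\<lambda>\<omega>. x \<omega> - \<xi> \<omega> * g \<omega>)"
    by (auto simp: algebra_simps)
  ultimately show ?thesis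
    by (simp add: increment_def algebra_simps)
qed

text \<open>The upper bound is monotonicity. For the lower one, \<open>x\<close> is the midpoint of
  \<open>x + g\<close> and \<open>x - g\<close>, so the decrease of \<open>f\<close> towards
  \<open>x + g\<close> is at most its increase towards \<open>x - g\<close>.\<close>

lemma f_increment_abs:
  assumes x: "x \<in> \<L>" and g: "g \<in> \<L>"
  shows "AE \<omega> in M. \<bar>f (\<lambda>\<omega>. x \<omega> + g \<omega>) \<omega> - f x \<omega>\<bar> \<le> increment x (\<lambda>\<omega>. \<bar>g \<omega>\<bar>) \<omega>"
proof -
  have "AE \<omega> in M. f (\<lambda>\<omega>. x \<omega> + g \<omega>) \<omega> \<le> f (\<lambda>\<omega>. x \<omega> - \<bar>g \<omega>\<bar>) \<omega>"
    using x g by (intro f_antimono LFp_add LFp_diff LFp_abs) auto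
  moreover have "AE \<omega> in M. f (\<lambda>\<omega>. x \<omega> - g \<omega>) \<omega> \<le> f (\<lambda>\<omega>. x \<omega> - \<bar>g \<omega>\<bar>) \<omega>"
    using x g by (intro f_antimono LFp_add LFp_diff LFp_abs) auto
  moreover have "AE \<omega> in M. f x \<omega> \<le> 1/2 * f (\<lambda>\<omega>. x \<omega> + g \<omega>) \<omega> + 1/2 * f (\<lambda>\<omega>. x \<omega> - g \<omega>) \<omega>"
  proof -
    have "(\<lambda>\<omega>. 1/2 * (x \<omega> + g \<omega>) + (1 - 1/2) * (x \<omega> - g \<omega>)) = x"
      by (auto simp: field_simps)
    then show ?thesis
      using f_convex[of "\<lambda>\<omega>. x \<omega> + g \<omega>" "\<lambda>\<omega>. x \<omega> - g \<omega>" "\<lambda>_. 1/2"] LFp_add[OF x g] LFp_diff[OF x g] by simp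
  qed
  ultimately show ?thesis
    by eventually_elim (auto simp: increment_def)
qed

text \<open>
  A finite convex antitone map is bounded near every point: otherwise there are small \<open>g\<^sub>n\<close> with
  \<open>increment x g\<^sub>n \<ge> n\<close>, and \<open>(\<Sum>n. g\<^sub>n powr p) powr (1 / p)\<close> dominates all of them.
\<close>

lemma increment_bounded_near_0:
  assumes x: "x \<in> \<L>"
  obtains k :: "'a \<Rightarrow> nat" where "k \<in> measurable F (count_space UNIV)"
    "\<And>g. g \<in> \<L> \<Longrightarrow> AE \<omega> in M. 0 \<le> g \<omega> \<Longrightarrow> AE \<omega> in M. moment g \<omega> \<le> ennreal ((1/2) ^ k \<omega>) \<Longrightarrow>
      AE \<omega> in M. increment x g \<omega> \<le> real (k \<omega>)"
proof -
  \<comment> \<open>The geometric rate makes the sum of \<open>p\<close>-th powers of one choice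
    from each \<open>G n\<close> have a bounded conditional expectation.\<close>
  define G where "G n = {g \<in> \<L>. (AE \<omega> in M. 0 \<le> g \<omega>) \<and> (AE \<omega> in M. moment g \<omega> \<le> ennreal ((1/2) ^ n))}" for n :: nat
  have GL: "g \<in> \<L>" if "g \<in> G n" for g n using that by (simp add: G_def)
  \<comment> \<open>Such a sequence has the same essential supremum of increments as the uncountable
    family \<open>G n\<close>. Countability permits a measurable selection.\<close>
  define dense where "dense n gs \<longleftrightarrow> (\<forall>j. gs j \<in> G n) \<and>
    (\<forall>g\<in>G n. AE \<omega> in M. ereal (increment x g \<omega>) \<le> (SUP j. ereal (increment x (gs j) \<omega>)))"
    for n and gs :: "nat \<Rightarrow> 'a \<Rightarrow> real"
  have "\<exists>gs. dense n gs" for n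
  proof -
    let ?I = "\<lambda>g \<omega>. ereal (increment x g \<omega>)"
    have "?I ` G n \<subseteq> borel_measurable F"
      using increment_measurable[OF x] GL by auto
    then obtain C where C: "C \<subseteq> ?I ` G n" "countable C"
        "\<And>h. h \<in> ?I ` G n \<Longrightarrow> AE \<omega> in M. h \<omega> \<le> (SUP c\<in>C. c \<omega>)"
      by (rule essential_supremum) blast
    then obtain D where D: "countable D" "D \<subseteq> G n" "C = ?I ` D"
      using countable_subset_image[of C ?I "G n"] by auto
    have 0: "(\<lambda>_. 0) \<in> G n"
    proof -
      have "AE \<omega> in M. 0 = moment (\<lambda>_. 0) \<omega>"
        using nn_cond_exp_F_meas[of "\<lambda>_. 0"] by simp
      then show ?thesis
        using LFp_bounded[of "\<lambda>_. 0" 0] by (auto simp: G_def elim: eventually_mono)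
    qed
    \<comment> \<open>Inserting 0 makes the set nonempty, so that \<open>from_nat_into\<close>
      enumerates exactly its members.\<close>
    let ?D = "insert (\<lambda>_. 0) D"
    have range: "range (from_nat_into ?D) = ?D"
      using D(1) by (intro range_from_nat_into) auto
    have "dense n (from_nat_into ?D)"
      unfolding dense_def
    proof (intro conjI allI ballI)
      show "from_nat_into ?D j \<in> G n" for j
        using range 0 D(2) by (metis insert_subset rangeI subset_iff)
      fix g assume "g \<in> G n"
      then have "AE \<omega> in M. ?I g \<omega> \<le> (SUP c\<in>C. c \<omega>)" by (intro C(3)) auto
      then show "AE \<omega> in M. ?I g \<omega> \<le> (SUP j. ?I (from_nat_into ?D j) \<omega>)"
      proof eventually_elim
        case (elim \<omega>)
        have "(SUP c\<in>C. c \<omega>) = (SUP h\<in>D. ?I h \<omega>)"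
          unfolding D(3) by (simp add: image_image)
        also have "\<dots> \<le> (SUP h\<in>range (from_nat_into ?D). ?I h \<omega>)"
          unfolding range by (intro SUP_subset_mono) auto
        finally show ?case using elim by (simp add: image_image)
      qed
    qed
    then show ?thesis by blast
  qed
  then obtain gs where "\<And>n. dense n (gs n)" by metis
  then have gs: "\<And>n j. gs n j \<in> G n"
    "\<And>n g. g \<in> G n \<Longrightarrow> AE \<omega> in M. ereal (increment x g \<omega>) \<le> (SUP j. ereal (increment x (gs n j) \<omega>))"
    by (auto simp: dense_def)
  have I_meas [measurable]: "increment x (gs n j) \<in> L0 F" for n j
    using increment_measurable[OF x GL[OF gs(1)]] .
  \<comment> \<open>The first member of the sequence whose increment reaches the level
    \<open>n\<close>. Where none does, the value is arbitrary, which is why \<open>g_large\<close>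
    is stated as an implication.\<close>
  define J where "J n \<omega> = (LEAST j. real n \<le> increment x (gs n j) \<omega>)" for n \<omega>
  have J [measurable]: "J n \<in> measurable F (count_space UNIV)" for n
    unfolding J_def by measurable
  define g where "g n \<omega> = gs n (J n \<omega>) \<omega>" for n \<omega>
  have gL: "g n \<in> \<L>" for n
    unfolding g_def by (rule LFp_paste(1)[OF J GL[OF gs(1)]])
  have [measurable]: "g n \<in> L0 M" for n using gL LFp_measurable by blast
  have g_nonneg: "AE \<omega> in M. 0 \<le> g n \<omega>" for n
  proof -
    have "AE \<omega> in M. \<forall>j. 0 \<le> gs n j \<omega>"
      using gs(1) by (subst AE_all_countable) (auto simp: G_def)
    then show ?thesis by eventually_elim (simp add: g_def)
  qed
  have g_moment: "AE \<omega> in M. moment (g n) \<omega> \<le> ennreal ((1/2) ^ n)" for n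
  proof -
    have "AE \<omega> in M. \<forall>j. moment (gs n j) \<omega> \<le> ennreal ((1/2) ^ n)"
      using gs(1) by (subst AE_all_countable) (auto simp: G_def)
    moreover have "AE \<omega> in M. moment (g n) \<omega> = moment (gs n (J n \<omega>)) \<omega>"
      unfolding g_def by (rule LFp_paste(2)[OF J GL[OF gs(1)]])
    ultimately show ?thesis by eventually_elim simp
  qed
  have g_large: "AE \<omega> in M. (\<exists>j. real n \<le> increment x (gs n j) \<omega>) \<longrightarrow> real n \<le> increment x (g n) \<omega>" for n
  proof -
    have "AE \<omega> in M. \<forall>j. \<omega> \<in> {\<omega> \<in> space M. J n \<omega> = j} \<longrightarrow> increment x (g n) \<omega> = increment x (gs n j) \<omega>"
    proof (subst AE_all_countable, intro allI increment_local x gL GL[OF gs(1)])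
      show "{\<omega> \<in> space M. J n \<omega> = j} \<in> sets F" for j
        unfolding space_F[symmetric] by measurable
    qed (auto simp: g_def)
    with AE_space show ?thesis
      by eventually_elim (auto simp: J_def intro: LeastI)
  qed

  define T where "T \<omega> = (\<Sum>n. ennreal (\<bar>g n \<omega>\<bar> powr p))" for \<omega>
  define H where "H \<omega> = enn2real (T \<omega>) powr (1 / p)" for \<omega>
  have [measurable]: "T \<in> borel_measurable M" unfolding T_def by measurable
  have [measurable]: "H \<in> L0 M" unfolding H_def by measurable
  \<comment> \<open>The bound is the sum of the geometric series. Integrating it shows that
    \<open>T\<close> is a.e. finite, so that its real root \<open>H\<close> is meaningful and lies
    in \<L>.\<close>
  have ET: "AE \<omega> in M. nn_cond_exp M F T \<omega> \<le> 2"
  proof -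
    have "AE \<omega> in M. \<forall>n. moment (g n) \<omega> \<le> ennreal ((1/2) ^ n)"
      using g_moment by (subst AE_all_countable) auto
    moreover have "AE \<omega> in M. (\<Sum>n. moment (g n) \<omega>) = nn_cond_exp M F T \<omega>"
      unfolding T_def by (intro nn_cond_exp_suminf) measurable
    ultimately show ?thesis
    proof eventually_elim
      case (elim \<omega>)
      have "(\<Sum>n. moment (g n) \<omega>) \<le> (\<Sum>n. ennreal ((1/2) ^ n))"
        using elim by (intro suminf_le) auto
      also have "\<dots> = ennreal 2"
        using geometric_sums[of "1/2 :: real"] by (intro suminf_ennreal_eq) auto
      finally show ?case using elim by simp
    qed
  qed
  have T_fin: "AE \<omega> in M. T \<omega> \<noteq> \<infinity>"
  proof -
    have "(\<integral>\<^sup>+\<omega>. T \<omega> \<partial>M) = (\<integral>\<^sup>+\<omega>. nn_cond_exp M F T \<omega> \<partial>M)"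
      using nn_cond_exp_intg[of "\<lambda>_. 1" T] by simp
    also have "\<dots> \<le> (\<integral>\<^sup>+\<omega>. 2 \<partial>M)" using ET by (rule nn_integral_mono_AE)
    also have "\<dots> = 2" by (simp add: emeasure_space_1)
    finally have "(\<integral>\<^sup>+\<omega>. T \<omega> \<partial>M) \<noteq> \<infinity>" by (auto simp: top_unique)
    then show ?thesis by (intro nn_integral_PInf_AE) auto
  qed
  have H_powr: "\<bar>H \<omega>\<bar> powr p = enn2real (T \<omega>)" for \<omega>
    using p_ge_1 by (simp add: H_def powr_powr)
  have HL: "H \<in> \<L>"
  proof -
    have "AE \<omega> in M. moment H \<omega> \<le> nn_cond_exp M F T \<omega>"
      unfolding H_powr using T_fin by (intro nn_cond_exp_mono) (auto elim!: eventually_mono simp: ennreal_enn2real_if)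
    with ET have "AE \<omega> in M. moment H \<omega> < \<infinity>"
      by eventually_elim (auto simp: less_top[symmetric] top_unique)
    then show ?thesis by (simp add: LFp_iff)
  qed
  have gH: "AE \<omega> in M. g n \<omega> \<le> H \<omega>" for n
    using T_fin g_nonneg[of n]
  proof eventually_elim
    case (elim \<omega>)
    have "(\<Sum>i\<in>{n}. ennreal (\<bar>g i \<omega>\<bar> powr p)) \<le> T \<omega>"
      unfolding T_def by (rule sum_le_suminf) simp_all
    then have "ennreal (\<bar>g n \<omega>\<bar> powr p) \<le> T \<omega>" by simp
    then have "\<bar>g n \<omega>\<bar> powr p \<le> enn2real (T \<omega>)"
      using elim enn2real_mono[of "ennreal (\<bar>g n \<omega>\<bar> powr p)" "T \<omega>"] by (simp add: less_top)
    then have "(\<bar>g n \<omega>\<bar> powr p) powr (1 / p) \<le> H \<omega>"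
      unfolding H_def using p_ge_1 by (intro powr_mono2) auto
    then show ?case using elim p_ge_1 by (simp add: powr_powr)
  qed
  have "AE \<omega> in M. \<forall>n. increment x (g n) \<omega> \<le> increment x H \<omega>"
    by (subst AE_all_countable) (intro allI increment_mono x gL HL gH)
  moreover have "AE \<omega> in M. \<forall>n. (\<exists>j. real n \<le> increment x (gs n j) \<omega>) \<longrightarrow> real n \<le> increment x (g n) \<omega>"
    using g_large by (subst AE_all_countable) auto
  \<comment> \<open>If every level \<open>n\<close> were reached at \<omega>, the single number
    \<open>increment x H \<omega>\<close> would be at least every \<open>n\<close>.\<close>
  ultimately have ex: "AE \<omega> in M. \<exists>n. \<forall>j. increment x (gs n j) \<omega> < real n"
  proof eventually_elim
    case (elim \<omega>)
    obtain n where "increment x H \<omega> < real n" using reals_Archimedean2 by blast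
    with elim(1)[rule_format, of n] have "increment x (g n) \<omega> < real n" by linarith
    with elim(2)[rule_format, of n] have "\<not> (\<exists>j. real n \<le> increment x (gs n j) \<omega>)"
      by (meson not_le)
    then show ?case by (auto simp: not_le)
  qed

  define k where "k \<omega> = (LEAST n. \<forall>j. increment x (gs n j) \<omega> < real n)" for \<omega>
  have k [measurable]: "k \<in> measurable F (count_space UNIV)"
    unfolding k_def by measurable
  show thesis
  proof (rule that[OF k])
    fix h assume h: "h \<in> \<L>" "AE \<omega> in M. 0 \<le> h \<omega>" "AE \<omega> in M. moment h \<omega> \<le> ennreal ((1/2) ^ k \<omega>)"
    have [measurable]: "h \<in> L0 M" using h LFp_measurable by blast
    \<comment> \<open>The bound on the moment of \<open>h\<close> equals \<open>(1/2) ^ n\<close>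
      only where \<open>k\<close> is \<open>n\<close>. Cutting \<open>h\<close> to zero elsewhere
      gives a member of \<open>G n\<close>, and locality keeps its increment unchanged on
      \<open>K n\<close>.\<close>
    define K where "K n = {\<omega> \<in> space M. k \<omega> = n}" for n
    have K: "K n \<in> sets F" for n unfolding K_def space_F[symmetric] by measurable
    have "AE \<omega> in M. \<omega> \<in> K n \<longrightarrow> ereal (increment x h \<omega>) \<le> (SUP j. ereal (increment x (gs n j) \<omega>))" for n
    proof -
      let ?h = "\<lambda>\<omega>. indicator (K n) \<omega> * h \<omega>"
      have hL: "?h \<in> \<L>" by (rule LFp_restrict[OF K h(1)])
      have "AE \<omega> in M. moment ?h \<omega> = ennreal (\<bar>indicator (K n) \<omega>\<bar> powr p) * moment h \<omega>"
        using K[of n] LFp_measurable[OF h(1)] by (intro moment_mult) auto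
      with h(3) have "AE \<omega> in M. moment ?h \<omega> \<le> ennreal ((1/2) ^ n)"
        by eventually_elim (auto simp: K_def indicator_def)
      moreover have "AE \<omega> in M. 0 \<le> ?h \<omega>"
        using h(2) by eventually_elim simp
      ultimately have "?h \<in> G n"
        using hL by (simp add: G_def)
      then have "AE \<omega> in M. ereal (increment x ?h \<omega>) \<le> (SUP j. ereal (increment x (gs n j) \<omega>))"
        by (rule gs(2))
      moreover have "AE \<omega> in M. \<omega> \<in> K n \<longrightarrow> increment x h \<omega> = increment x ?h \<omega>"
        by (intro increment_local x K h(1) hL) auto
      ultimately show ?thesis by eventually_elim auto
    qed
    then have "AE \<omega> in M. \<forall>n. \<omega> \<in> K n \<longrightarrow> ereal (increment x h \<omega>) \<le> (SUP j. ereal (increment x (gs n j) \<omega>))"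
      by (subst AE_all_countable) auto
    with ex AE_space show "AE \<omega> in M. increment x h \<omega> \<le> real (k \<omega>)"
    proof eventually_elim
      case (elim \<omega>)
      have "\<forall>j. increment x (gs (k \<omega>) j) \<omega> < real (k \<omega>)"
        unfolding k_def using elim(1) by (rule LeastI_ex)
      then have "(SUP j. ereal (increment x (gs (k \<omega>) j) \<omega>)) \<le> ereal (real (k \<omega>))"
        by (intro SUP_least) (auto intro: less_imp_le)
      moreover have "\<omega> \<in> K (k \<omega>)" using elim(2) by (simp add: K_def)
      ultimately have "ereal (increment x h \<omega>) \<le> ereal (real (k \<omega>))"
        using elim(3) by (meson order_trans)
      then show ?case by simp
    qed
  qed
qed

text \<open>Boundedness near 0 becomes continuity by convex scaling: \<open>g\<close> is enlarged to
  \<open>h\<close> by the factor \<open>1 / \<xi>\<close>, the bound \<open>k\<close> applies to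
  \<open>h\<close>, and scaling back multiplies it by \<xi>. The modulus \<open>d\<close> is the
  moment bound of the previous lemma times \<open>\<xi> powr p\<close>. Keeping the condition on the
  moment inside the a.e. statement makes the modulus usable pointwise.\<close>

lemma f_continuity_modulus:
  assumes x: "x \<in> \<L>" and e: "e \<in> L0_pp M F"
  obtains d where "d \<in> L0_pp M F"
    "\<And>g. g \<in> \<L> \<Longrightarrow> AE \<omega> in M. moment g \<omega> \<le> ennreal (d \<omega>) \<longrightarrow> increment x (\<lambda>\<omega>. \<bar>g \<omega>\<bar>) \<omega> \<le> e \<omega>"
    "\<And>g. g \<in> \<L> \<Longrightarrow> AE \<omega> in M. moment g \<omega> \<le> ennreal (d \<omega>) \<longrightarrow> \<bar>f (\<lambda>\<omega>. x \<omega> + g \<omega>) \<omega> - f x \<omega>\<bar> \<le> e \<omega>"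
proof -
  obtain k :: "'a \<Rightarrow> nat" where k [measurable]: "k \<in> measurable F (count_space UNIV)"
    and bound: "\<And>g. g \<in> \<L> \<Longrightarrow> AE \<omega> in M. 0 \<le> g \<omega> \<Longrightarrow> AE \<omega> in M. moment g \<omega> \<le> ennreal ((1/2) ^ k \<omega>) \<Longrightarrow>
      AE \<omega> in M. increment x g \<omega> \<le> real (k \<omega>)"
    by (rule increment_bounded_near_0[OF x]) blast
  have [measurable]: "e \<in> L0 F" and e_pos: "AE \<omega> in M. 0 < e \<omega>" using e by (auto simp: L0_pp_def)
  \<comment> \<open>The cap at 1 keeps \<xi> a convex coefficient, and the summand 1 in the
    denominator covers \<open>k \<omega> = 0\<close>. The value 1 on the null set where
    \<open>e\<close> is not positive makes \<xi> positive everywhere.\<close>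
  define \<xi> where "\<xi> \<omega> = (if 0 < e \<omega> then min 1 (e \<omega> / (real (k \<omega>) + 1)) else 1)" for \<omega>
  have \<xi> [measurable]: "\<xi> \<in> L0 F" unfolding \<xi>_def by measurable
  have \<xi>_pos: "0 < \<xi> \<omega>" "\<xi> \<omega> \<le> 1" for \<omega> by (auto simp: \<xi>_def)
  have \<xi>_k: "\<xi> \<omega> * real (k \<omega>) \<le> e \<omega>" if "0 < e \<omega>" for \<omega>
  proof -
    have "\<xi> \<omega> * real (k \<omega>) \<le> (e \<omega> / (real (k \<omega>) + 1)) * (real (k \<omega>) + 1)"
      using that \<xi>_pos(1)[of \<omega>] by (intro mult_mono) (auto simp: \<xi>_def)
    then show ?thesis by simp
  qed
  define d where "d \<omega> = \<xi> \<omega> powr p * (1/2) ^ k \<omega>" for \<omega>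
  have d [measurable]: "d \<in> L0 F" unfolding d_def by measurable
  have d_pp: "d \<in> L0_pp M F"
    unfolding L0_pp_def using \<xi>_pos(1) by (auto simp: d_def less_imp_neq[symmetric])
  have inc: "AE \<omega> in M. moment g \<omega> \<le> ennreal (d \<omega>) \<longrightarrow> increment x (\<lambda>\<omega>. \<bar>g \<omega>\<bar>) \<omega> \<le> e \<omega>"
    if g: "g \<in> \<L>" for g
  proof -
    have [measurable]: "g \<in> L0 M" using g LFp_measurable by blast
    \<comment> \<open>The moment condition is assumed only on this \<open>F\<close>-measurable set.
      Cutting off outside \<open>A\<close> makes the bound for \<open>h\<close> global, and locality
      transfers the result back to \<open>g\<close> on \<open>A\<close>.\<close>
    define A where "A = {\<omega> \<in> space M. moment g \<omega> \<le> ennreal (d \<omega>)}"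
    have A [measurable]: "A \<in> sets F" unfolding A_def space_F[symmetric] by measurable
    define h where "h \<omega> = (indicator A \<omega> / \<xi> \<omega>) * \<bar>g \<omega>\<bar>" for \<omega>
    have hL: "h \<in> \<L>" unfolding h_def by (intro LFp_mult LFp_abs g) measurable
    have "AE \<omega> in M. moment h \<omega> = ennreal (\<bar>indicator A \<omega> / \<xi> \<omega>\<bar> powr p) * moment (\<lambda>\<omega>. \<bar>g \<omega>\<bar>) \<omega>"
      unfolding h_def by (intro moment_mult) measurable
    then have "AE \<omega> in M. moment h \<omega> \<le> ennreal ((1/2) ^ k \<omega>)"
    proof eventually_elim
      case (elim \<omega>)
      show ?case
      proof (cases "\<omega> \<in> A")
        case True
        then have "moment h \<omega> \<le> ennreal ((1 / \<xi> \<omega>) powr p) * ennreal (d \<omega>)"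
          using elim \<xi>_pos(1)[of \<omega>] by (auto simp: A_def intro!: mult_left_mono)
        also have "\<dots> = ennreal ((1 / \<xi> \<omega>) powr p * d \<omega>)"
          by (intro ennreal_mult[symmetric]) (auto simp: d_def)
        also have "(1 / \<xi> \<omega>) powr p * d \<omega> = (1/2) ^ k \<omega>"
          using \<xi>_pos(1)[of \<omega>] by (simp add: d_def powr_divide)
        finally show ?thesis .
      qed (use elim in simp)
    qed
    then have "AE \<omega> in M. increment x h \<omega> \<le> real (k \<omega>)"
      using \<xi>_pos(1) by (intro bound hL) (auto simp: h_def less_imp_le)
    moreover have "AE \<omega> in M. increment x (\<lambda>\<omega>. \<xi> \<omega> * h \<omega>) \<omega> \<le> \<xi> \<omega> * increment x h \<omega>"
      using \<xi>_pos by (intro increment_scale x hL \<xi>) (auto simp: less_imp_le)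
    moreover have "AE \<omega> in M. \<omega> \<in> A \<longrightarrow> increment x (\<lambda>\<omega>. \<bar>g \<omega>\<bar>) \<omega> = increment x (\<lambda>\<omega>. \<xi> \<omega> * h \<omega>) \<omega>"
      using \<xi>_pos(1) by (intro increment_local x A LFp_abs g LFp_mult \<xi> hL)
        (auto simp: h_def less_imp_neq[symmetric])
    ultimately show ?thesis
      using e_pos AE_space
    proof eventually_elim
      case (elim \<omega>)
      show ?case
      proof
        assume "moment g \<omega> \<le> ennreal (d \<omega>)"
        then have "\<omega> \<in> A" using elim by (simp add: A_def)
        then have "increment x (\<lambda>\<omega>. \<bar>g \<omega>\<bar>) \<omega> \<le> \<xi> \<omega> * increment x h \<omega>" using elim by simp
        also have "\<dots> \<le> \<xi> \<omega> * real (k \<omega>)"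
          using elim \<xi>_pos(1)[of \<omega>] by (intro mult_left_mono) auto
        also have "\<dots> \<le> e \<omega>" using elim \<xi>_k by simp
        finally show "increment x (\<lambda>\<omega>. \<bar>g \<omega>\<bar>) \<omega> \<le> e \<omega>" .
      qed
    qed
  qed
  show thesis
  proof (rule that[OF d_pp])
    fix g assume g: "g \<in> \<L>"
    show "AE \<omega> in M. moment g \<omega> \<le> ennreal (d \<omega>) \<longrightarrow> \<bar>f (\<lambda>\<omega>. x \<omega> + g \<omega>) \<omega> - f x \<omega>\<bar> \<le> e \<omega>"
      using inc[OF g] f_increment_abs[OF x g] by eventually_elim auto
  qed (rule inc)
qed

text \<open>A modulus is chosen for each of the tolerances \<open>1 / Suc j\<close>. There are
  countably many exceptional null sets, and outside them the usual epsilon argument works at each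
  point.\<close>

lemma f_tendsto:
  assumes x: "x \<in> \<L>" and g: "\<And>i. g i \<in> \<L>" and lim: "AE \<omega> in M. (\<lambda>i. moment (g i) \<omega>) \<longlonglongrightarrow> 0"
  shows "AE \<omega> in M. (\<lambda>i. f (\<lambda>\<omega>. x \<omega> + g i \<omega>) \<omega>) \<longlonglongrightarrow> f x \<omega>"
proof -
  define modulus where "modulus j d \<longleftrightarrow> (AE \<omega> in M. 0 < d \<omega>) \<and>
    (\<forall>i. AE \<omega> in M. moment (g i) \<omega> \<le> ennreal (d \<omega>) \<longrightarrow>
      \<bar>f (\<lambda>\<omega>. x \<omega> + g i \<omega>) \<omega> - f x \<omega>\<bar> \<le> 1 / real (Suc j))" for j and d :: "'a \<Rightarrow> real"
  have "\<exists>d. modulus j d" for j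
  proof -
    have "(\<lambda>_. 1 / real (Suc j)) \<in> L0_pp M F" by (simp add: L0_pp_def)
    then obtain d where "d \<in> L0_pp M F" "\<And>g. g \<in> \<L> \<Longrightarrow> AE \<omega> in M. moment g \<omega> \<le> ennreal (d \<omega>) \<longrightarrow>
        \<bar>f (\<lambda>\<omega>. x \<omega> + g \<omega>) \<omega> - f x \<omega>\<bar> \<le> 1 / real (Suc j)"
      by (rule f_continuity_modulus[OF x]) blast
    then show ?thesis
      unfolding modulus_def using g by (intro exI[of _ d]) (auto simp: L0_pp_def)
  qed
  then obtain d where "\<And>j. modulus j (d j)" by metis
  then have d: "\<And>j. AE \<omega> in M. 0 < d j \<omega>"
    "\<And>j i. AE \<omega> in M. moment (g i) \<omega> \<le> ennreal (d j \<omega>) \<longrightarrow>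
      \<bar>f (\<lambda>\<omega>. x \<omega> + g i \<omega>) \<omega> - f x \<omega>\<bar> \<le> 1 / real (Suc j)"
    by (simp_all add: modulus_def)
  have "AE \<omega> in M. \<forall>j. 0 < d j \<omega>" using d(1) by (subst AE_all_countable) auto
  moreover have "AE \<omega> in M. \<forall>j i. moment (g i) \<omega> \<le> ennreal (d j \<omega>) \<longrightarrow>
      \<bar>f (\<lambda>\<omega>. x \<omega> + g i \<omega>) \<omega> - f x \<omega>\<bar> \<le> 1 / real (Suc j)"
    using d(2) by (simp add: AE_all_countable)
  ultimately show ?thesis using lim
  proof eventually_elim
    case (elim \<omega>)
    show ?case
    proof (rule LIMSEQ_I)
      fix r :: real assume "0 < r"
      then obtain j where j: "1 / real (Suc j) < r"
        by (metis nat_approx_posE)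
      have "\<forall>\<^sub>F i in sequentially. moment (g i) \<omega> < ennreal (d j \<omega>)"
        using elim by (intro order_tendstoD(2)[OF elim(3)]) (auto simp: ennreal_less_zero_iff)
      then obtain n where "\<And>i. n \<le> i \<Longrightarrow> moment (g i) \<omega> < ennreal (d j \<omega>)"
        by (auto simp: eventually_sequentially)
      then have "norm (f (\<lambda>\<omega>. x \<omega> + g i \<omega>) \<omega> - f x \<omega>) < r" if "n \<le> i" for i
        using elim(2)[rule_format, of i j] j that by (simp add: less_imp_le)
      then show "\<exists>n. \<forall>i\<ge>n. norm (f (\<lambda>\<omega>. x \<omega> + g i \<omega>) \<omega> - f x \<omega>) < r" by blast
    qed
  qed
qed

end

section \<open>Conditional subgradients\<close>

lemma simple_function_bounded:
  fixes s :: "'a \<Rightarrow> real"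
  assumes "simple_function M s"
  obtains C where "\<And>\<omega>. \<omega> \<in> space M \<Longrightarrow> \<bar>s \<omega>\<bar> \<le> C"
proof
  show "\<bar>s \<omega>\<bar> \<le> Max ((\<lambda>\<omega>. \<bar>s \<omega>\<bar>) ` space M)" if "\<omega> \<in> space M" for \<omega>
  proof (rule Max_ge)
    have "finite (abs ` s ` space M)" using assms by (auto dest: simple_functionD)
    then show "finite ((\<lambda>\<omega>. \<bar>s \<omega>\<bar>) ` space M)" by (simp add: image_image)
  qed (use that in auto)
qed

lemma integrable_simple_mult:
  fixes s v :: "'a \<Rightarrow> real"
  assumes s: "simple_function M s" and v: "integrable M v"
  shows "integrable M (\<lambda>\<omega>. s \<omega> * v \<omega>)"
proof -
  obtain C where C: "\<And>\<omega>. \<omega> \<in> space M \<Longrightarrow> \<bar>s \<omega>\<bar> \<le> C" by (rule simple_function_bounded[OF s]) blast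
  have [measurable]: "s \<in> L0 M" using s by (rule borel_measurable_simple_function)
  have [measurable]: "v \<in> L0 M" using v by auto
  show ?thesis
  proof (rule Bochner_Integration.integrable_bound)
    show "integrable M (\<lambda>\<omega>. C * v \<omega>)" using v by simp
    show "AE \<omega> in M. norm (s \<omega> * v \<omega>) \<le> norm (C * v \<omega>)"
    proof (rule AE_I2)
      fix \<omega> assume "\<omega> \<in> space M"
      from C[OF this] show "norm (s \<omega> * v \<omega>) \<le> norm (C * v \<omega>)"
        by (auto simp: abs_mult intro!: mult_right_mono)
    qed
  qed measurable
qed

context finite_measure_subalgebra
begin

lemma nn_cond_exp_finite_if_integrable:
  assumes z: "integrable M z"
  shows "AE x in M. nn_cond_exp M F (\<lambda>x. ennreal \<bar>z x\<bar>) x < \<infinity>"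
proof -
  have [measurable]: "z \<in> borel_measurable M" using z by auto
  have "(\<integral>\<^sup>+x. nn_cond_exp M F (\<lambda>x. ennreal \<bar>z x\<bar>) x \<partial>M) = (\<integral>\<^sup>+x. ennreal \<bar>z x\<bar> \<partial>M)"
    using nn_cond_exp_intg[of "\<lambda>_. 1" "\<lambda>x. ennreal \<bar>z x\<bar>"] by simp
  also have "\<dots> < \<infinity>" using z by (simp add: integrable_iff_bounded)
  finally have "AE x in M. nn_cond_exp M F (\<lambda>x. ennreal \<bar>z x\<bar>) x \<noteq> \<infinity>"
    by (intro nn_integral_PInf_AE) auto
  then show ?thesis by eventually_elim (simp add: less_top)
qed

lemma real_cond_exp_nonneg_eq:
  assumes "\<And>x. 0 \<le> z x" "AE x in M. nn_cond_exp M F (\<lambda>x. ennreal (z x)) x < \<infinity>"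
  shows "AE x in M. ennreal (real_cond_exp M F z x) = nn_cond_exp M F (\<lambda>x. ennreal (z x)) x"
proof -
  have "(\<lambda>x. ennreal (- z x)) = (\<lambda>_. 0)" using assms(1) by (simp add: ennreal_neg)
  moreover have "AE x in M. 0 = nn_cond_exp M F (\<lambda>_. 0) x"
    by (rule nn_cond_exp_F_meas) simp
  ultimately show ?thesis
    using assms(2) by (auto elim!: eventually_elim2 simp: real_cond_exp_def ennreal_enn2real_if)
qed

text \<open>Tested on the set where \<open>w < u\<close>, which lies in \<open>F\<close>: there
  \<open>u - w\<close> is positive but its integral is at most 0.\<close>

lemma AE_le_if_set_integrals_le:
  assumes [measurable]: "u \<in> borel_measurable F" "w \<in> borel_measurable F"
    and int: "integrable M u" "integrable M w"
    and le: "\<And>A. A \<in> sets F \<Longrightarrow> (\<integral>x. indicator A x * u x \<partial>M) \<le> (\<integral>x. indicator A x * w x \<partial>M)"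
  shows "AE x in M. u x \<le> (w x :: real)"
proof -
  define A where "A = {x \<in> space M. w x < u x}"
  have A: "A \<in> sets F" unfolding A_def space_F[symmetric] by measurable
  have [measurable]: "A \<in> sets M" using A sets_F_into_M by auto
  have i: "integrable M (\<lambda>x. indicator A x * u x)" "integrable M (\<lambda>x. indicator A x * w x)"
    using int by (auto intro: integrable_real_mult_indicator simp: mult.commute)
  have "0 \<le> (\<integral>x. indicator A x * u x - indicator A x * w x \<partial>M)"
    by (intro integral_nonneg_AE) (auto simp: A_def indicator_def)
  moreover have "(\<integral>x. indicator A x * u x - indicator A x * w x \<partial>M) \<le> 0"
    using le[OF A] i by simp
  ultimately have "(\<integral>x. indicator A x * u x - indicator A x * w x \<partial>M) = 0" by simp
  then have "AE x in M. indicator A x * u x - indicator A x * w x = 0"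
    using i by (subst (asm) integral_nonneg_eq_0_iff_AE) (auto simp: A_def indicator_def)
  with AE_space show ?thesis
    by eventually_elim (auto simp: A_def indicator_def not_less split: if_splits)
qed

end

section \<open>Subgradients of the expected and of the conditional increment\<close>

context LFp_convex_risk_measure
begin

text \<open>Translation invariance gives the constant \<open>c\<close> the increment
  \<open>c\<close>, and monotonicity compares \<open>h\<close> with \<open>C\<close> and
  \<open>- C\<close>. This is what makes expected increments of simple functions finite.\<close>

lemma increment_abs_le:
  assumes x: "x \<in> \<L>" and h: "h \<in> L0 M" "AE \<omega> in M. \<bar>h \<omega>\<bar> \<le> C"
  shows "AE \<omega> in M. \<bar>increment x h \<omega>\<bar> \<le> C"
proof -
  have hL: "h \<in> \<L>" using h by (rule LFp_bounded)
  have const: "AE \<omega> in M. increment x (\<lambda>_. c) \<omega> = c" for c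
    using f_translate[OF x, of "\<lambda>_. - c"] by (auto simp: increment_def)
  have cL: "(\<lambda>_. c) \<in> \<L>" for c by (intro L0_subset_LFp) auto
  have "AE \<omega> in M. increment x h \<omega> \<le> increment x (\<lambda>_. C) \<omega>"
    using h(2) by (intro increment_mono x hL cL) (auto elim: eventually_mono)
  moreover have "AE \<omega> in M. increment x (\<lambda>_. - C) \<omega> \<le> increment x h \<omega>"
    using h(2) by (intro increment_mono x hL cL) (auto elim: eventually_mono)
  ultimately show ?thesis using const[of C] const[of "- C"]
    by eventually_elim auto
qed

lemma simple_function_LFp: "simple_function M s \<Longrightarrow> s \<in> \<L>"
  by (rule simple_function_bounded, assumption)
    (auto intro!: LFp_bounded borel_measurable_simple_function)

lemma integrable_increment_simple:
  assumes x: "x \<in> \<L>" and s: "simple_function M s"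
  shows "integrable M (increment x s)"
proof -
  obtain C where C: "\<And>\<omega>. \<omega> \<in> space M \<Longrightarrow> \<bar>s \<omega>\<bar> \<le> C" by (rule simple_function_bounded[OF s]) blast
  have "AE \<omega> in M. \<bar>increment x s \<omega>\<bar> \<le> C"
    using C s by (intro increment_abs_le x) (auto intro: borel_measurable_simple_function)
  then show ?thesis
    using increment_measurable[OF x simple_function_LFp[OF s]] measurable_F_into_M
    by (intro integrable_const_bound[of _ C]) auto
qed

text \<open>
  The subgradient of the expected increment along simple functions is a finitely additive set
  function; it is countably additive because \<open>f\<close> is continuous.
\<close>

lemma integral_subgradient:
  assumes x: "x \<in> \<L>"
  obtains v where "v \<in> L0 M" "\<And>\<omega>. 0 \<le> v \<omega>" "integrable M v"
    "\<And>s. simple_function M s \<Longrightarrow> (\<integral>\<omega>. s \<omega> * v \<omega> \<partial>M) \<le> (\<integral>\<omega>. increment x s \<omega> \<partial>M)"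
proof -
  define X where "X = {s :: 'a \<Rightarrow> real. simple_function M s}"
  define P where "P s = (\<integral>\<omega>. increment x s \<omega> \<partial>M)" for s
  have XL: "s \<in> \<L>" if "s \<in> X" for s using that simple_function_LFp by (simp add: X_def)
  have Xint: "integrable M (increment x s)" if "s \<in> X" for s
    using that integrable_increment_simple[OF x] by (simp add: X_def)
  have X: "subspace X"
    unfolding subspace_def by (auto simp: X_def plus_fun_def zero_fun_def scaleR_fun_def)
  have P_conv: "convex_on X P"
    unfolding convex_on_def
  proof (intro conjI ballI allI impI)
    show "convex X" using X by (rule subspace_imp_convex)
    fix s t and a b :: real assume s: "s \<in> X" and t: "t \<in> X" and ab: "0 \<le> a" "0 \<le> b" "a + b = 1"
    have st: "a *\<^sub>R s + b *\<^sub>R t \<in> X" using X s t by (simp add: subspace_add subspace_scale)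
    have "AE \<omega> in M. f (\<lambda>\<omega>. a * (x \<omega> - s \<omega>) + (1 - a) * (x \<omega> - t \<omega>)) \<omega> \<le>
        a * f (\<lambda>\<omega>. x \<omega> - s \<omega>) \<omega> + (1 - a) * f (\<lambda>\<omega>. x \<omega> - t \<omega>) \<omega>"
      using x XL s t ab by (intro f_convex LFp_diff) auto
    moreover have "(\<lambda>\<omega>. a * (x \<omega> - s \<omega>) + (1 - a) * (x \<omega> - t \<omega>)) = (\<lambda>\<omega>. x \<omega> - (a *\<^sub>R s + b *\<^sub>R t) \<omega>)"
      using ab(3) by (auto simp: scaleR_fun_def algebra_simps simp flip: distrib_right)
    moreover have b: "b = 1 - a" using ab by simp
    ultimately have "AE \<omega> in M. increment x (a *\<^sub>R s + b *\<^sub>R t) \<omega> \<le> a * increment x s \<omega> + b * increment x t \<omega>"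
      unfolding b by (auto elim!: eventually_mono simp: increment_def algebra_simps)
    then have "P (a *\<^sub>R s + b *\<^sub>R t) \<le> (\<integral>\<omega>. a * increment x s \<omega> + b * increment x t \<omega> \<partial>M)"
      unfolding P_def using Xint s t st by (intro integral_mono_AE) auto
    also have "\<dots> = a * P s + b * P t"
      unfolding P_def using Xint s t by simp
    finally show "P (a *\<^sub>R s + b *\<^sub>R t) \<le> a * P s + b * P t" .
  qed
  have "P 0 = 0" by (simp add: P_def zero_fun_def increment_0)
  then obtain l where l_add: "\<And>s t. s \<in> X \<Longrightarrow> t \<in> X \<Longrightarrow> l (s + t) = l s + l t"
    and l_scale: "\<And>c s. s \<in> X \<Longrightarrow> l (c *\<^sub>R s) = c * l s" and l_le: "\<And>s. s \<in> X \<Longrightarrow> l s \<le> P s"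
    by (rule convex_dominates_linear[OF X P_conv]) blast

  have P_nonpos: "P s \<le> 0" if "s \<in> X" "AE \<omega> in M. s \<omega> \<le> 0" for s
  proof -
    have "AE \<omega> in M. increment x s \<omega> \<le> increment x (\<lambda>_. 0) \<omega>"
      using that by (intro increment_mono x XL) (auto simp: X_def)
    then have "AE \<omega> in M. 0 \<le> - increment x s \<omega>"
      by (auto elim!: eventually_mono simp: increment_0)
    then have "0 \<le> (\<integral>\<omega>. - increment x s \<omega> \<partial>M)" by (rule integral_nonneg_AE)
    then show ?thesis by (simp add: P_def)
  qed
  have l_uminus: "l (- s) = - l s" if "s \<in> X" for s
    using l_scale[OF that, of "- 1"] by simp
  have l_nonneg: "0 \<le> l s" if s: "s \<in> X" "AE \<omega> in M. 0 \<le> s \<omega>" for s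
  proof -
    have "l (- s) \<le> P (- s)" using subspace_neg[OF X] s by (intro l_le)
    also have "\<dots> \<le> 0"
      using s subspace_neg[OF X] by (intro P_nonpos) (auto elim: eventually_mono)
    finally show ?thesis using l_uminus[OF s(1)] by simp
  qed
  \<comment> \<open>A linear functional that is nonnegative on a.s. nonnegative functions ignores
    null sets. This later gives absolute continuity of the measure built from
    \<open>l\<close>.\<close>
  have l_cong: "l s = l t" if s: "s \<in> X" and t: "t \<in> X" and eq: "AE \<omega> in M. s \<omega> = t \<omega>" for s t
  proof -
    have le: "l s \<le> l t" if s: "s \<in> X" and t: "t \<in> X" and eq: "AE \<omega> in M. s \<omega> = t \<omega>" for s t
    proof -
      have "0 \<le> l (t - s)"
        using eq subspace_diff[OF X t s] by (intro l_nonneg) (auto elim: eventually_mono)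
      moreover have "l (t - s) + l s = l t"
        using l_add[of "t - s" s] subspace_diff[OF X t s] s by simp
      ultimately show ?thesis by simp
    qed
    have "AE \<omega> in M. t \<omega> = s \<omega>" using eq by eventually_elim simp
    with le[OF s t eq] le[OF t s] show ?thesis by simp
  qed

  have ind: "indicator B \<in> X" if "B \<in> sets M" for B using that by (simp add: X_def)
  define \<mu> where "\<mu> B = ennreal (l (indicator B))" for B
  have pos: "positive (sets M) \<mu>"
    using l_scale[OF ind[of "{}"], of 0] by (auto simp: positive_def \<mu>_def scaleR_fun_def indicator_def[abs_def])
  have add: "additive (sets M) \<mu>"
    unfolding additive_def
  proof (intro ballI impI)
    fix A B assume A: "A \<in> sets M" and B: "B \<in> sets M" and "A \<inter> B = {}"
    then have "indicator (A \<union> B) = (indicator A + indicator B :: 'a \<Rightarrow> real)"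
      by (auto simp: fun_eq_iff indicator_def)
    then show "\<mu> (A \<union> B) = \<mu> A + \<mu> B"
      using l_add[OF ind[OF A] ind[OF B]] l_nonneg[OF ind[OF A]] l_nonneg[OF ind[OF B]]
      by (simp add: \<mu>_def ennreal_plus)
  qed
  \<comment> \<open>Along sets decreasing to the empty set, \<open>\<mu> (B i)\<close> lies between
    0 and the expected increment of the indicator. The latter tends to 0 by \<open>f_tendsto\<close>
    and by dominated convergence with the bound 1.\<close>
  have cadd: "countably_additive (sets M) \<mu>"
  proof (rule sets.empty_continuous_imp_countably_additive[OF pos add])
    show "\<forall>A\<in>sets M. \<mu> A \<noteq> \<infinity>" by (simp add: \<mu>_def)
    fix B :: "nat \<Rightarrow> 'a set" assume B: "range B \<subseteq> sets M" "decseq B" "(\<Inter>i. B i) = {}"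
    have [measurable]: "B i \<in> sets M" for i using B(1) by auto
    have ev: "\<forall>\<^sub>F i in sequentially. \<omega> \<notin> B i" for \<omega>
    proof -
      obtain n where "\<omega> \<notin> B n" using B(3) by auto
      then have "\<omega> \<notin> B i" if "n \<le> i" for i using decseqD[OF B(2) that] by auto
      then show ?thesis by (auto simp: eventually_sequentially)
    qed
    let ?g = "\<lambda>i \<omega>. - indicator (B i) \<omega> :: real"
    have g: "?g i \<in> \<L>" for i by (rule LFp_bounded[of _ 1]) auto
    have "AE \<omega> in M. (\<lambda>i. moment (?g i) \<omega>) \<longlonglongrightarrow> 0"
    proof (rule nn_cond_exp_tendsto_0[where w = "\<lambda>_. 1"])
      show "AE \<omega> in M. (\<lambda>i. ennreal (\<bar>?g i \<omega>\<bar> powr p)) \<longlonglongrightarrow> 0"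
      proof (rule AE_I2)
        fix \<omega>
        have "\<forall>\<^sub>F i in sequentially. ennreal (\<bar>?g i \<omega>\<bar> powr p) = 0"
          using ev[of \<omega>] by eventually_elim simp
        then show "(\<lambda>i. ennreal (\<bar>?g i \<omega>\<bar> powr p)) \<longlonglongrightarrow> 0" by (rule tendsto_eventually)
      qed
      have "AE \<omega> in M. 1 = nn_cond_exp M F (\<lambda>_. 1) \<omega>" by (rule nn_cond_exp_F_meas) simp
      then show "AE \<omega> in M. nn_cond_exp M F (\<lambda>_. 1) \<omega> < \<infinity>"
        by eventually_elim (metis ennreal_one_less_top infinity_ennreal_def)
    qed (auto simp: indicator_def)
    then have lim: "AE \<omega> in M. (\<lambda>i. f (\<lambda>\<omega>. x \<omega> + ?g i \<omega>) \<omega>) \<longlonglongrightarrow> f x \<omega>"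
      by (intro f_tendsto x g)
    have "(\<lambda>i. P (indicator (B i))) \<longlonglongrightarrow> (\<integral>\<omega>. 0 \<partial>M)"
      unfolding P_def
    proof (rule integral_dominated_convergence[where w = "\<lambda>_. 1"])
      show "AE \<omega> in M. (\<lambda>i. increment x (indicator (B i)) \<omega>) \<longlonglongrightarrow> 0"
        using lim by eventually_elim (auto simp: increment_def intro: LIM_zero)
      show "AE \<omega> in M. norm (increment x (indicator (B i)) \<omega>) \<le> 1" for i
        using increment_abs_le[OF x, of "indicator (B i)" 1] by (auto simp: indicator_def)
    qed (use Xint[OF ind] in auto)
    then have lim0: "(\<lambda>i. ennreal (P (indicator (B i)))) \<longlonglongrightarrow> 0"
      using tendsto_ennrealI by fastforce
    have "\<mu> (B i) \<le> ennreal (P (indicator (B i)))" for i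
      unfolding \<mu>_def by (intro ennreal_leI l_le ind) auto
    then show "(\<lambda>i. \<mu> (B i)) \<longlonglongrightarrow> 0"
      by (intro tendsto_sandwich[OF _ _ tendsto_const lim0]) simp_all
  qed
  define N where "N = measure_of (space M) (sets M) \<mu>"
  have sets_N: "sets N = sets M" by (simp add: N_def)
  have em: "emeasure N B = \<mu> B" if "B \<in> sets M" for B
    unfolding N_def using sets.sigma_algebra_axioms pos cadd that by (rule emeasure_measure_of_sigma)
  have "absolutely_continuous M N"
    unfolding absolutely_continuous_def
  proof
    fix B assume B: "B \<in> null_sets M"
    then have "l (indicator B) = l (indicator {})"
      using AE_not_in[OF B] by (intro l_cong ind) (auto elim!: eventually_mono simp: indicator_def)
    then have "\<mu> B = 0" using pos by (simp add: \<mu>_def positive_def)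
    then show "B \<in> null_sets N"
      using B em sets_N by (auto intro!: null_setsI)
  qed
  then obtain w where w [measurable]: "w \<in> borel_measurable M" and dens: "density M w = N"
    using Radon_Nikodym sets_N by blast
  have w_int: "(\<integral>\<^sup>+\<omega>. w \<omega> * indicator B \<omega> \<partial>M) = \<mu> B" if "B \<in> sets M" for B
    using emeasure_density[OF w that] dens em[OF that] by simp
  have "(\<integral>\<^sup>+\<omega>. w \<omega> \<partial>M) = (\<integral>\<^sup>+\<omega>. w \<omega> * indicator (space M) \<omega> \<partial>M)"
    by (intro nn_integral_cong) simp
  also have "\<dots> \<noteq> \<infinity>" using w_int[OF sets.top] by (simp add: \<mu>_def)
  finally have w_int_fin: "(\<integral>\<^sup>+\<omega>. w \<omega> \<partial>M) \<noteq> \<infinity>" .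
  then have w_fin: "AE \<omega> in M. w \<omega> \<noteq> \<infinity>"
    by (intro nn_integral_PInf_AE) auto
  define v where "v \<omega> = enn2real (w \<omega>)" for \<omega>
  have v [measurable]: "v \<in> L0 M" unfolding v_def by measurable
  have vw: "AE \<omega> in M. ennreal (v \<omega>) = w \<omega>"
    using w_fin by eventually_elim (simp add: v_def ennreal_enn2real_if)
  have v_nonneg: "0 \<le> v \<omega>" for \<omega> by (simp add: v_def)
  have v_integrable: "integrable M v"
  proof (rule integrableI_nonneg)
    have "(\<integral>\<^sup>+\<omega>. ennreal (v \<omega>) \<partial>M) = (\<integral>\<^sup>+\<omega>. w \<omega> \<partial>M)" using vw by (rule nn_integral_cong_AE)
    then show "(\<integral>\<^sup>+\<omega>. ennreal (v \<omega>) \<partial>M) < \<infinity>" using w_int_fin by (simp add: less_top)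
  qed (use v_nonneg in auto)
  have l_ind: "(\<integral>\<omega>. indicator B \<omega> * v \<omega> \<partial>M) = l (indicator B)" if [measurable]: "B \<in> sets M" for B
  proof -
    have "(\<integral>\<^sup>+\<omega>. ennreal (indicator B \<omega> * v \<omega>) \<partial>M) = (\<integral>\<^sup>+\<omega>. w \<omega> * indicator B \<omega> \<partial>M)"
      using vw by (intro nn_integral_cong_AE) (auto elim!: eventually_mono simp: indicator_def)
    also have "\<dots> = ennreal (l (indicator B))" using w_int[OF that] by (simp add: \<mu>_def)
    finally show ?thesis
      using l_nonneg[OF ind[OF that]] v_nonneg by (intro integral_eq_nn_integral[THEN trans]) auto
  qed
  note int_sv = integrable_simple_mult[OF _ v_integrable]
  \<comment> \<open>Being simple is part of the induction statement because additivity and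
    homogeneity of \<open>l\<close> are available on \<open>X\<close> only.\<close>
  have l_nn: "simple_function M s \<and> (\<integral>\<omega>. s \<omega> * v \<omega> \<partial>M) = l s" if "simple_function M s" "\<And>\<omega>. 0 \<le> s \<omega>" for s
    using that(1)
  proof (rule simple_function_induct_real)
    fix s t assume *: "simple_function M s" "simple_function M t" "AE \<omega> in M. s \<omega> = t \<omega>"
      "simple_function M s \<and> (\<integral>\<omega>. s \<omega> * v \<omega> \<partial>M) = l s"
    have "l s = l t" using * by (intro l_cong) (auto simp: X_def)
    moreover have "(\<integral>\<omega>. s \<omega> * v \<omega> \<partial>M) = (\<integral>\<omega>. t \<omega> * v \<omega> \<partial>M)"
    proof (rule integral_cong_AE)
      have [measurable]: "s \<in> L0 M" "t \<in> L0 M" using * by (auto intro: borel_measurable_simple_function)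
      show "(\<lambda>\<omega>. s \<omega> * v \<omega>) \<in> L0 M" "(\<lambda>\<omega>. t \<omega> * v \<omega>) \<in> L0 M" by measurable
      show "AE \<omega> in M. s \<omega> * v \<omega> = t \<omega> * v \<omega>" using *(3) by eventually_elim simp
    qed
    ultimately show "simple_function M t \<and> (\<integral>\<omega>. t \<omega> * v \<omega> \<partial>M) = l t" using * by simp
  next
    fix A assume "A \<in> sets M"
    then show "simple_function M (indicator A :: 'a \<Rightarrow> real) \<and> (\<integral>\<omega>. indicator A \<omega> * v \<omega> \<partial>M) = l (indicator A)"
      using l_ind by simp
  next
    fix s c assume "simple_function M s \<and> (\<integral>\<omega>. s \<omega> * v \<omega> \<partial>M) = l s"
    then show "simple_function M (\<lambda>\<omega>. c * s \<omega>) \<and> (\<integral>\<omega>. c * s \<omega> * v \<omega> \<partial>M) = l (\<lambda>\<omega>. c * s \<omega>)"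
      using l_scale[of s c] by (auto simp: X_def scaleR_fun_def mult.assoc)
  next
    fix s t assume "simple_function M s \<and> (\<integral>\<omega>. s \<omega> * v \<omega> \<partial>M) = l s"
      "simple_function M t \<and> (\<integral>\<omega>. t \<omega> * v \<omega> \<partial>M) = l t"
    then show "simple_function M (\<lambda>\<omega>. s \<omega> + t \<omega>) \<and> (\<integral>\<omega>. (s \<omega> + t \<omega>) * v \<omega> \<partial>M) = l (\<lambda>\<omega>. s \<omega> + t \<omega>)"
      using l_add[of s t] int_sv by (auto simp: X_def plus_fun_def distrib_right)
  qed (rule that(2))
  show thesis
  proof (rule that[OF v v_nonneg v_integrable])
    fix s :: "'a \<Rightarrow> real" assume s: "simple_function M s"
    let ?p = "\<lambda>\<omega>. max 0 (s \<omega>)" and ?n = "\<lambda>\<omega>. max 0 (- s \<omega>)"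
    have pn: "simple_function M ?p" "simple_function M ?n"
      by (intro simple_function_compose1[OF s])+
    have eq: "s \<omega> = ?p \<omega> - ?n \<omega>" for \<omega> by auto
    have "(\<integral>\<omega>. s \<omega> * v \<omega> \<partial>M) = (\<integral>\<omega>. ?p \<omega> * v \<omega> - ?n \<omega> * v \<omega> \<partial>M)"
      by (intro Bochner_Integration.integral_cong refl) (simp add: eq[symmetric] left_diff_distrib[symmetric] del: max.cobounded1)
    also have "\<dots> = l ?p - l ?n"
      using l_nn[OF pn(1)] l_nn[OF pn(2)] int_sv[OF pn(1)] int_sv[OF pn(2)] by simp
    also have "\<dots> = l s"
    proof -
      have "s + ?n = ?p" by (auto simp: fun_eq_iff)
      then have "l ?p = l s + l ?n" using l_add[of s ?n] s pn by (simp add: X_def)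
      then show ?thesis by simp
    qed
    also have "\<dots> \<le> (\<integral>\<omega>. increment x s \<omega> \<partial>M)"
      using l_le[of s] s by (simp add: X_def P_def)
    finally show "(\<integral>\<omega>. s \<omega> * v \<omega> \<partial>M) \<le> (\<integral>\<omega>. increment x s \<omega> \<partial>M)" .
  qed
qed

text \<open>Inserting \<open>indicator A * s\<close> with \<open>A\<close> in \<open>F\<close> into
  the integrated inequality and using locality of the increment gives the conditional inequality for
  simple \<open>s\<close>. For general \<open>h\<close>, increasing approximation of the absolute
  value yields finiteness, which then serves as domination on the left, while
  \<open>f_tendsto\<close> handles the right.\<close>

lemma conditional_subgradient:
  assumes x: "x \<in> \<L>"
  obtains v where "v \<in> L0 M" "\<And>\<omega>. 0 \<le> v \<omega>" "integrable M v" "AE \<omega> in M. real_cond_exp M F v \<omega> = 1"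
    "\<And>h. h \<in> \<L> \<Longrightarrow> AE \<omega> in M. nn_cond_exp M F (\<lambda>\<omega>. ennreal (\<bar>h \<omega>\<bar> * v \<omega>)) \<omega> \<le> ennreal (increment x (\<lambda>\<omega>. \<bar>h \<omega>\<bar>) \<omega>)"
    "\<And>h. h \<in> \<L> \<Longrightarrow> AE \<omega> in M. real_cond_exp M F (\<lambda>\<omega>. h \<omega> * v \<omega>) \<omega> \<le> increment x h \<omega>"
proof -
  obtain v where v [measurable]: "v \<in> L0 M" and v_nonneg: "\<And>\<omega>. 0 \<le> v \<omega>" and v_int: "integrable M v"
    and v_le: "\<And>s. simple_function M s \<Longrightarrow> (\<integral>\<omega>. s \<omega> * v \<omega> \<partial>M) \<le> (\<integral>\<omega>. increment x s \<omega> \<partial>M)"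
    by (rule integral_subgradient[OF x]) blast
  note int_sv = integrable_simple_mult[OF _ v_int]
  have simple: "AE \<omega> in M. real_cond_exp M F (\<lambda>\<omega>. s \<omega> * v \<omega>) \<omega> \<le> increment x s \<omega>"
    if s: "simple_function M s" for s
  proof (rule AE_le_if_set_integrals_le)
    have sL: "s \<in> \<L>" using s by (rule simple_function_LFp)
    show "increment x s \<in> borel_measurable F" using x sL by (rule increment_measurable)
    show "integrable M (real_cond_exp M F (\<lambda>\<omega>. s \<omega> * v \<omega>))"
      using int_sv[OF s] by (rule real_cond_exp_int)
    show i: "integrable M (increment x s)" using x s by (rule integrable_increment_simple)
    fix A assume A: "A \<in> sets F"
    then have [measurable]: "A \<in> sets M" by (rule sets_F_into_M)
    have Ac: "space M - A \<in> sets F" using sets.compl_sets[OF A] by simp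
    let ?s = "\<lambda>\<omega>. indicator A \<omega> * s \<omega>"
    have s': "simple_function M ?s" using s by auto
    have s'L: "?s \<in> \<L>" using s' by (rule simple_function_LFp)
    have zL: "(\<lambda>_. 0) \<in> \<L>" by (intro L0_subset_LFp) auto
    have "(\<integral>\<omega>. indicator A \<omega> * real_cond_exp M F (\<lambda>\<omega>. s \<omega> * v \<omega>) \<omega> \<partial>M) = (\<integral>\<omega>. indicator A \<omega> * (s \<omega> * v \<omega>) \<partial>M)"
    proof (rule real_cond_exp_intg(2))
      show "integrable M (\<lambda>\<omega>. indicator A \<omega> * (s \<omega> * v \<omega>))"
        using integrable_mult_indicator[OF \<open>A \<in> sets M\<close> int_sv[OF s]] by simp
      show "(\<lambda>\<omega>. s \<omega> * v \<omega>) \<in> L0 M" using int_sv[OF s] by auto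
    qed (use A in auto)
    also have "\<dots> = (\<integral>\<omega>. ?s \<omega> * v \<omega> \<partial>M)" by (simp add: mult.assoc)
    also have "\<dots> \<le> (\<integral>\<omega>. increment x ?s \<omega> \<partial>M)" using s' by (rule v_le)
    also have "\<dots> = (\<integral>\<omega>. indicator A \<omega> * increment x s \<omega> \<partial>M)"
    proof (rule integral_cong_AE)
      show "increment x ?s \<in> L0 M" using increment_measurable[OF x s'L] by (rule measurable_F_into_M)
      show "(\<lambda>\<omega>. indicator A \<omega> * increment x s \<omega>) \<in> L0 M" using i by auto
      have "AE \<omega> in M. \<omega> \<in> A \<longrightarrow> increment x ?s \<omega> = increment x s \<omega>"
        by (intro increment_local x A s'L sL) auto
      \<comment> \<open>Off \<open>A\<close> the test function vanishes and so does its increment,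
        so only the contribution of \<open>A\<close> remains.\<close>
      moreover have "AE \<omega> in M. \<omega> \<in> space M - A \<longrightarrow> increment x ?s \<omega> = increment x (\<lambda>_. 0) \<omega>"
        by (intro increment_local x Ac s'L zL) auto
      ultimately show "AE \<omega> in M. increment x ?s \<omega> = indicator A \<omega> * increment x s \<omega>"
        using AE_space by eventually_elim (auto simp: increment_0 indicator_def)
    qed
    finally show "(\<integral>\<omega>. indicator A \<omega> * real_cond_exp M F (\<lambda>\<omega>. s \<omega> * v \<omega>) \<omega> \<partial>M) \<le>
      (\<integral>\<omega>. indicator A \<omega> * increment x s \<omega> \<partial>M)" .
  qed simp

  \<comment> \<open>The increments at the constants 1 and \<open>-1\<close> are these constants,
    which gives both inequalities.\<close>
  have v_1: "AE \<omega> in M. real_cond_exp M F v \<omega> = 1"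
  proof -
    have const: "AE \<omega> in M. increment x (\<lambda>_. c) \<omega> = c" for c
      using f_translate[OF x, of "\<lambda>_. - c"] by (auto simp: increment_def)
    have "AE \<omega> in M. real_cond_exp M F (\<lambda>\<omega>. - 1 * v \<omega>) \<omega> = - 1 * real_cond_exp M F v \<omega>"
      using v_int by (rule real_cond_exp_cmult)
    moreover have "AE \<omega> in M. real_cond_exp M F (\<lambda>\<omega>. 1 * v \<omega>) \<omega> \<le> increment x (\<lambda>_. 1) \<omega>"
      "AE \<omega> in M. real_cond_exp M F (\<lambda>\<omega>. - 1 * v \<omega>) \<omega> \<le> increment x (\<lambda>_. - 1) \<omega>"
      by (rule simple; simp)+
    ultimately show ?thesis
      using const[of 1] const[of "- 1"] by eventually_elim simp
  qed

  have fin: "AE \<omega> in M. nn_cond_exp M F (\<lambda>\<omega>. ennreal (\<bar>h \<omega>\<bar> * v \<omega>)) \<omega> \<le> ennreal (increment x (\<lambda>\<omega>. \<bar>h \<omega>\<bar>) \<omega>)"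
    if h: "h \<in> \<L>" for h
  proof -
    have [measurable]: "h \<in> L0 M" using h by (rule LFp_measurable)
    obtain u where u: "\<And>i. simple_function M (u i)" "incseq u" "\<And>i \<omega>. u i \<omega> < top"
        "\<And>\<omega>. (SUP i. u i \<omega>) = ennreal \<bar>h \<omega>\<bar>"
      by (rule borel_measurable_implies_simple_function_sequence'[of "\<lambda>\<omega>. ennreal \<bar>h \<omega>\<bar>" M]) auto
    define s where "s i \<omega> = enn2real (u i \<omega>)" for i \<omega>
    have s: "simple_function M (s i)" for i
      unfolding s_def using u(1) by (rule simple_function_compose1)
    have [measurable]: "s i \<in> L0 M" for i using s by (rule borel_measurable_simple_function)
    have us: "u i \<omega> = ennreal (s i \<omega>)" for i \<omega> using u(3)[of i \<omega>] by (simp add: s_def ennreal_enn2real_if less_top)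
    have s_le: "s i \<omega> \<le> \<bar>h \<omega>\<bar>" for i \<omega>
    proof -
      have "u i \<omega> \<le> ennreal \<bar>h \<omega>\<bar>" unfolding u(4)[symmetric] by (rule SUP_upper) simp
      then show ?thesis unfolding us by (simp add: ennreal_le_iff)
    qed
    have s_nonneg: "0 \<le> s i \<omega>" for i \<omega> by (simp add: s_def)
    have "AE \<omega> in M. nn_cond_exp M F (\<lambda>\<omega>. ennreal (s i \<omega> * v \<omega>)) \<omega> \<le> ennreal (increment x (\<lambda>\<omega>. \<bar>h \<omega>\<bar>) \<omega>)" for i
    proof -
      have "AE \<omega> in M. ennreal (real_cond_exp M F (\<lambda>\<omega>. s i \<omega> * v \<omega>) \<omega>) = nn_cond_exp M F (\<lambda>\<omega>. ennreal (s i \<omega> * v \<omega>)) \<omega>"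
        using nn_cond_exp_finite_if_integrable[OF int_sv[OF s[of i]]] s_nonneg v_nonneg
        by (intro real_cond_exp_nonneg_eq) auto
      moreover have "AE \<omega> in M. increment x (s i) \<omega> \<le> increment x (\<lambda>\<omega>. \<bar>h \<omega>\<bar>) \<omega>"
        using s_le by (intro increment_mono x simple_function_LFp s LFp_abs h) auto
      ultimately show ?thesis using simple[OF s[of i]]
        by eventually_elim (metis ennreal_leI order_trans)
    qed
    then have bd: "AE \<omega> in M. \<forall>i. nn_cond_exp M F (\<lambda>\<omega>. ennreal (s i \<omega> * v \<omega>)) \<omega> \<le> ennreal (increment x (\<lambda>\<omega>. \<bar>h \<omega>\<bar>) \<omega>)"
      by (subst AE_all_countable) auto
    have lim: "AE \<omega> in M. (\<lambda>i. nn_cond_exp M F (\<lambda>\<omega>. ennreal (s i \<omega> * v \<omega>)) \<omega>)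
        \<longlonglongrightarrow> nn_cond_exp M F (\<lambda>\<omega>. SUP i. ennreal (s i \<omega> * v \<omega>)) \<omega>"
    proof (rule nn_cond_exp_monotone_convergence)
      have "incseq (\<lambda>i. ennreal (s i \<omega> * v \<omega>))" for \<omega>
      proof (rule incseq_SucI)
        fix i
        have "u i \<omega> \<le> u (Suc i) \<omega>" using u(2) by (auto simp: incseq_Suc_iff le_fun_def)
        then have "s i \<omega> \<le> s (Suc i) \<omega>" unfolding us using s_nonneg by (simp add: ennreal_le_iff)
        then show "ennreal (s i \<omega> * v \<omega>) \<le> ennreal (s (Suc i) \<omega> * v \<omega>)"
          using v_nonneg by (intro ennreal_leI mult_right_mono) auto
      qed
      then show "AE \<omega> in M. incseq (\<lambda>i. ennreal (s i \<omega> * v \<omega>))" by simp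
    qed measurable
    have sup: "(SUP i. ennreal (s i \<omega> * v \<omega>)) = ennreal (\<bar>h \<omega>\<bar> * v \<omega>)" for \<omega>
    proof -
      have "(SUP i. ennreal (s i \<omega> * v \<omega>)) = (SUP i. ennreal (v \<omega>) * u i \<omega>)"
        unfolding us using s_nonneg v_nonneg by (simp add: ennreal_mult mult.commute)
      also have "\<dots> = ennreal (v \<omega>) * ennreal \<bar>h \<omega>\<bar>"
        by (simp only: SUP_mult_left_ennreal[symmetric] u(4))
      finally show ?thesis using v_nonneg by (simp add: ennreal_mult mult.commute)
    qed
    from bd lim[unfolded sup] show ?thesis
      by eventually_elim (rule LIMSEQ_le_const2, auto)
  qed
  show thesis
  proof (rule that[OF v v_nonneg v_int v_1 fin])
    fix h assume h: "h \<in> \<L>"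
    have [measurable]: "h \<in> L0 M" using h by (rule LFp_measurable)
    obtain s where "\<forall>i. simple_function M (s i)" "\<forall>\<omega>\<in>space M. (\<lambda>i. s i \<omega>) \<longlonglongrightarrow> h \<omega>"
        "\<forall>i. \<forall>\<omega>\<in>space M. dist (s i \<omega>) 0 \<le> 2 * dist (h \<omega>) 0"
      using borel_measurable_implies_sequence_metric[of h M 0] by auto
    then have s: "\<And>i. simple_function M (s i)"
        "\<And>\<omega>. \<omega> \<in> space M \<Longrightarrow> (\<lambda>i. s i \<omega>) \<longlonglongrightarrow> h \<omega>"
        "\<And>i \<omega>. \<omega> \<in> space M \<Longrightarrow> \<bar>s i \<omega>\<bar> \<le> 2 * \<bar>h \<omega>\<bar>"
      by (auto simp: dist_real_def)
    have [measurable]: "s i \<in> L0 M" for i using s(1) by (rule borel_measurable_simple_function)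
    \<comment> \<open>The approximants are bounded by twice the absolute value of \<open>h\<close>,
      hence the errors by three times; these multiples provide the dominating functions.\<close>
    have h2: "(\<lambda>\<omega>. c * h \<omega>) \<in> \<L>" for c using h by (intro LFp_mult) auto
    have "AE \<omega> in M. (\<lambda>i. real_cond_exp M F (\<lambda>\<omega>. s i \<omega> * v \<omega>) \<omega>) \<longlonglongrightarrow> real_cond_exp M F (\<lambda>\<omega>. h \<omega> * v \<omega>) \<omega>"
    proof (rule real_cond_exp_dominated_convergence[where w = "\<lambda>\<omega>. \<bar>2 * h \<omega>\<bar> * v \<omega>"])
      show "AE \<omega> in M. (\<lambda>i. s i \<omega> * v \<omega>) \<longlonglongrightarrow> h \<omega> * v \<omega>"
        using s(2) by (auto intro!: tendsto_mult)
      show "AE \<omega> in M. \<forall>i. \<bar>s i \<omega> * v \<omega>\<bar> \<le> \<bar>2 * h \<omega>\<bar> * v \<omega>"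
        using s(3) v_nonneg by (auto simp: abs_mult intro!: mult_right_mono)
      show "AE \<omega> in M. nn_cond_exp M F (\<lambda>\<omega>. ennreal (\<bar>2 * h \<omega>\<bar> * v \<omega>)) \<omega> < \<infinity>"
        using fin[OF h2[of 2]] by eventually_elim (auto simp: less_top[symmetric] top_unique)
    qed measurable
    \<comment> \<open>With \<open>x - s i\<close> written as \<open>(x - h) + (h - s i)\<close>,
      continuity is used at the point \<open>x - h\<close> along perturbations tending to 0.\<close>
    moreover have "AE \<omega> in M. (\<lambda>i. f (\<lambda>\<omega>. (x \<omega> - h \<omega>) + (h \<omega> - s i \<omega>)) \<omega>) \<longlonglongrightarrow> f (\<lambda>\<omega>. x \<omega> - h \<omega>) \<omega>"
    proof (rule f_tendsto)
      show "AE \<omega> in M. (\<lambda>i. moment (\<lambda>\<omega>. h \<omega> - s i \<omega>) \<omega>) \<longlonglongrightarrow> 0"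
      proof (rule nn_cond_exp_tendsto_0[where w = "\<lambda>\<omega>. ennreal (\<bar>3 * h \<omega>\<bar> powr p)"])
        show "AE \<omega> in M. (\<lambda>i. ennreal (\<bar>h \<omega> - s i \<omega>\<bar> powr p)) \<longlonglongrightarrow> 0"
        proof (rule AE_I2)
          fix \<omega> assume "\<omega> \<in> space M"
          then have "(\<lambda>i. \<bar>h \<omega> - s i \<omega>\<bar>) \<longlonglongrightarrow> \<bar>h \<omega> - h \<omega>\<bar>"
            by (intro tendsto_intros s(2))
          then have "(\<lambda>i. \<bar>h \<omega> - s i \<omega>\<bar> powr p) \<longlonglongrightarrow> 0 powr p"
            using p_ge_1 by (intro tendsto_powr') auto
          then show "(\<lambda>i. ennreal (\<bar>h \<omega> - s i \<omega>\<bar> powr p)) \<longlonglongrightarrow> 0"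
            using tendsto_ennrealI by fastforce
        qed
        show "AE \<omega> in M. \<forall>i. ennreal (\<bar>h \<omega> - s i \<omega>\<bar> powr p) \<le> ennreal (\<bar>3 * h \<omega>\<bar> powr p)"
        proof (intro AE_I2 allI ennreal_leI powr_mono2)
          fix \<omega> i assume "\<omega> \<in> space M"
          from s(3)[OF this, of i] show "\<bar>h \<omega> - s i \<omega>\<bar> \<le> \<bar>3 * h \<omega>\<bar>" by linarith
        qed (use p_ge_1 in auto)
      qed (use LFp_moment[OF h2[of 3]] in auto)
    qed (use x h s(1) simple_function_LFp LFp_diff in auto)
    then have "AE \<omega> in M. (\<lambda>i. increment x (s i) \<omega>) \<longlonglongrightarrow> increment x h \<omega>"
      by (auto elim!: eventually_mono simp: increment_def intro: tendsto_diff)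
    moreover have "AE \<omega> in M. \<forall>i. real_cond_exp M F (\<lambda>\<omega>. s i \<omega> * v \<omega>) \<omega> \<le> increment x (s i) \<omega>"
      using simple[OF s(1)] by (subst AE_all_countable) auto
    ultimately show "AE \<omega> in M. real_cond_exp M F (\<lambda>\<omega>. h \<omega> * v \<omega>) \<omega> \<le> increment x h \<omega>"
      by eventually_elim (rule LIMSEQ_le, auto)
  qed
qed

end

section \<open>Dual representations\<close>

context prob_subalgebra
begin

text \<open>Homogeneity: \<open>g\<close> is scaled by \<open>(d / c) powr (1 / p)\<close>, with
  \<open>c\<close> slightly above its moment, so that the scaled element lies in the ball where the
  bound 1 holds. The margin \<open>1 / Suc n\<close> avoids division by zero where the moment
  vanishes and is removed in the limit.\<close>

lemma Hoelder_converse: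
  assumes v [measurable]: "v \<in> L0 M" and v_nonneg: "\<And>x. 0 \<le> v x" and d: "d \<in> L0_pp M F"
    and bound: "\<And>g. g \<in> \<L> \<Longrightarrow> AE x in M. moment g x \<le> ennreal (d x) \<longrightarrow>
      nn_cond_exp M F (\<lambda>x. ennreal (\<bar>g x\<bar> * v x)) x \<le> 1"
    and g: "g \<in> \<L>"
  shows "AE x in M. nn_cond_exp M F (\<lambda>x. ennreal (\<bar>g x\<bar> * v x)) x \<le>
    ennreal ((enn2real (moment g x) / d x) powr (1 / p))"
proof -
  let ?m = "\<lambda>x. enn2real (moment g x)"
  let ?E = "nn_cond_exp M F (\<lambda>x. ennreal (\<bar>g x\<bar> * v x))"
  have [measurable]: "d \<in> L0 F" and d_pos: "AE x in M. 0 < d x" using d by (auto simp: L0_pp_def)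
  have [measurable]: "g \<in> L0 M" using g by (rule LFp_measurable)
  have "AE x in M. ?E x \<le> ennreal (((?m x + 1 / real (Suc n)) / d x) powr (1 / p))" for n
  proof -
    define c where "c x = ?m x + 1 / real (Suc n)" for x
    have c_pos: "0 < c x" for x unfolding c_def by (intro add_nonneg_pos) auto
    define \<xi> where "\<xi> x = (d x / c x) powr (1 / p)" for x
    have [measurable]: "\<xi> \<in> L0 F" unfolding \<xi>_def c_def by measurable
    have "AE x in M. moment (\<lambda>x. \<xi> x * g x) x \<le> ennreal (d x) \<longrightarrow>
        nn_cond_exp M F (\<lambda>x. ennreal (\<bar>\<xi> x * g x\<bar> * v x)) x \<le> 1"
      by (intro bound LFp_mult g) measurable
    moreover have "AE x in M. moment (\<lambda>x. \<xi> x * g x) x = ennreal (\<bar>\<xi> x\<bar> powr p) * moment g x"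
      by (intro moment_mult) measurable
    moreover have "AE x in M. ennreal (\<xi> x) * ?E x = nn_cond_exp M F (\<lambda>x. ennreal (\<xi> x) * ennreal (\<bar>g x\<bar> * v x)) x"
      by (intro nn_cond_exp_prod) measurable
    moreover have "(\<lambda>x. ennreal (\<xi> x) * ennreal (\<bar>g x\<bar> * v x)) = (\<lambda>x. ennreal (\<bar>\<xi> x * g x\<bar> * v x))"
      using v_nonneg by (auto simp: ennreal_mult[symmetric] abs_mult \<xi>_def mult.assoc)
    ultimately have "AE x in M. ennreal (\<bar>\<xi> x\<bar> powr p) * moment g x \<le> ennreal (d x) \<longrightarrow> ennreal (\<xi> x) * ?E x \<le> 1"
      by (auto elim: eventually_elim2)
    then show ?thesis
      using d_pos LFp_moment[OF g]
    proof eventually_elim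
      case (elim x)
      have "\<bar>\<xi> x\<bar> powr p = d x / c x"
        using elim(2) c_pos[of x] p_ge_1 by (simp add: \<xi>_def powr_powr)
      moreover have m: "moment g x = ennreal (?m x)" using elim(3) by (simp add: ennreal_enn2real_if)
      ultimately have "ennreal (\<bar>\<xi> x\<bar> powr p) * moment g x = ennreal (d x / c x * ?m x)"
        using elim(2) c_pos[of x] by (metis divide_nonneg_pos ennreal_mult enn2real_nonneg less_imp_le)
      also have "\<dots> \<le> ennreal (d x / c x * c x)"
        using elim(2) c_pos[of x] by (intro ennreal_leI mult_left_mono) (auto simp: c_def)
      also have "d x / c x * c x = d x" using c_pos[of x] by simp
      finally have 1: "ennreal (\<xi> x) * ?E x \<le> 1" using elim(1) by simp
      have \<xi>_pos: "0 < \<xi> x" using elim(2) c_pos[of x] by (simp add: \<xi>_def)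
      have inv: "(c x / d x) powr (1 / p) * \<xi> x = 1"
        using elim(2) c_pos[of x] by (simp add: \<xi>_def powr_mult[symmetric])
      have "?E x = ennreal ((c x / d x) powr (1 / p) * \<xi> x) * ?E x" by (simp add: inv)
      also have "\<dots> = ennreal ((c x / d x) powr (1 / p)) * (ennreal (\<xi> x) * ?E x)"
        using \<xi>_pos by (simp add: ennreal_mult mult.assoc)
      also have "\<dots> \<le> ennreal ((c x / d x) powr (1 / p)) * 1" by (intro mult_left_mono 1) simp
      finally show ?case by (simp add: c_def)
    qed
  qed
  then have "AE x in M. \<forall>n. ?E x \<le> ennreal (((?m x + 1 / real (Suc n)) / d x) powr (1 / p))"
    by (subst AE_all_countable) auto
  with d_pos show ?thesis
  proof eventually_elim
    case (elim x)
    have "(\<lambda>n. ?m x + 1 / real (Suc n)) \<longlonglongrightarrow> ?m x + 0"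
      by (intro tendsto_intros LIMSEQ_inverse_real_of_nat[unfolded inverse_eq_divide])
    then have "(\<lambda>n. (?m x + 1 / real (Suc n)) / d x) \<longlonglongrightarrow> ?m x / d x"
      using elim(1) by (intro tendsto_divide) auto
    then have "(\<lambda>n. ((?m x + 1 / real (Suc n)) / d x) powr (1 / p)) \<longlonglongrightarrow> (?m x / d x) powr (1 / p)"
      using elim(1) p_ge_1 by (intro tendsto_powr') (auto intro!: always_eventually)
    then have "(\<lambda>n. ennreal (((?m x + 1 / real (Suc n)) / d x) powr (1 / p))) \<longlonglongrightarrow> ennreal ((?m x / d x) powr (1 / p))"
      by (rule tendsto_ennrealI)
    then show ?case by (rule LIMSEQ_le_const) (use elim(2) in blast)
  qed
qed

text \<open>The test element is the indicator of \<open>B\<close>, the set where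
  \<open>d * v\<close> exceeds 1. As \<open>d\<close> is \<open>F\<close>-measurable, the
  conditional bound integrates to: the integral of \<open>d * v\<close> over \<open>B\<close> is at
  most the measure of \<open>B\<close>. Hence \<open>B\<close> is null.\<close>

lemma Hoelder_converse_infinity:
  assumes v [measurable]: "v \<in> L0 M" and v_nonneg: "\<And>x. 0 \<le> v x" and d: "d \<in> L0_pp M F" and p1: "p = 1"
    and bound: "\<And>g. g \<in> \<L> \<Longrightarrow> AE x in M. nn_cond_exp M F (\<lambda>x. ennreal (\<bar>g x\<bar> * v x)) x \<le>
      ennreal ((enn2real (moment g x) / d x) powr (1 / p))"
  shows "AE x in M. v x \<le> 1 / d x"
proof -
  have [measurable]: "d \<in> L0 F" and d_pos: "AE x in M. 0 < d x" using d by (auto simp: L0_pp_def)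
  have [measurable]: "d \<in> L0 M" by (rule measurable_F_into_M) measurable
  define B where "B = {x \<in> space M. 1 < d x * v x}"
  have [measurable]: "B \<in> sets M" unfolding B_def by measurable
  let ?i = "\<lambda>x. indicator B x :: real"
  have iL: "?i \<in> \<L>" by (rule LFp_bounded[of _ 1]) auto
  let ?E = "nn_cond_exp M F (\<lambda>x. ennreal (\<bar>?i x\<bar> * v x))"
  have le: "AE x in M. ennreal (d x) * ?E x \<le> moment ?i x"
    using bound[OF iL] d_pos LFp_moment[OF iL]
  proof eventually_elim
    case (elim x)
    have "ennreal (d x) * ?E x \<le> ennreal (d x) * ennreal (enn2real (moment ?i x) / d x)"
      using elim p1 by (intro mult_left_mono) auto
    also have "\<dots> = ennreal (d x * (enn2real (moment ?i x) / d x))"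
      using elim(2) by (intro ennreal_mult[symmetric]) auto
    also have "\<dots> = moment ?i x" using elim by (simp add: ennreal_enn2real_if)
    finally show ?case .
  qed
  have eq: "ennreal (d x) * ennreal (\<bar>?i x\<bar> * v x) = indicator B x * ennreal (d x * v x)" if "0 < d x" for x
    using that v_nonneg by (simp add: indicator_def ennreal_mult)
  have "(\<integral>\<^sup>+x. indicator B x * ennreal (d x * v x) \<partial>M) = (\<integral>\<^sup>+x. ennreal (d x) * ennreal (\<bar>?i x\<bar> * v x) \<partial>M)"
  proof (rule nn_integral_cong_AE)
    show "AE x in M. indicator B x * ennreal (d x * v x) = ennreal (d x) * ennreal (\<bar>?i x\<bar> * v x)"
      using d_pos by eventually_elim (simp only: eq)
  qed
  also have "\<dots> = (\<integral>\<^sup>+x. ennreal (d x) * ?E x \<partial>M)"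
    by (intro nn_cond_exp_intg[symmetric]) measurable
  also have "\<dots> \<le> (\<integral>\<^sup>+x. moment ?i x \<partial>M)" using le by (rule nn_integral_mono_AE)
  also have "\<dots> = (\<integral>\<^sup>+x. ennreal (\<bar>?i x\<bar> powr p) \<partial>M)"
    using nn_cond_exp_intg[of "\<lambda>_. 1" "\<lambda>x. ennreal (\<bar>?i x\<bar> powr p)"] by simp
  also have "\<dots> = (\<integral>\<^sup>+x. indicator B x \<partial>M)" by (intro nn_integral_cong) (simp add: indicator_def)
  finally have int_le: "(\<integral>\<^sup>+x. indicator B x * ennreal (d x * v x) \<partial>M) \<le> (\<integral>\<^sup>+x. indicator B x \<partial>M)" .
  have ge: "indicator B x \<le> indicator B x * ennreal (d x * v x)" for x
    by (auto simp: indicator_def B_def ennreal_ge_1)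
  have "(\<integral>\<^sup>+x. indicator B x * ennreal (d x * v x) - indicator B x \<partial>M) =
      (\<integral>\<^sup>+x. indicator B x * ennreal (d x * v x) \<partial>M) - (\<integral>\<^sup>+x. indicator B x \<partial>M)"
    using ge by (intro nn_integral_diff) (auto simp: emeasure_eq_measure)
  also have "\<dots> = 0" using int_le by (intro diff_eq_0_ennreal) (auto simp: emeasure_eq_measure elim: le_less_trans)
  finally have "AE x in M. indicator B x * ennreal (d x * v x) - indicator B x = 0"
    by (subst (asm) nn_integral_0_iff_AE) measurable
  with d_pos AE_space show ?thesis
  proof eventually_elim
    case (elim x)
    have "x \<notin> B"
    proof
      assume "x \<in> B"
      then have "ennreal (d x * v x) - 1 = 0" "1 < d x * v x" using elim by (auto simp: B_def)
      moreover from this(2) have "1 < ennreal (d x * v x)" by (simp add: ennreal_1[symmetric] ennreal_less_iff del: ennreal_1)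
      ultimately show False by (simp add: diff_eq_0_iff_ennreal)
    qed
    then show ?case using elim by (auto simp: B_def field_simps)
  qed
qed

text \<open>The test elements are powers \<open>q - 1\<close> of truncations of \<open>v\<close>.
  Since \<open>(q - 1) * p = q\<close>, their moment \<open>a\<close> is the \<open>q\<close>-th
  moment of the truncation, and the bound becomes \<open>a \<le> (a / d) powr (1 / p)\<close>.
  Truncation makes \<open>a\<close> finite, so for \<open>a > 0\<close> one can divide by it;
  monotone convergence removes the truncation.\<close>

lemma Hoelder_converse_finite:
  assumes v [measurable]: "v \<in> L0 M" and v_nonneg: "\<And>x. 0 \<le> v x" and d: "d \<in> L0_pp M F" and p1: "1 < p"
    and bound: "\<And>g. g \<in> \<L> \<Longrightarrow> AE x in M. nn_cond_exp M F (\<lambda>x. ennreal (\<bar>g x\<bar> * v x)) x \<le>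
      ennreal ((enn2real (moment g x) / d x) powr (1 / p))"
  shows "AE x in M. nn_cond_exp M F (\<lambda>x. ennreal (\<bar>v x\<bar> powr (p / (p - 1)))) x \<le>
    ennreal ((1 / d x) powr (1 / (p - 1)))"
proof -
  define q where "q = p / (p - 1)"
  have q: "1 < q" "(q - 1) * p = q" using p1 by (auto simp: q_def field_simps)
  have [measurable]: "d \<in> L0 F" and d_pos: "AE x in M. 0 < d x" using d by (auto simp: L0_pp_def)
  define g where "g n x = min (v x) (real n) powr (q - 1)" for n x
  have [measurable]: "g n \<in> L0 M" for n unfolding g_def by measurable
  have gL: "g n \<in> \<L>" for n
  proof (rule LFp_bounded)
    show "AE x in M. \<bar>g n x\<bar> \<le> real n powr (q - 1)"
      using v_nonneg q by (auto simp: g_def intro!: powr_mono2)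
  qed measurable
  have g_powr: "\<bar>g n x\<bar> powr p = min (v x) (real n) powr q" for n x
    using q by (simp add: g_def powr_powr)
  have g_v: "min (v x) (real n) powr q \<le> \<bar>g n x\<bar> * v x" for n x
  proof -
    have "min (v x) (real n) powr q = min (v x) (real n) powr (q - 1) * min (v x) (real n)"
      using v_nonneg[of x] powr_mult_base[of "min (v x) (real n)" "q - 1"] by (simp add: mult.commute)
    also have "\<dots> \<le> \<bar>g n x\<bar> * v x"
      unfolding g_def using v_nonneg[of x] by (auto intro!: mult_left_mono)
    finally show ?thesis .
  qed
  have "AE x in M. nn_cond_exp M F (\<lambda>x. ennreal (min (v x) (real n) powr q)) x \<le> ennreal ((1 / d x) powr (1 / (p - 1)))" for n
  proof -
    have "AE x in M. moment (g n) x \<le> nn_cond_exp M F (\<lambda>x. ennreal (\<bar>g n x\<bar> * v x)) x"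
      unfolding g_powr using g_v by (intro nn_cond_exp_mono) (auto intro!: ennreal_leI)
    then have "AE x in M. moment (g n) x \<le> ennreal ((1 / d x) powr (1 / (p - 1)))"
      using bound[OF gL[of n]] LFp_moment[OF gL[of n]] d_pos
    proof eventually_elim
      case (elim x)
      define a where "a = enn2real (moment (g n) x)"
      have m: "moment (g n) x = ennreal a" using elim(3) by (simp add: a_def ennreal_enn2real_if)
      have a0: "0 \<le> a" by (simp add: a_def)
      have "ennreal a \<le> ennreal ((a / d x) powr (1 / p))"
        using order_trans[OF elim(1,2)] a0 by (simp add: m)
      then have le: "a \<le> (a / d x) powr (1 / p)" by (simp add: ennreal_le_iff)
      have "a \<le> (1 / d x) powr (1 / (p - 1))"
      proof (cases "a = 0")
        case False
        then have a: "0 < a" using a0 by simp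
        have "a powr p \<le> ((a / d x) powr (1 / p)) powr p"
          using le a p1 by (intro powr_mono2) auto
        also have "\<dots> = a / d x" using a elim(4) p1 by (simp add: powr_powr)
        finally have "a powr p / a \<le> 1 / d x" using a elim(4) by (simp add: field_simps)
        moreover have "a powr p / a = a powr (p - 1)" using a by (simp add: powr_diff)
        ultimately have "(a powr (p - 1)) powr (1 / (p - 1)) \<le> (1 / d x) powr (1 / (p - 1))"
          using p1 by (intro powr_mono2) auto
        then show ?thesis using a p1 by (simp add: powr_powr)
      qed simp
      then show ?case unfolding m by (rule ennreal_leI)
    qed
    then show ?thesis unfolding g_powr .
  qed
  then have bd: "AE x in M. \<forall>n. nn_cond_exp M F (\<lambda>x. ennreal (min (v x) (real n) powr q)) x \<le> ennreal ((1 / d x) powr (1 / (p - 1)))"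
    by (subst AE_all_countable) auto
  have lim: "AE x in M. (\<lambda>n. nn_cond_exp M F (\<lambda>x. ennreal (min (v x) (real n) powr q)) x)
      \<longlonglongrightarrow> nn_cond_exp M F (\<lambda>x. SUP n. ennreal (min (v x) (real n) powr q)) x"
    using v_nonneg q
    by (intro nn_cond_exp_monotone_convergence) (auto intro!: AE_I2 incseq_SucI ennreal_leI powr_mono2)
  have sup: "(SUP n. ennreal (min (v x) (real n) powr q)) = ennreal (\<bar>v x\<bar> powr q)" for x
  proof (rule antisym)
    show "(SUP n. ennreal (min (v x) (real n) powr q)) \<le> ennreal (\<bar>v x\<bar> powr q)"
      using v_nonneg q by (intro SUP_least ennreal_leI powr_mono2) auto
    obtain n where "v x \<le> real n" using real_arch_simple by blast
    then have "ennreal (\<bar>v x\<bar> powr q) = ennreal (min (v x) (real n) powr q)"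
      using v_nonneg[of x] by (simp add: min_def)
    also have "\<dots> \<le> (SUP n. ennreal (min (v x) (real n) powr q))" by (rule SUP_upper) simp
    finally show "ennreal (\<bar>v x\<bar> powr q) \<le> (SUP n. ennreal (min (v x) (real n) powr q))" .
  qed
  from bd lim[unfolded sup] show ?thesis
    unfolding q_def[symmetric] by eventually_elim (rule LIMSEQ_le_const2, auto)
qed

lemma cond_norm_infinity_bounded:
  assumes "x \<in> L0 M" "AE \<omega> in M. \<bar>x \<omega>\<bar> \<le> C"
  shows "cond_norm M F \<infinity> x \<in> borel_measurable F"
    and "AE \<omega> in M. 0 \<le> cond_norm M F \<infinity> x \<omega> \<and> cond_norm M F \<infinity> x \<omega> \<le> ereal C"
proof -
  define S where "S = {\<xi> \<in> borel_measurable F. (AE \<omega> in M. 0 \<le> \<xi> \<omega>) \<and> (AE \<omega> in M. ereal \<bar>x \<omega>\<bar> \<le> \<xi> \<omega>)}"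
  have S: "S \<subseteq> borel_measurable F" by (auto simp: S_def)
  have eq: "cond_norm M F \<infinity> x = L0_Inf M F S" by (simp add: cond_norm_def S_def)
  show "cond_norm M F \<infinity> x \<in> borel_measurable F" unfolding eq by (rule L0_Inf_measurable[OF S])
  have "AE \<omega> in M. 0 \<le> ereal C" using assms(2) by eventually_elim auto
  then have "(\<lambda>_. ereal C) \<in> S" using assms(2) by (auto simp: S_def elim!: eventually_mono)
  then have "AE \<omega> in M. cond_norm M F \<infinity> x \<omega> \<le> ereal C" unfolding eq by (rule L0_Inf_lower[OF S])
  moreover have "AE \<omega> in M. 0 \<le> cond_norm M F \<infinity> x \<omega>"
    unfolding eq by (rule L0_Inf_greatest[OF S]) (auto simp: S_def)
  ultimately show "AE \<omega> in M. 0 \<le> cond_norm M F \<infinity> x \<omega> \<and> cond_norm M F \<infinity> x \<omega> \<le> ereal C"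
    by eventually_elim simp
qed

lemma bounded_cond_moment_infinity:
  assumes x: "x \<in> L0 M" "AE \<omega> in M. \<bar>x \<omega>\<bar> \<le> C"
  shows "x \<in> Lp M M \<infinity>" "cond_moment M F \<infinity> x \<in> Lp M F \<infinity>"
proof -
  show "x \<in> Lp M M \<infinity>" using assms by (auto simp: Lp_def)
  have "AE \<omega> in M. \<bar>real_of_ereal (cond_norm M F \<infinity> x \<omega>)\<bar> \<le> C"
    using cond_norm_infinity_bounded(2)[OF x]
  proof eventually_elim
    case (elim \<omega>)
    then show ?case by (cases "cond_norm M F \<infinity> x \<omega>") auto
  qed
  then show "cond_moment M F \<infinity> x \<in> Lp M F \<infinity>"
    using cond_norm_infinity_bounded(1)[OF x] by (auto simp: Lp_def cond_moment_def)
qed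

lemma bounded_cond_moment_finite:
  assumes [measurable]: "x \<in> L0 M"
    and le: "AE \<omega> in M. nn_cond_exp M F (\<lambda>\<omega>. ennreal (\<bar>x \<omega>\<bar> powr q)) \<omega> \<le> ennreal C"
  shows "x \<in> Lp M M (ereal q)" "cond_moment M F (ereal q) x \<in> Lp M F \<infinity>"
proof -
  have "(\<integral>\<^sup>+\<omega>. ennreal (\<bar>x \<omega>\<bar> powr q) \<partial>M) = (\<integral>\<^sup>+\<omega>. nn_cond_exp M F (\<lambda>\<omega>. ennreal (\<bar>x \<omega>\<bar> powr q)) \<omega> \<partial>M)"
    using nn_cond_exp_intg[of "\<lambda>_. 1" "\<lambda>\<omega>. ennreal (\<bar>x \<omega>\<bar> powr q)"] by simp
  also have "\<dots> \<le> (\<integral>\<^sup>+\<omega>. ennreal C \<partial>M)" using le by (rule nn_integral_mono_AE)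
  also have "\<dots> < \<infinity>" by (simp add: emeasure_space_1)
  finally have "integrable M (\<lambda>\<omega>. \<bar>x \<omega>\<bar> powr q)" by (intro integrableI_nonneg) auto
  then show "x \<in> Lp M M (ereal q)" by (simp add: Lp_def)
  have "AE \<omega> in M. ennreal \<bar>real_cond_exp M F (\<lambda>\<omega>. \<bar>x \<omega>\<bar> powr q) \<omega>\<bar> \<le>
      nn_cond_exp M F (\<lambda>\<omega>. ennreal (\<bar>x \<omega>\<bar> powr q)) \<omega>"
    using real_cond_exp_abs[of "\<lambda>\<omega>. \<bar>x \<omega>\<bar> powr q"] by simp
  with le have "AE \<omega> in M. ennreal \<bar>real_cond_exp M F (\<lambda>\<omega>. \<bar>x \<omega>\<bar> powr q) \<omega>\<bar> \<le> ennreal C"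
    by eventually_elim (meson order_trans)
  then have "AE \<omega> in M. \<bar>real_cond_exp M F (\<lambda>\<omega>. \<bar>x \<omega>\<bar> powr q) \<omega>\<bar> \<le> max 0 C"
    by eventually_elim (metis abs_ge_zero ennreal_le_iff ennreal_max_0 max.cobounded1)
  then show "cond_moment M F (ereal q) x \<in> Lp M F \<infinity>"
    by (auto simp: Lp_def cond_moment_def)
qed

text \<open>Makes the index set with bounded conditional moments a subset of those in the second and
  third statements.\<close>

lemma Lp_infinity_subset: "0 < \<gamma> \<Longrightarrow> Lp M F \<infinity> \<subseteq> Lp M F (ereal \<gamma>)"
proof
  fix x assume \<gamma>: "0 < \<gamma>" and "x \<in> Lp M F \<infinity>"
  then obtain C where x: "x \<in> L0 F" and C: "AE \<omega> in M. \<bar>x \<omega>\<bar> \<le> C" by (auto simp: Lp_def)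
  have [measurable]: "x \<in> L0 M" using x by (rule measurable_F_into_M)
  have "integrable M (\<lambda>\<omega>. \<bar>x \<omega>\<bar> powr \<gamma>)"
  proof (rule integrable_const_bound)
    show "AE \<omega> in M. norm (\<bar>x \<omega>\<bar> powr \<gamma>) \<le> C powr \<gamma>"
      using C \<gamma> by (auto elim!: eventually_mono intro!: powr_mono2)
  qed measurable
  then show "x \<in> Lp M F (ereal \<gamma>)" using x by (simp add: Lp_def)
qed

lemma Lp_subset_LFp:
  assumes q: "0 \<le> q"
  shows "Lp M M q \<subseteq> LFp M F q"
proof
  fix x assume x: "x \<in> Lp M M q"
  then have [measurable]: "x \<in> L0 M" by (simp add: Lp_def)
  show "x \<in> LFp M F q"
  proof (cases "q = \<infinity>")
    case True
    then obtain C where "AE \<omega> in M. \<bar>x \<omega>\<bar> \<le> C" using x by (auto simp: Lp_def)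
    from cond_norm_infinity_bounded(2)[OF \<open>x \<in> L0 M\<close> this]
    have "AE \<omega> in M. cond_norm M F \<infinity> x \<omega> < \<infinity>"
      by eventually_elim auto
    then show ?thesis using True by (simp add: LFp_def)
  next
    case False
    then obtain s where s: "q = ereal s" using q by (cases q) auto
    have "AE \<omega> in M. nn_cond_exp M F (\<lambda>\<omega>. ennreal \<bar>\<bar>x \<omega>\<bar> powr s\<bar>) \<omega> < \<infinity>"
      using x s by (intro nn_cond_exp_finite_if_integrable) (simp add: Lp_def)
    then show ?thesis
      unfolding s LFp_def cond_norm_def ennreal_root_def by (auto elim!: eventually_mono)
  qed
qed

lemma conjugate_exponent_cases:
  assumes "1 \<le> q" "1 / ereal p + 1 / q = 1"
  obtains "p = 1" "q = \<infinity>" | "1 < p" "q = ereal (p / (p - 1))"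
proof (cases q)
  case (real s)
  then have s: "1 \<le> s" and "1 / p + 1 / s = 1"
    using assms p_ge_1 by (auto simp: one_ereal_def)
  then have eq: "s + p = p * s" using p_ge_1 by (simp add: field_simps)
  then have "p \<noteq> 1" by auto
  then have "1 < p" using p_ge_1 by simp
  moreover from this eq have "s = p / (p - 1)" by (simp add: field_simps)
  ultimately show thesis using real that(2) by simp
next
  case PInf
  then have "1 / p = 1" using assms p_ge_1 by (simp add: one_ereal_def)
  then show thesis using PInf that(1) by simp
next
  case MInf
  then show thesis using assms(1) by simp
qed

end

section \<open>Truncated subgradients and attainment of the supremum\<close>

context LFp_convex_risk_measure
begin

abbreviation strongly_bounded :: "ereal \<Rightarrow> ('a \<Rightarrow> real) set" where
  "strongly_bounded q \<equiv> {y \<in> Lp M M q. cond_moment M F q y \<in> Lp M F \<infinity>}"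

text \<open>The continuity modulus for the tolerance 1 bounds the conditional pairing with
  \<open>v\<close> on a ball, and the converse Hoelder inequality turns this into an
  \<open>F\<close>-measurable \<open>c\<close> that bounds \<open>v\<close> itself for
  \<open>p = 1\<close> and its conditional \<open>q\<close>-th moment otherwise. Sets of the form
  \<open>c \<le> n\<close> lie in \<open>F\<close>, so truncating along them commutes with
  conditioning.\<close>

lemma subgradient_truncation:
  assumes x: "x \<in> \<L>" and q: "1 \<le> q" "1 / ereal p + 1 / q = 1"
  obtains v c where "v \<in> L0 M" "\<And>\<omega>. 0 \<le> v \<omega>" "c \<in> L0 F" "AE \<omega> in M. real_cond_exp M F v \<omega> = 1"
    "\<And>h. h \<in> \<L> \<Longrightarrow> AE \<omega> in M. nn_cond_exp M F (\<lambda>\<omega>. ennreal (\<bar>h \<omega>\<bar> * v \<omega>)) \<omega> < \<infinity>"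
    "\<And>h. h \<in> \<L> \<Longrightarrow> AE \<omega> in M. real_cond_exp M F (\<lambda>\<omega>. h \<omega> * v \<omega>) \<omega> \<le> increment x h \<omega>"
    "\<And>n :: nat. (\<lambda>\<omega>. if c \<omega> \<le> real n then - v \<omega> else - 1) \<in> strongly_bounded q"
proof -
  obtain v where v [measurable]: "v \<in> L0 M" and v_nonneg: "\<And>\<omega>. 0 \<le> v \<omega>" and "integrable M v"
    and v_1: "AE \<omega> in M. real_cond_exp M F v \<omega> = 1"
    and v_fin: "\<And>h. h \<in> \<L> \<Longrightarrow> AE \<omega> in M. nn_cond_exp M F (\<lambda>\<omega>. ennreal (\<bar>h \<omega>\<bar> * v \<omega>)) \<omega> \<le> ennreal (increment x (\<lambda>\<omega>. \<bar>h \<omega>\<bar>) \<omega>)"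
    and v_le: "\<And>h. h \<in> \<L> \<Longrightarrow> AE \<omega> in M. real_cond_exp M F (\<lambda>\<omega>. h \<omega> * v \<omega>) \<omega> \<le> increment x h \<omega>"
    by (rule conditional_subgradient[OF x]) blast
  have "(\<lambda>_. 1) \<in> L0_pp M F" by (simp add: L0_pp_def)
  then obtain d where d: "d \<in> L0_pp M F"
    and d_le: "\<And>g. g \<in> \<L> \<Longrightarrow> AE \<omega> in M. moment g \<omega> \<le> ennreal (d \<omega>) \<longrightarrow> increment x (\<lambda>\<omega>. \<bar>g \<omega>\<bar>) \<omega> \<le> 1"
    by (rule f_continuity_modulus[OF x]) blast
  have [measurable]: "d \<in> L0 F" using d by (auto simp: L0_pp_def)
  have bound: "AE \<omega> in M. nn_cond_exp M F (\<lambda>\<omega>. ennreal (\<bar>g \<omega>\<bar> * v \<omega>)) \<omega> \<le>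
      ennreal ((enn2real (moment g \<omega>) / d \<omega>) powr (1 / p))" if "g \<in> \<L>" for g
  proof (rule Hoelder_converse[OF v v_nonneg d _ that])
    fix g assume g: "g \<in> \<L>"
    show "AE \<omega> in M. moment g \<omega> \<le> ennreal (d \<omega>) \<longrightarrow> nn_cond_exp M F (\<lambda>\<omega>. ennreal (\<bar>g \<omega>\<bar> * v \<omega>)) \<omega> \<le> 1"
      using v_fin[OF g] d_le[OF g] by eventually_elim (metis ennreal_1 ennreal_leI order_trans)
  qed
  have fin: "AE \<omega> in M. nn_cond_exp M F (\<lambda>\<omega>. ennreal (\<bar>h \<omega>\<bar> * v \<omega>)) \<omega> < \<infinity>" if "h \<in> \<L>" for h
    using v_fin[OF that] by eventually_elim (auto simp: less_top[symmetric] top_unique)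
  show thesis
    using q
  proof (cases rule: conjugate_exponent_cases)
    case 1
    have le: "AE \<omega> in M. v \<omega> \<le> 1 / d \<omega>"
      by (rule Hoelder_converse_infinity[OF v v_nonneg d 1(1) bound])
    let ?y = "\<lambda>n \<omega>. if 1 / d \<omega> \<le> real n then - v \<omega> else - 1"
    show thesis
    proof (rule that[OF v v_nonneg _ v_1 fin v_le])
      show "(\<lambda>\<omega>. 1 / d \<omega>) \<in> L0 F" by measurable
      fix n :: nat
      have "(\<lambda>\<omega>. 1 / d \<omega>) \<in> L0 M" by (rule measurable_F_into_M) measurable
      then have "?y n \<in> L0 M" by measurable
      moreover have "AE \<omega> in M. \<bar>?y n \<omega>\<bar> \<le> max (real n) 1"
        using le by eventually_elim (use v_nonneg in auto)
      ultimately show "?y n \<in> strongly_bounded q"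
        unfolding 1(2) using bounded_cond_moment_infinity by auto
    qed
  next
    case 2
    let ?q = "p / (p - 1)"
    define c where "c \<omega> = (1 / d \<omega>) powr (1 / (p - 1))" for \<omega>
    have c [measurable]: "c \<in> L0 F" "c \<in> L0 M" unfolding c_def by (auto intro: measurable_F_into_M)
    have le: "AE \<omega> in M. nn_cond_exp M F (\<lambda>\<omega>. ennreal (\<bar>v \<omega>\<bar> powr ?q)) \<omega> \<le> ennreal (c \<omega>)"
      unfolding c_def by (rule Hoelder_converse_finite[OF v v_nonneg d 2(1) bound])
    let ?y = "\<lambda>n \<omega>. if c \<omega> \<le> real n then - v \<omega> else - 1"
    show thesis
    proof (rule that[OF v v_nonneg c(1) v_1 fin v_le])
      fix n :: nat
      have [measurable]: "?y n \<in> L0 M" by measurable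
      define A where "A = {\<omega> \<in> space M. c \<omega> \<le> real n}"
      have A: "A \<in> sets F" unfolding A_def space_F[symmetric] by measurable
      have Ac: "space M - A \<in> sets F" using sets.compl_sets[OF A] by simp
      let ?E = "\<lambda>y. nn_cond_exp M F (\<lambda>\<omega>. ennreal (\<bar>y \<omega>\<bar> powr ?q))"
      have "AE \<omega> in M. \<omega> \<in> A \<longrightarrow> ?E (?y n) \<omega> = ?E v \<omega>"
        by (intro nn_cond_exp_local A) (auto simp: A_def)
      moreover have "AE \<omega> in M. \<omega> \<in> space M - A \<longrightarrow> ?E (?y n) \<omega> = ?E (\<lambda>_. 1) \<omega>"
        by (intro nn_cond_exp_local Ac) (auto simp: A_def)
      moreover have "AE \<omega> in M. ennreal (\<bar>1\<bar> powr ?q) = ?E (\<lambda>_. 1) \<omega>"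
        by (rule nn_cond_exp_F_meas) simp
      \<comment> \<open>On \<open>A\<close> the moment is at most \<open>n\<close>; off
        \<open>A\<close> the element is \<open>-1\<close> and its moment is 1, whence the
        maximum.\<close>
      ultimately have "AE \<omega> in M. ?E (?y n) \<omega> \<le> ennreal (max (real n) 1)"
        using le AE_space
      proof eventually_elim
        case (elim \<omega>)
        show ?case
        proof (cases "\<omega> \<in> A")
          case True
          then have "?E (?y n) \<omega> \<le> ennreal (c \<omega>)" using elim by simp
          also have "\<dots> \<le> ennreal (max (real n) 1)" using True by (intro ennreal_leI) (auto simp: A_def)
          finally show ?thesis .
        next
          case False
          then have "?E (?y n) \<omega> = ennreal 1" using elim by simp
          also have "\<dots> \<le> ennreal (max (real n) 1)" by (intro ennreal_leI) auto
          finally show ?thesis .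
        qed
      qed
      then show "?y n \<in> strongly_bounded q"
        unfolding 2(2) using bounded_cond_moment_finite[of "?y n" ?q] by auto
    qed
  qed
qed

text \<open>The upper bound is Fenchel--Young and holds for each \<open>y\<close>. For the lower
  bound the truncated subgradients lie in the smallest index set and attain the value on
  \<open>A n\<close>. A domain \<open>X\<close> inside \<L> with a version \<open>g\<close> of
  \<open>f\<close> covers both risk measures of the theorem: the subgradient inequality on \<L>
  bounds the conjugate taken over \<open>X\<close> as well.\<close>

lemma dual_representation_superset:
  assumes q: "1 \<le> q" "1 / ereal p + 1 / q = 1"
    and X: "X \<subseteq> \<L>" and g: "\<And>x. x \<in> X \<Longrightarrow> g x \<in> L0 F" "\<And>x. x \<in> X \<Longrightarrow> AE \<omega> in M. f x \<omega> = g x \<omega>"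
    and Y: "strongly_bounded q \<subseteq> Y"
  shows "dual_representation M F X g Y"
  unfolding dual_representation_def
proof
  fix x assume x: "x \<in> X"
  let ?E = "\<lambda>x y. real_cond_exp M F (\<lambda>\<omega>. x \<omega> * y \<omega>)"
  let ?g' = "cond_conjugate M F X g"
  define K where "K y = {(\<lambda>\<omega>. ereal (?E x y \<omega> - g x \<omega>)) | x. x \<in> X}" for y
  have K: "K y \<subseteq> borel_measurable F" for y using g(1) by (auto simp: K_def)
  have conj: "?g' y = L0_Sup M F (K y)" for y by (simp add: cond_conjugate_def K_def)
  have conj_meas [measurable]: "?g' y \<in> borel_measurable F" for y
    unfolding conj by (rule L0_Sup_measurable[OF K])
  define S where "S = {(\<lambda>\<omega>. ereal (?E x y \<omega>) - ?g' y \<omega>) | y. y \<in> dual_elements M F Y}"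
  have S: "S \<subseteq> borel_measurable F" by (auto simp: S_def)
  have [measurable]: "g x \<in> L0 F" by (rule g(1)[OF x])
  have "AE \<omega> in M. L0_Sup M F S \<omega> \<le> ereal (g x \<omega>)"
  proof (rule L0_Sup_least[OF S])
    fix h assume "h \<in> S"
    then obtain y where h: "h = (\<lambda>\<omega>. ereal (?E x y \<omega>) - ?g' y \<omega>)" by (auto simp: S_def)
    have "AE \<omega> in M. ereal (?E x y \<omega> - g x \<omega>) \<le> ?g' y \<omega>"
      unfolding conj by (rule L0_Sup_upper[OF K]) (use x in \<open>auto simp: K_def\<close>)
    then show "AE \<omega> in M. h \<omega> \<le> ereal (g x \<omega>)"
    proof eventually_elim
      case (elim \<omega>)
      then show ?case unfolding h by (cases "?g' y \<omega>") auto
    qed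
  qed measurable
  moreover have "AE \<omega> in M. ereal (g x \<omega>) \<le> L0_Sup M F S \<omega>"
  proof -
    have xL: "x \<in> \<L>" using x X by auto
    obtain v c where v [measurable]: "v \<in> L0 M" and v_nonneg: "\<And>\<omega>. 0 \<le> v \<omega>" and c [measurable]: "c \<in> L0 F"
      and v_1: "AE \<omega> in M. real_cond_exp M F v \<omega> = 1"
      and v_fin: "\<And>h. h \<in> \<L> \<Longrightarrow> AE \<omega> in M. nn_cond_exp M F (\<lambda>\<omega>. ennreal (\<bar>h \<omega>\<bar> * v \<omega>)) \<omega> < \<infinity>"
      and v_le: "\<And>h. h \<in> \<L> \<Longrightarrow> AE \<omega> in M. real_cond_exp M F (\<lambda>\<omega>. h \<omega> * v \<omega>) \<omega> \<le> increment x h \<omega>"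
      and v_bd: "\<And>n :: nat. (\<lambda>\<omega>. if c \<omega> \<le> real n then - v \<omega> else - 1) \<in> strongly_bounded q"
      by (rule subgradient_truncation[OF xL q]) blast
    define y where "y n \<omega> = (if c \<omega> \<le> real n then - v \<omega> else - 1)" for n :: nat and \<omega>
    have [measurable]: "c \<in> L0 M" by (rule measurable_F_into_M[OF c])
    have [measurable]: "y n \<in> L0 M" for n unfolding y_def by measurable
    define A where "A n = {\<omega> \<in> space M. c \<omega> \<le> real n}" for n :: nat
    have A: "A n \<in> sets F" for n unfolding A_def space_F[symmetric] by measurable
    have Ac: "space M - A n \<in> sets F" for n using sets.compl_sets[OF A] by simp
    have uminus: "real_cond_exp M F (\<lambda>\<omega>. - z \<omega>) = (\<lambda>\<omega>. - real_cond_exp M F z \<omega>)" for z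
      by (simp add: real_cond_exp_def)
    have y_dual: "y n \<in> dual_elements M F Y" for n
    proof -
      have "AE \<omega> in M. \<omega> \<in> A n \<longrightarrow> real_cond_exp M F (y n) \<omega> = real_cond_exp M F (\<lambda>\<omega>. - v \<omega>) \<omega>"
        by (intro real_cond_exp_local A) (auto simp: y_def A_def)
      moreover have "AE \<omega> in M. \<omega> \<in> space M - A n \<longrightarrow> real_cond_exp M F (y n) \<omega> = real_cond_exp M F (\<lambda>_. - 1) \<omega>"
        by (intro real_cond_exp_local Ac) (auto simp: y_def A_def)
      moreover have "AE \<omega> in M. real_cond_exp M F (\<lambda>_. - 1) \<omega> = - 1"
        by (rule real_cond_exp_F_meas) auto
      ultimately have "AE \<omega> in M. real_cond_exp M F (y n) \<omega> = - 1"
        using v_1 AE_space unfolding uminus by eventually_elim auto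
      moreover have "y n \<in> Y" using v_bd[of n] Y unfolding y_def by blast
      moreover have "y n \<omega> \<le> 0" for \<omega> using v_nonneg[of \<omega>] by (simp add: y_def)
      ultimately show ?thesis by (simp add: dual_elements_def)
    qed
    have Ey: "AE \<omega> in M. \<omega> \<in> A n \<longrightarrow> ?E z (y n) \<omega> = - ?E z v \<omega>" if "z \<in> \<L>" for z n
    proof -
      have [measurable]: "z \<in> L0 M" using that by (rule LFp_measurable)
      have "AE \<omega> in M. \<omega> \<in> A n \<longrightarrow> ?E z (y n) \<omega> = real_cond_exp M F (\<lambda>\<omega>. - (z \<omega> * v \<omega>)) \<omega>"
        by (intro real_cond_exp_local A) (auto simp: y_def A_def)
      then show ?thesis unfolding uminus .
    qed
    have "AE \<omega> in M. \<omega> \<in> A n \<longrightarrow> ?g' (y n) \<omega> \<le> ereal (?E x (y n) \<omega> - g x \<omega>)" for n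
    proof -
      \<comment> \<open>The least-upper-bound property speaks about the whole space. The value
        \<infinity> off \<open>A n\<close> makes a bound that is informative only on
        \<open>A n\<close> admissible for it.\<close>
      define k where "k \<omega> = (if c \<omega> \<le> real n then ereal (?E x (y n) \<omega> - g x \<omega>) else \<infinity>)" for \<omega>
      have k: "k \<in> borel_measurable F" unfolding k_def by measurable
      have "AE \<omega> in M. ?g' (y n) \<omega> \<le> k \<omega>"
        unfolding conj
      proof (rule L0_Sup_least[OF K k])
        fix h assume "h \<in> K (y n)"
        then obtain z where z: "z \<in> X" and h: "h = (\<lambda>\<omega>. ereal (?E z (y n) \<omega> - g z \<omega>))" by (auto simp: K_def)
        have zL: "z \<in> \<L>" using z X by auto
        have [measurable]: "x \<in> L0 M" "z \<in> L0 M" using xL zL by (auto dest: LFp_measurable)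
        \<comment> \<open>In this direction the perturbed point \<open>x - (x - z)\<close> is
          \<open>z\<close>, so the subgradient inequality compares \<open>f z\<close> with
          \<open>f x\<close>.\<close>
        let ?d = "\<lambda>\<omega>. x \<omega> - z \<omega>"
        have dL: "?d \<in> \<L>" using xL zL by (rule LFp_diff)
        have "AE \<omega> in M. real_cond_exp M F (\<lambda>\<omega>. ?d \<omega> * v \<omega> + z \<omega> * v \<omega>) \<omega> = ?E ?d v \<omega> + ?E z v \<omega>"
          using v_fin[OF dL] v_fin[OF zL] v_nonneg
          by (intro real_cond_exp_add_generalised) (auto simp: abs_mult)
        moreover have "(\<lambda>\<omega>. ?d \<omega> * v \<omega> + z \<omega> * v \<omega>) = (\<lambda>\<omega>. x \<omega> * v \<omega>)" by (auto simp: algebra_simps)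
        moreover have "AE \<omega> in M. ?E ?d v \<omega> \<le> f z \<omega> - f x \<omega>"
          using v_le[OF dL] by (simp add: increment_def)
        ultimately have "AE \<omega> in M. ?E x v \<omega> - ?E z v \<omega> \<le> f z \<omega> - f x \<omega>"
          by (auto elim!: eventually_elim2)
        then show "AE \<omega> in M. h \<omega> \<le> k \<omega>"
          using Ey[OF xL, of n] Ey[OF zL, of n] g(2)[OF x] g(2)[OF z] AE_space
          by eventually_elim (auto simp: h k_def A_def)
      qed
      with AE_space show ?thesis by eventually_elim (auto simp: A_def k_def)
    qed
    then have "AE \<omega> in M. \<forall>n. \<omega> \<in> A n \<longrightarrow> ?g' (y n) \<omega> \<le> ereal (?E x (y n) \<omega> - g x \<omega>)"
      by (subst AE_all_countable) auto
    moreover have "AE \<omega> in M. \<forall>n. ereal (?E x (y n) \<omega>) - ?g' (y n) \<omega> \<le> L0_Sup M F S \<omega>"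
      by (subst AE_all_countable, intro allI L0_Sup_upper[OF S]) (use y_dual in \<open>auto simp: S_def\<close>)
    ultimately show ?thesis using AE_space
    proof eventually_elim
      case (elim \<omega>)
      \<comment> \<open>The sets \<open>A n\<close> exhaust the space because \<open>c\<close> is
        real-valued. The index may depend on \<omega>, as all \<open>n\<close> were treated outside
        a common null set.\<close>
      obtain n :: nat where "c \<omega> \<le> real n" using real_arch_simple by blast
      then have "?g' (y n) \<omega> \<le> ereal (?E x (y n) \<omega> - g x \<omega>)" using elim by (auto simp: A_def)
      then have "ereal (g x \<omega>) \<le> ereal (?E x (y n) \<omega>) - ?g' (y n) \<omega>"
        by (cases "?g' (y n) \<omega>") auto
      with elim(2) show ?case by (meson order_trans)
    qed
  qed
  ultimately have "AE \<omega> in M. ereal (g x \<omega>) = L0_Sup M F S \<omega>"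
    by eventually_elim (rule antisym)
  then show "AE \<omega> in M. ereal (g x \<omega>) =
      L0_Sup M F {(\<lambda>\<omega>. ereal (?E x y \<omega>) - ?g' y \<omega>) | y. y \<in> dual_elements M F Y} \<omega>"
    by (simp add: S_def)
qed

end

section \<open>Semicontinuity\<close>

lemma (in prob_space) prob_Int_ge:
  assumes "A \<in> events" "B \<in> events"
  shows "prob A + prob B - 1 \<le> prob (A \<inter> B)"
  using finite_measure_Union'[OF assms] finite_measure_Diff'[OF assms(2,1)] prob_le_1[of "A \<union> B"]
  by (simp add: Int_commute)

text \<open>Continuity from below along the increasing sets where \<open>h\<close> exceeds
  \<open>1 / Suc n\<close>. It supplies the constant margins with which openness for convergence in
  probability is shown.\<close>

lemma (in prob_space) prob_greater_margin:
  fixes h :: "'a \<Rightarrow> real"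
  assumes [measurable]: "h \<in> borel_measurable M" and "\<beta> < \<P>(\<omega> in M. 0 < h \<omega>)"
  obtains \<kappa> where "0 < \<kappa>" "\<beta> < \<P>(\<omega> in M. \<kappa> < h \<omega>)"
proof -
  define A where "A n = {\<omega> \<in> space M. 1 / real (Suc n) < h \<omega>}" for n
  have "incseq A"
  proof (rule incseq_SucI)
    fix n
    have "1 / real (Suc (Suc n)) \<le> 1 / real (Suc n)" by (simp add: field_simps)
    then show "A n \<subseteq> A (Suc n)" unfolding A_def by (auto intro: order_le_less_trans)
  qed
  moreover have "range A \<subseteq> events" unfolding A_def by auto
  ultimately have "(\<lambda>n. prob (A n)) \<longlonglongrightarrow> prob (\<Union>n. A n)"
    by (intro finite_Lim_measure_incseq)
  moreover have "(\<Union>n. A n) = {\<omega> \<in> space M. 0 < h \<omega>}"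
  proof (intro equalityI subsetI)
    fix \<omega> assume "\<omega> \<in> (\<Union>n. A n)"
    then obtain n where \<omega>: "\<omega> \<in> space M" "1 / real (Suc n) < h \<omega>" by (auto simp: A_def)
    have "0 < 1 / real (Suc n)" by simp
    then have "0 < h \<omega>" using \<omega>(2) by (rule less_trans)
    with \<omega>(1) show "\<omega> \<in> {\<omega> \<in> space M. 0 < h \<omega>}" by simp
  next
    fix \<omega> assume "\<omega> \<in> {\<omega> \<in> space M. 0 < h \<omega>}"
    then show "\<omega> \<in> (\<Union>n. A n)" using nat_approx_posE[of "h \<omega>"] by (auto simp: A_def)
  qed
  ultimately have "\<forall>\<^sub>F n in sequentially. \<beta> < prob (A n)"
    using assms(2) by (intro order_tendstoD(1)) auto
  then obtain n where "\<beta> < prob (A n)" by (auto simp: eventually_sequentially)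
  then show thesis by (intro that[of "1 / real (Suc n)"]) (auto simp: A_def)
qed

lemma topspace_local_base_topology:
  assumes "\<And>A B. A \<in> \<N> \<Longrightarrow> B \<in> \<N> \<Longrightarrow> \<exists>C\<in>\<N>. C \<subseteq> A \<inter> B" "\<N> \<noteq> {}"
  shows "topspace (local_base_topology S \<N>) = S"
proof
  show "topspace (local_base_topology S \<N>) \<subseteq> S"
    using openin_local_base_topology[OF assms(1), of S "topspace (local_base_topology S \<N>)"] by simp
  have "openin (local_base_topology S \<N>) S"
    using assms(2) by (subst openin_local_base_topology[OF assms(1)]) auto
  then show "S \<subseteq> topspace (local_base_topology S \<N>)" by (rule openin_subset)
qed

section \<open>Open sets and carriers of the topologies\<close>

context prob_subalgebra
begin

lemma openin_Tc_LFp: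
  "openin (Tc_LFp M F p) U \<longleftrightarrow>
     U \<subseteq> \<L> \<and> (\<forall>x\<in>U. \<exists>N\<in>Tc_nhds_LFp M F p. \<forall>z\<in>\<L>. (\<lambda>\<omega>. z \<omega> - x \<omega>) \<in> N \<longrightarrow> z \<in> U)"
  unfolding Tc_LFp_def by (rule openin_local_base_topology[OF Tc_nhds_LFp_Int])

lemma openin_Tc_L0:
  "openin (Tc_L0 M F) U \<longleftrightarrow>
     U \<subseteq> L0 F \<and> (\<forall>x\<in>U. \<exists>N\<in>Tc_nhds_L0 M F. \<forall>z\<in>L0 F. (\<lambda>\<omega>. z \<omega> - x \<omega>) \<in> N \<longrightarrow> z \<in> U)"
  unfolding Tc_L0_def by (rule openin_local_base_topology[OF Tc_nhds_L0_Int])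

lemma openin_Teps_LFp:
  "openin (Teps_LFp M F p) U \<longleftrightarrow>
     U \<subseteq> \<L> \<and> (\<forall>x\<in>U. \<exists>N\<in>Teps_nhds_LFp M F p. \<forall>z\<in>\<L>. (\<lambda>\<omega>. z \<omega> - x \<omega>) \<in> N \<longrightarrow> z \<in> U)"
  unfolding Teps_LFp_def
  by (rule openin_local_base_topology[OF Teps_nhds_LFp_Int[OF prob_space_axioms subalg_F]])

lemma openin_Teps_L0:
  "openin (Teps_L0 M F) U \<longleftrightarrow>
     U \<subseteq> L0 F \<and> (\<forall>x\<in>U. \<exists>N\<in>Teps_nhds_L0 M F. \<forall>z\<in>L0 F. (\<lambda>\<omega>. z \<omega> - x \<omega>) \<in> N \<longrightarrow> z \<in> U)"
  unfolding Teps_L0_def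
  by (rule openin_local_base_topology[OF Teps_nhds_L0_Int[OF prob_space_axioms subalg_F]])

lemma L0_pp_const: "0 < c \<Longrightarrow> (\<lambda>_. c) \<in> L0_pp M F"
  by (simp add: L0_pp_def)

lemma topspace_Tc_LFp: "topspace (Tc_LFp M F p) = \<L>"
  unfolding Tc_LFp_def
proof (rule topspace_local_base_topology[OF Tc_nhds_LFp_Int])
  show "Tc_nhds_LFp M F p \<noteq> {}"
    using L0_pp_const[of 1] by (auto simp: Tc_nhds_LFp_def)
qed

lemma topspace_Tc_L0: "topspace (Tc_L0 M F) = L0 F"
  unfolding Tc_L0_def
proof (rule topspace_local_base_topology[OF Tc_nhds_L0_Int])
  show "Tc_nhds_L0 M F \<noteq> {}"
    using L0_pp_const[of 1] by (auto simp: Tc_nhds_L0_def)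
qed

lemma topspace_Teps_LFp: "topspace (Teps_LFp M F p) = \<L>"
  unfolding Teps_LFp_def
proof (rule topspace_local_base_topology[OF Teps_nhds_LFp_Int[OF prob_space_axioms subalg_F]])
  show "Teps_nhds_LFp M F p \<noteq> {}"
    unfolding Teps_nhds_LFp_def using zero_less_one[where 'a = real] half_gt_zero[of "1 :: real"]
    by (metis (mono_tags, lifting) empty_iff field_sum_of_halves less_add_same_cancel1 mem_Collect_eq)
qed

lemma topspace_Teps_L0: "topspace (Teps_L0 M F) = L0 F"
  unfolding Teps_L0_def
proof (rule topspace_local_base_topology[OF Teps_nhds_L0_Int[OF prob_space_axioms subalg_F]])
  show "Teps_nhds_L0 M F \<noteq> {}"
    unfolding Teps_nhds_L0_def using zero_less_one[where 'a = real] half_gt_zero[of "1 :: real"]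
    by (metis (mono_tags, lifting) empty_iff field_sum_of_halves less_add_same_cancel1 mem_Collect_eq)
qed

end

section \<open>Continuity and semicontinuity with respect to both topologies\<close>

context LFp_convex_risk_measure
begin

text \<open>The radius is the \<open>p\<close>-th root of the modulus for moments, which translates
  it to the conditional norm.\<close>

lemma Tc_modulus:
  assumes x: "x \<in> \<L>" and e: "e \<in> L0_pp M F"
  obtains d where "d \<in> L0_pp M F"
    "\<And>z. z \<in> \<L> \<Longrightarrow> AE \<omega> in M. cond_norm M F (ereal p) (\<lambda>\<omega>. z \<omega> - x \<omega>) \<omega> \<le> ereal (d \<omega>) \<longrightarrow>
      \<bar>f z \<omega> - f x \<omega>\<bar> \<le> e \<omega>"
proof -
  obtain c where c: "c \<in> L0_pp M F"
    and le: "\<And>g. g \<in> \<L> \<Longrightarrow> AE \<omega> in M. moment g \<omega> \<le> ennreal (c \<omega>) \<longrightarrow> \<bar>f (\<lambda>\<omega>. x \<omega> + g \<omega>) \<omega> - f x \<omega>\<bar> \<le> e \<omega>"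
    by (rule f_continuity_modulus[OF x e]) blast
  have [measurable]: "c \<in> L0 F" and c_pos: "AE \<omega> in M. 0 < c \<omega>" using c by (auto simp: L0_pp_def)
  show thesis
  proof (rule that)
    show "(\<lambda>\<omega>. c \<omega> powr (1 / p)) \<in> L0_pp M F"
      unfolding L0_pp_def using c_pos by (auto elim: eventually_mono)
    fix z assume z: "z \<in> \<L>"
    show "AE \<omega> in M. cond_norm M F (ereal p) (\<lambda>\<omega>. z \<omega> - x \<omega>) \<omega> \<le> ereal (c \<omega> powr (1 / p)) \<longrightarrow>
        \<bar>f z \<omega> - f x \<omega>\<bar> \<le> e \<omega>"
      using le[OF LFp_diff[OF z x]] c_pos
    proof eventually_elim
      case (elim \<omega>)
      then show ?case
        using cond_norm_le_imp[of "\<lambda>\<omega>. z \<omega> - x \<omega>" \<omega> "c \<omega> powr (1 / p)"] p_ge_1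
        by (auto simp: powr_powr)
    qed
  qed
qed

text \<open>The modulus \<open>d\<close> is only a positive random variable, but it exceeds some
  constant \<eta> outside an event of probability below \<open>b / 2\<close>. The remaining
  \<open>b / 2\<close> is the tolerance for the conditional norm to reach \<eta>.\<close>

lemma Teps_modulus:
  assumes x: "x \<in> \<L>" and e: "0 < e" and b: "0 < b" "b < 1"
  obtains N where "N \<in> Teps_nhds_LFp M F p"
    "\<And>z. z \<in> \<L> \<Longrightarrow> (\<lambda>\<omega>. z \<omega> - x \<omega>) \<in> N \<Longrightarrow> 1 - b < \<P>(\<omega> in M. \<bar>f z \<omega> - f x \<omega>\<bar> \<le> e)"
proof -
  obtain d where d: "d \<in> L0_pp M F"
    and le: "\<And>z. z \<in> \<L> \<Longrightarrow> AE \<omega> in M. cond_norm M F (ereal p) (\<lambda>\<omega>. z \<omega> - x \<omega>) \<omega> \<le> ereal (d \<omega>) \<longrightarrow>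
      \<bar>f z \<omega> - f x \<omega>\<bar> \<le> e"
    by (rule Tc_modulus[OF x L0_pp_const[OF e]]) blast
  have [measurable]: "d \<in> L0 M" and d_pos: "AE \<omega> in M. 0 < d \<omega>"
    using d measurable_F_into_M by (auto simp: L0_pp_def)
  have "\<P>(\<omega> in M. 0 < d \<omega>) = 1"
    using d_pos by (intro prob_eq_1[THEN iffD2]) auto
  with b have "1 - b / 2 < \<P>(\<omega> in M. 0 < d \<omega>)" by simp
  then obtain \<eta> where \<eta>: "0 < \<eta>" "1 - b / 2 < \<P>(\<omega> in M. \<eta> < d \<omega>)"
    by (rule prob_greater_margin[rotated]) measurable
  let ?N = "{x \<in> \<L>. \<P>(\<omega> in M. cond_norm M F (ereal p) x \<omega> < ereal \<eta>) > 1 - b / 2}"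
  show thesis
  proof (rule that)
    show "?N \<in> Teps_nhds_LFp M F p"
      unfolding Teps_nhds_LFp_def using \<eta>(1) b by (intro CollectI exI[of _ \<eta>] exI[of _ "b / 2"]) auto
    fix z assume z: "z \<in> \<L>" and N: "(\<lambda>\<omega>. z \<omega> - x \<omega>) \<in> ?N"
    have [measurable]: "cond_norm M F (ereal p) (\<lambda>\<omega>. z \<omega> - x \<omega>) \<in> borel_measurable M"
      by (rule measurable_F_into_M[OF borel_measurable_cond_norm])
    have [measurable]: "f z \<in> L0 M" "f x \<in> L0 M"
      using f_measurable[OF z] f_measurable[OF x] measurable_F_into_M by auto
    let ?A = "{\<omega> \<in> space M. \<eta> < d \<omega>}"
    let ?B = "{\<omega> \<in> space M. cond_norm M F (ereal p) (\<lambda>\<omega>. z \<omega> - x \<omega>) \<omega> < ereal \<eta>}"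
    have "1 - b < prob ?A + prob ?B - 1" using \<eta>(2) N by simp
    also have "\<dots> \<le> prob (?A \<inter> ?B)" by (intro prob_Int_ge) measurable
    also have "\<dots> \<le> \<P>(\<omega> in M. \<bar>f z \<omega> - f x \<omega>\<bar> \<le> e)"
    proof (rule finite_measure_mono_AE)
      show "AE \<omega> in M. \<omega> \<in> ?A \<inter> ?B \<longrightarrow> \<omega> \<in> {\<omega> \<in> space M. \<bar>f z \<omega> - f x \<omega>\<bar> \<le> e}"
        using le[OF z]
      proof eventually_elim
        case (elim \<omega>)
        show ?case
        proof
          assume \<omega>: "\<omega> \<in> ?A \<inter> ?B"
          then have "cond_norm M F (ereal p) (\<lambda>\<omega>. z \<omega> - x \<omega>) \<omega> < ereal \<eta>" "ereal \<eta> < ereal (d \<omega>)"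
            by auto
          then have "cond_norm M F (ereal p) (\<lambda>\<omega>. z \<omega> - x \<omega>) \<omega> \<le> ereal (d \<omega>)"
            by (intro less_imp_le) (rule less_trans)
          with elim \<omega> show "\<omega> \<in> {\<omega> \<in> space M. \<bar>f z \<omega> - f x \<omega>\<bar> \<le> e}" by simp
        qed
      qed
    qed measurable
    finally show "1 - b < \<P>(\<omega> in M. \<bar>f z \<omega> - f x \<omega>\<bar> \<le> e)" .
  qed
qed

lemma Tc_continuous: "continuous_map (Tc_LFp M F p) (Tc_L0 M F) f"
  unfolding continuous_map_def topspace_Tc_LFp topspace_Tc_L0
proof (intro conjI allI impI)
  show "f \<in> \<L> \<rightarrow> L0 F" using f_measurable by auto
  fix U assume U: "openin (Tc_L0 M F) U"
  show "openin (Tc_LFp M F p) {x \<in> \<L>. f x \<in> U}"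
    unfolding openin_Tc_LFp
  proof (intro conjI ballI)
    fix x assume "x \<in> {x \<in> \<L>. f x \<in> U}"
    then have x: "x \<in> \<L>" and fx: "f x \<in> U" by auto
    then obtain N where N: "N \<in> Tc_nhds_L0 M F" "\<And>z. z \<in> L0 F \<Longrightarrow> (\<lambda>\<omega>. z \<omega> - f x \<omega>) \<in> N \<Longrightarrow> z \<in> U"
      using U unfolding openin_Tc_L0 by meson
    then obtain e where e: "e \<in> L0_pp M F" "N = {x \<in> L0 F. AE \<omega> in M. \<bar>x \<omega>\<bar> \<le> e \<omega>}"
      by (auto simp: Tc_nhds_L0_def)
    obtain d where d: "d \<in> L0_pp M F"
      and le: "\<And>z. z \<in> \<L> \<Longrightarrow> AE \<omega> in M. cond_norm M F (ereal p) (\<lambda>\<omega>. z \<omega> - x \<omega>) \<omega> \<le> ereal (d \<omega>) \<longrightarrow>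
        \<bar>f z \<omega> - f x \<omega>\<bar> \<le> e \<omega>"
      by (rule Tc_modulus[OF x e(1)]) blast
    show "\<exists>N\<in>Tc_nhds_LFp M F p. \<forall>z\<in>\<L>. (\<lambda>\<omega>. z \<omega> - x \<omega>) \<in> N \<longrightarrow> z \<in> {x \<in> \<L>. f x \<in> U}"
    proof (intro bexI ballI impI)
      let ?N = "{x \<in> \<L>. AE \<omega> in M. cond_norm M F (ereal p) x \<omega> \<le> ereal (d \<omega>)}"
      show "?N \<in> Tc_nhds_LFp M F p" using d by (auto simp: Tc_nhds_LFp_def)
      fix z assume z: "z \<in> \<L>" and zN: "(\<lambda>\<omega>. z \<omega> - x \<omega>) \<in> ?N"
      have "AE \<omega> in M. \<bar>f z \<omega> - f x \<omega>\<bar> \<le> e \<omega>"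
        using zN le[OF z] by (auto elim: eventually_elim2)
      then have "(\<lambda>\<omega>. f z \<omega> - f x \<omega>) \<in> N"
        unfolding e(2) using f_measurable[OF z] f_measurable[OF x] by auto
      then show "z \<in> {x \<in> \<L>. f x \<in> U}" using N(2) f_measurable[OF z] z by auto
    qed
  qed auto
qed

lemma Tc_lower_semicontinuous: "Tc_lsc M F p f"
  unfolding Tc_lsc_def
proof
  fix s assume s [measurable]: "s \<in> L0 F"
  let ?C = "{x \<in> \<L>. AE \<omega> in M. f x \<omega> \<le> s \<omega>}"
  have "openin (Tc_LFp M F p) (\<L> - ?C)"
    unfolding openin_Tc_LFp
  proof (intro conjI ballI)
    fix x assume xC: "x \<in> \<L> - ?C"
    then have x: "x \<in> \<L>" by simp
    have [measurable]: "f x \<in> L0 F" by (rule f_measurable[OF x])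
    \<comment> \<open>Half the gap where \<open>s < f x\<close>: if some \<open>z\<close> this close
      satisfied \<open>f z \<le> s\<close> a.e., the gap would be at most half of itself. The value
      1 elsewhere only keeps \<open>e\<close> positive.\<close>
    define e where "e \<omega> = (if s \<omega> < f x \<omega> then (f x \<omega> - s \<omega>) / 2 else 1)" for \<omega>
    have "e \<in> L0 F" unfolding e_def by measurable
    moreover have "0 < e \<omega>" for \<omega>
      by (cases "s \<omega> < f x \<omega>") (simp_all add: e_def)
    ultimately have "e \<in> L0_pp M F" by (simp add: L0_pp_def)
    then obtain d where d: "d \<in> L0_pp M F"
      and le: "\<And>z. z \<in> \<L> \<Longrightarrow> AE \<omega> in M. cond_norm M F (ereal p) (\<lambda>\<omega>. z \<omega> - x \<omega>) \<omega> \<le> ereal (d \<omega>) \<longrightarrow>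
        \<bar>f z \<omega> - f x \<omega>\<bar> \<le> e \<omega>"
      by (rule Tc_modulus[OF x]) blast
    show "\<exists>N\<in>Tc_nhds_LFp M F p. \<forall>z\<in>\<L>. (\<lambda>\<omega>. z \<omega> - x \<omega>) \<in> N \<longrightarrow> z \<in> \<L> - ?C"
    proof (intro bexI ballI impI)
      let ?N = "{x \<in> \<L>. AE \<omega> in M. cond_norm M F (ereal p) x \<omega> \<le> ereal (d \<omega>)}"
      show "?N \<in> Tc_nhds_LFp M F p" using d by (auto simp: Tc_nhds_LFp_def)
      fix z assume z: "z \<in> \<L>" and zN: "(\<lambda>\<omega>. z \<omega> - x \<omega>) \<in> ?N"
      have near: "AE \<omega> in M. \<bar>f z \<omega> - f x \<omega>\<bar> \<le> e \<omega>"
        using zN le[OF z] by (auto elim: eventually_elim2)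
      have "\<not> (AE \<omega> in M. f z \<omega> \<le> s \<omega>)"
      proof
        assume "AE \<omega> in M. f z \<omega> \<le> s \<omega>"
        with near have "AE \<omega> in M. f x \<omega> \<le> s \<omega>"
          by eventually_elim (auto simp: e_def field_simps split: if_splits)
        with xC show False by simp
      qed
      with z show "z \<in> \<L> - ?C" by simp
    qed
  qed auto
  then show "closedin (Tc_LFp M F p) ?C"
    unfolding closedin_def topspace_Tc_LFp by auto
qed

text \<open>The complement of the epigraph is open. The level \<open>s + \<epsilon>\<close> at the
  given point separates: on \<open>U\<close> the value \<open>f z\<close> exceeds it with
  probability above \<beta>, on \<open>V\<close> the function \<open>t\<close> stays below it with
  probability above \<open>1 - \<beta>\<close>. Both events then occur together with positive
  probability, so \<open>f z \<le> t\<close> cannot hold a.e.\<close>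

lemma Teps_lower_semicontinuous: "Teps_lsc M F p f"
proof -
  let ?C = "{(x, s). x \<in> \<L> \<and> s \<in> L0 F \<and> (AE \<omega> in M. f x \<omega> \<le> s \<omega>)}"
  have "openin (prod_topology (Teps_LFp M F p) (Teps_L0 M F)) (\<L> \<times> L0 F - ?C)"
    unfolding openin_prod_topology_alt
  proof (intro allI impI)
    fix x s assume "(x, s) \<in> \<L> \<times> L0 F - ?C"
    then have x: "x \<in> \<L>" and s: "s \<in> L0 F" and not_le: "\<not> (AE \<omega> in M. f x \<omega> \<le> s \<omega>)" by auto
    have [measurable]: "s \<in> L0 M" using s by (rule measurable_F_into_M)
    have f_meas: "f z \<in> L0 M" if "z \<in> \<L>" for z
      using f_measurable[OF that] by (rule measurable_F_into_M)
    have [measurable]: "f x \<in> L0 M" by (rule f_meas[OF x])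
    have "0 < \<P>(\<omega> in M. 0 < f x \<omega> - s \<omega>)"
    proof (rule ccontr)
      assume "\<not> ?thesis"
      then have "\<P>(\<omega> in M. 0 < f x \<omega> - s \<omega>) = 0" by (simp add: measure_le_0_iff not_less)
      then have "AE \<omega> in M. \<not> 0 < f x \<omega> - s \<omega>" by (subst (asm) prob_eq_0) auto
      then have "AE \<omega> in M. f x \<omega> \<le> s \<omega>" by eventually_elim simp
      with not_le show False by contradiction
    qed
    then obtain \<epsilon> where \<epsilon>: "0 < \<epsilon>" "0 < \<P>(\<omega> in M. \<epsilon> < f x \<omega> - s \<omega>)"
      by (rule prob_greater_margin[rotated]) measurable
    \<comment> \<open>Half of the probability leaves strict room for \<open>x\<close> in
      \<open>U\<close> and gives \<open>\<beta> < 1\<close>.\<close>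
    define \<beta> where "\<beta> = \<P>(\<omega> in M. \<epsilon> < f x \<omega> - s \<omega>) / 2"
    have \<beta>: "0 < \<beta>" "\<beta> < \<P>(\<omega> in M. \<epsilon> < f x \<omega> - s \<omega>)" "\<beta> < 1"
      using \<epsilon>(2) le_less_trans[OF prob_le_1[of "{\<omega> \<in> space M. \<epsilon> < f x \<omega> - s \<omega>}"], of 2]
      by (auto simp: \<beta>_def)
    define U where "U = {z \<in> \<L>. \<beta> < \<P>(\<omega> in M. \<epsilon> < f z \<omega> - s \<omega>)}"
    define V where "V = {t \<in> L0 F. 1 - \<beta> < \<P>(\<omega> in M. t \<omega> < s \<omega> + \<epsilon>)}"
    have U: "openin (Teps_LFp M F p) U"
      unfolding openin_Teps_LFp
    proof (intro conjI ballI)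
      fix z assume "z \<in> U"
      then have z: "z \<in> \<L>" and "\<beta> < \<P>(\<omega> in M. 0 < f z \<omega> - s \<omega> - \<epsilon>)" by (auto simp: U_def)
      moreover have [measurable]: "f z \<in> L0 M" by (rule f_meas[OF z])
      ultimately obtain \<kappa> where \<kappa>: "0 < \<kappa>" "\<beta> < \<P>(\<omega> in M. \<kappa> < f z \<omega> - s \<omega> - \<epsilon>)"
        using prob_greater_margin[of "\<lambda>\<omega>. f z \<omega> - s \<omega> - \<epsilon>" \<beta>] by auto
      let ?A = "{\<omega> \<in> space M. \<kappa> < f z \<omega> - s \<omega> - \<epsilon>}"
      \<comment> \<open>The surplus of the probability of \<open>?A\<close> over \<beta> is what a
        nearby \<open>y\<close> may lose, and the margin \<kappa> is how far \<open>f y\<close> may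
        deviate.\<close>
      have b: "0 < prob ?A - \<beta>" "prob ?A - \<beta> < 1"
        using \<kappa>(2) \<beta>(1) prob_le_1[of ?A] by linarith+
      obtain N where N: "N \<in> Teps_nhds_LFp M F p"
        and close: "\<And>y. y \<in> \<L> \<Longrightarrow> (\<lambda>\<omega>. y \<omega> - z \<omega>) \<in> N \<Longrightarrow>
          1 - (prob ?A - \<beta>) < \<P>(\<omega> in M. \<bar>f y \<omega> - f z \<omega>\<bar> \<le> \<kappa>)"
        by (rule Teps_modulus[OF z \<kappa>(1) b]) blast
      show "\<exists>N\<in>Teps_nhds_LFp M F p. \<forall>y\<in>\<L>. (\<lambda>\<omega>. y \<omega> - z \<omega>) \<in> N \<longrightarrow> y \<in> U"
      proof (intro bexI[OF _ N] ballI impI)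
        fix y assume y: "y \<in> \<L>" and yN: "(\<lambda>\<omega>. y \<omega> - z \<omega>) \<in> N"
        have [measurable]: "f y \<in> L0 M" by (rule f_meas[OF y])
        let ?B = "{\<omega> \<in> space M. \<bar>f y \<omega> - f z \<omega>\<bar> \<le> \<kappa>}"
        have "\<beta> < prob ?A + prob ?B - 1" using close[OF y yN] by simp
        also have "\<dots> \<le> prob (?A \<inter> ?B)" by (intro prob_Int_ge) measurable
        also have "\<dots> \<le> \<P>(\<omega> in M. \<epsilon> < f y \<omega> - s \<omega>)"
          by (intro finite_measure_mono) (auto simp: abs_le_iff)
        finally show "y \<in> U" using y by (simp add: U_def)
      qed
    qed (auto simp: U_def)
    have V: "openin (Teps_L0 M F) V"
      unfolding openin_Teps_L0
    proof (intro conjI ballI)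
      fix t assume "t \<in> V"
      then have t: "t \<in> L0 F" and "1 - \<beta> < \<P>(\<omega> in M. 0 < s \<omega> + \<epsilon> - t \<omega>)" by (auto simp: V_def)
      moreover have [measurable]: "t \<in> L0 M" using t by (rule measurable_F_into_M)
      ultimately obtain \<kappa> where \<kappa>: "0 < \<kappa>" "1 - \<beta> < \<P>(\<omega> in M. \<kappa> < s \<omega> + \<epsilon> - t \<omega>)"
        using prob_greater_margin[of "\<lambda>\<omega>. s \<omega> + \<epsilon> - t \<omega>" "1 - \<beta>"] by auto
      let ?A = "{\<omega> \<in> space M. \<kappa> < s \<omega> + \<epsilon> - t \<omega>}"
      define b where "b = prob ?A - (1 - \<beta>)"
      have b: "0 < b" "b < 1"
        using \<kappa>(2) \<beta> prob_le_1[of ?A] unfolding b_def by linarith+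
      let ?N = "{x \<in> L0 F. 1 - b < \<P>(\<omega> in M. \<bar>x \<omega>\<bar> < \<kappa>)}"
      have N: "?N \<in> Teps_nhds_L0 M F"
        unfolding Teps_nhds_L0_def using b \<kappa>(1) by (intro CollectI exI[of _ \<kappa>] exI[of _ b]) auto
      show "\<exists>N\<in>Teps_nhds_L0 M F. \<forall>y\<in>L0 F. (\<lambda>\<omega>. y \<omega> - t \<omega>) \<in> N \<longrightarrow> y \<in> V"
      proof (intro bexI[OF _ N] ballI impI)
        fix y assume y: "y \<in> L0 F" and yN: "(\<lambda>\<omega>. y \<omega> - t \<omega>) \<in> ?N"
        have [measurable]: "y \<in> L0 M" using y by (rule measurable_F_into_M)
        let ?B = "{\<omega> \<in> space M. \<bar>y \<omega> - t \<omega>\<bar> < \<kappa>}"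
        have "1 - \<beta> < prob ?A + prob ?B - 1" using yN by (simp add: b_def)
        also have "\<dots> \<le> prob (?A \<inter> ?B)" by (intro prob_Int_ge) measurable
        also have "\<dots> \<le> \<P>(\<omega> in M. y \<omega> < s \<omega> + \<epsilon>)"
          by (intro finite_measure_mono) (auto simp: abs_less_iff)
        finally show "y \<in> V" using y by (simp add: V_def)
      qed
    qed (auto simp: V_def)
    have "x \<in> U" using x \<beta>(2) by (simp add: U_def)
    moreover have "s \<in> V" using s \<epsilon>(1) \<beta>(1) prob_space by (simp add: V_def)
    moreover have "U \<times> V \<subseteq> \<L> \<times> L0 F - ?C"
    proof clarify
      fix z t assume "z \<in> U" "t \<in> V"
      then have z: "z \<in> \<L>" "\<beta> < \<P>(\<omega> in M. \<epsilon> < f z \<omega> - s \<omega>)"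
        and t: "t \<in> L0 F" "1 - \<beta> < \<P>(\<omega> in M. t \<omega> < s \<omega> + \<epsilon>)" by (auto simp: U_def V_def)
      have [measurable]: "t \<in> L0 M" "f z \<in> L0 M"
        using measurable_F_into_M[OF t(1)] f_meas[OF z(1)] by auto
      let ?A = "{\<omega> \<in> space M. \<epsilon> < f z \<omega> - s \<omega>}" and ?B = "{\<omega> \<in> space M. t \<omega> < s \<omega> + \<epsilon>}"
      have "0 < prob ?A + prob ?B - 1" using z(2) t(2) by simp
      also have "\<dots> \<le> prob (?A \<inter> ?B)" by (intro prob_Int_ge) measurable
      also have "\<dots> \<le> \<P>(\<omega> in M. \<not> f z \<omega> \<le> t \<omega>)"
        by (intro finite_measure_mono) auto
      finally have "\<P>(\<omega> in M. \<not> f z \<omega> \<le> t \<omega>) \<noteq> 0" by simp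
      then have "\<not> (AE \<omega> in M. f z \<omega> \<le> t \<omega>)"
        by (subst (asm) prob_eq_0) auto
      then show "(z, t) \<in> \<L> \<times> L0 F - ?C" using z(1) t(1) by auto
    qed
    ultimately show "\<exists>U V. openin (Teps_LFp M F p) U \<and> openin (Teps_L0 M F) V \<and> x \<in> U \<and> s \<in> V \<and>
        U \<times> V \<subseteq> \<L> \<times> L0 F - ?C"
      using U V by blast
  qed
  then show ?thesis
    unfolding Teps_lsc_def closedin_def topspace_prod_topology topspace_Teps_LFp topspace_Teps_L0
    by auto
qed

end

theorem theorem4p31:
  fixes M F :: "'a measure"
    and p r :: real
    and q :: ereal
    and f fbar :: "('a \<Rightarrow> real) \<Rightarrow> 'a \<Rightarrow> real"
  assumes "prob_space M"
    and "subalgebra M F"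
    and "1 \<le> r" and "r \<le> p"
    and "1 \<le> q" and "1 / ereal p + 1 / q = 1"
    and "Lp_cond_risk_measure M F p r f"
    and "L0_convex M F (Lp M M (ereal p)) f"
    and "LFp_cond_risk_measure M F p fbar"
    and "L0_convex M F (LFp M F (ereal p)) fbar"
    and "\<forall>x\<in>Lp M M (ereal p). AE \<omega> in M. fbar x \<omega> = f x \<omega>"
  shows "let
      stmt1 = dual_representation M F (Lp M M (ereal p)) f
                {y \<in> Lp M M q. cond_moment M F q y \<in> Lp M F \<infinity>};
      stmt2 = (\<forall>\<gamma>::real. \<gamma> > 0 \<longrightarrow> dual_representation M F (Lp M M (ereal p)) f
                {y \<in> Lp M M q. cond_moment M F q y \<in> Lp M F (ereal \<gamma>)});
      stmt3 = dual_representation M F (Lp M M (ereal p)) f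
                {y \<in> Lp M M q. cond_moment M F q y
                   \<in> Lp M F (if p = r then \<infinity> else ereal (r * (p - 1) / (p - r)))};
      stmt4 = dual_representation M F (Lp M M (ereal p)) f (LFp M F q);
      stmt5 = dual_representation M F (LFp M F (ereal p)) fbar (LFp M F q);
      stmt6 = Teps_lsc M F p fbar;
      stmt6' = Tc_lsc M F p fbar;
      stmt7 = continuous_map (Tc_LFp M F p) (Tc_L0 M F) fbar
    in (stmt1 \<longleftrightarrow> stmt2) \<and> (stmt2 \<longleftrightarrow> stmt3) \<and> (stmt3 \<longleftrightarrow> stmt4) \<and> (stmt4 \<longleftrightarrow> stmt5) \<and>
       (stmt5 \<longleftrightarrow> stmt6) \<and> (stmt6 \<longleftrightarrow> stmt6') \<and> (stmt6' \<longleftrightarrow> stmt7)"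
proof -
  have p: "1 \<le> p" using assms(3,4) by simp
  interpret prob_space M by fact
  interpret LFp_convex_risk_measure M F p fbar
    using assms(2,9,10) p by unfold_locales
  have X: "Lp M M (ereal p) \<subseteq> LFp M F (ereal p)"
    using p by (intro Lp_subset_LFp) simp
  have f: "f x \<in> L0 F" if "x \<in> Lp M M (ereal p)" for x
    using assms(7) that by (auto simp: Lp_cond_risk_measure_def cond_risk_measure_def Lp_def)
  \<comment> \<open>The locale is instantiated with \<open>fbar\<close>, and \<open>f\<close> enters
    as its a.e. restriction. The subgradients of the extension thus represent
    \<open>f\<close>.\<close>
  have rep: "dual_representation M F (Lp M M (ereal p)) f Y" if "strongly_bounded q \<subseteq> Y" for Y
    using assms(11) that by (intro dual_representation_superset[OF assms(5,6) X f]) auto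
  have q: "0 \<le> q" using assms(5) by (rule order_trans[rotated]) simp
  have \<gamma>: "strongly_bounded q \<subseteq> {y \<in> Lp M M q. cond_moment M F q y \<in> Lp M F (ereal \<gamma>)}"
    if "0 < \<gamma>" for \<gamma>
    using Lp_infinity_subset[OF that] by auto
  have "dual_representation M F (Lp M M (ereal p)) f
      {y \<in> Lp M M q. cond_moment M F q y \<in> Lp M F (if p = r then \<infinity> else ereal (r * (p - 1) / (p - r)))}"
  proof (cases "p = r")
    case False
    \<comment> \<open>Here \<open>p > r \<ge> 1\<close>, so the exponent is a positive real and
      falls under the inclusion for general \<gamma>.\<close>
    then have "0 < r * (p - 1) / (p - r)" using assms(3,4) by simp
    from rep[OF \<gamma>[OF this]] False show ?thesis by simp
  qed (use rep[of "strongly_bounded q"] in simp)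
  moreover have bd: "strongly_bounded q \<subseteq> LFp M F q"
    using Lp_subset_LFp[OF q] by auto
  moreover have "dual_representation M F (LFp M F (ereal p)) fbar (LFp M F q)"
    using f_measurable bd by (intro dual_representation_superset[OF assms(5,6)]) auto
  ultimately show ?thesis
    unfolding Let_def
    using rep[of "strongly_bounded q"] rep[OF \<gamma>] rep[OF bd]
      Teps_lower_semicontinuous Tc_lower_semicontinuous Tc_continuous by simp
qed

end
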